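(* Let $1<p\le 5$, let $1\le m\le 5$ satisfy $p\frac{m+1}{m}<6$, and suppose: (i) $\gamma\in W^{1,\infty}_{loc}(\mathbb{R}^+)$ is bounded and nonnegative on $\mathbb{R}^+=[0,+\infty)$; (ii) $g:\mathbb{R}\to\mathbb{R}$ is continuous and monotone increasing with $g(0)=0$, and there are constants $b_1,b_2>0$ such that $b_1|s|^{m+1}\le g(s)s\le b_2|s|^{m+1}$ for all $|s|>1$; (iii) $u_0\in H_0^1(\Omega)$ and $u_1\in L^2(\Omega)$; (iv) $$0<E(0)<\Big(\frac12-\frac1{p+1}\Big)\Big(\frac{\omega^{\frac{p+1}{2}}}{M^{p+1}}\Big)^{\frac{2}{p-1}},\qquad a(u_0,u_0)<\Big(\frac{\omega^{\frac{p+1}{2}}}{M^{p+1}}\Big)^{\frac{2}{p-1}};$$ (v) there is a constant $\gamma_0$ such that $\gamma(t)\ge\gamma_0>0$ for all $t\ge 0$; (vi) there exists a strictly increasing and odd function $h\in C^1([-1,1])$ such that $|h(s)s|\le g(s)s\le|h^{-1}(s)s|$ for $|s|\le 1$, where $h^{-1}$ is the inverse function of $h$. Let $u$ be the global weak solution of $$u_{tt}-\mathcal{A}u+\gamma(t)g(u_t)=|u|^{p-1}u\ \text{ in }\Omega\times(0,\infty),\quad u=0\ \text{ on }\partial\Omega\times(0,\infty),\quad u(\cdot,0)=u_0,\ u_t(\cdot,0)=u_1,$$ and let $E(t)$ be its total energy. Put $H(s):=h(s)s$. Then there is a constant $C>0$ independent of $t$ such that for all $t\ge1$ (for which $H^{-1}(1/t)$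 is defined) $$E(t)\le C\,E(0)\left(H^{-1}\Big(\frac1t\Big)\right)^2.$$
   Context: $\Omega\subset\mathbb{R}^3$ is a bounded domain with $C^\infty$ boundary (so $n=3$). $\mathcal{A}u=\mathrm{div}(A(x)\nabla u)=\sum_{i,j=1}^{n}\frac{\partial}{\partial x_i}\big(a_{ij}(x)\frac{\partial u}{\partial x_j}\big)$, where $A(x)=(a_{ij}(x))$ is symmetric and positive definite, $a_{ij}\in C^\infty(\bar\Omega)$, and $\sum_{i,j=1}^n a_{ij}(x)\xi_i\xi_j\ge\omega\sum_{i=1}^n\xi_i^2$ for all $x\in\bar\Omega$, $\xi\in\mathbb{R}^n$, with a constant $\omega>0$. The bilinear form $a$ on $H_0^1(\Omega)$ is $a(u,v)=\int_\Omega A\nabla u\cdot\nabla v\,dx$; thus $a(u,u)\ge\omega\|\nabla u\|_2^2$. $\|\cdot\|_q$ is the norm of $L^q(\Omega)$ and $(\cdot,\cdot)$ is the $L^2(\Omega)$ inner product. $M$ is the optimal constant of the embedding $H_0^1(\Omega)\hookrightarrow L^{p+1}(\Omega)$, i.e. the smallest constant with $\|v\|_{p+1}\le M\|\nabla v\|_2$ for all $v\in H_0^1(\Omega)$. Weak solution on $[0,T]$: a function $u\in C([0,T];H_0^1(\Omega))$ with $u_t\in C([0,T];L^2(\Omega))\cap L^{m+1}(\Omega\times(0,T))$, having the prescribed initial data, such that for all $t\in[0,T]$ $$(u_t(t),\phi(t))-(u_t(0),\phi(0))+\int_0^t a(u(s),\phi(s))ds-\int_0^t\!\!\int_\Omega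 u_t\phi_t\,dxds+\int_0^t\!\!\int_\Omega\gamma(s)g(u_t(s))\phi(s)\,dxds=\int_0^t\!\!\int_\Omega |u(s)|^{p-1}u(s)\phi(s)\,dxds$$ for all $\phi\in C([0,T];H_0^1(\Omega))\cap L^{m+1}(\Omega\times(0,T))$ with $\phi_t\in C([0,T];L^2(\Omega))$. A global weak solution is one that is a weak solution on $[0,T]$ for every $T>0$. Quadratic energy: $\mathcal{E}(t)=\frac12\|u_t(t)\|_2^2+\frac12a(u(t),u(t))$. Total energy: $E(t)=\mathcal{E}(t)-\frac1{p+1}\|u(t)\|_{p+1}^{p+1}$; in particular $E(0)=\frac12\|u_1\|_2^2+\frac12a(u_0,u_0)-\frac1{p+1}\|u_0\|_{p+1}^{p+1}$. Under (i)–(iv) a global weak solution exists and satisfies the energy identity $E(t)+\int_0^t\int_\Omega\gamma(s)g(u_t)u_t\,dxds=E(0)$, so that $E$ is nonincreasing and $E'(t)=-\int_\Omega\gamma(t)g(u_t)u_t\,dx$; "the global weak solution" refers to this solution. In (vi), the upper bound is understood for those $s$ with $|s|\le1$ at which $h^{-1}(s)$ is defined (i.e. $|s|\le h(1)$). $H^{-1}$ denotes the inverse of the strictly increasing function $H:[0,1]\to[0,h(1)]$. *)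

theory Defs
  imports "HOL-Analysis.Analysis"
begin

text \<open>
  Elements of function spaces are represented by functions on the whole Euclidean space, of which
  only the values almost everywhere in the relevant set matter. Curves in a function space are
  functions \<open>w :: real \<Rightarrow> 'a \<Rightarrow> real\<close>, with \<open>w t\<close> a representative of the value at time \<open>t\<close>.
\<close>

subsection \<open>Smooth functions and smooth bounded domains\<close>

primrec Ck_on :: "nat \<Rightarrow> 'a::euclidean_space set \<Rightarrow> ('a \<Rightarrow> real) \<Rightarrow> bool" where
  "Ck_on 0 S f \<longleftrightarrow> continuous_on S f"
| "Ck_on (Suc k) S f \<longleftrightarrow>
     (\<forall>x\<in>S. f differentiable (at x)) \<and>
     (\<forall>i\<in>Basis. Ck_on k S (\<lambda>x. frechet_derivative f (at x) i))"

text \<open>Meant for open \<open>S\<close>.\<close>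

definition smooth_on :: "'a::euclidean_space set \<Rightarrow> ('a \<Rightarrow> real) \<Rightarrow> bool" where
  "smooth_on S f \<longleftrightarrow> (\<forall>k. Ck_on k S f)"

text \<open>\<open>C\<^sup>\<infinity>\<close> on a closed set: restrictions of smooth functions on a neighbourhood.\<close>

definition smooth_on_closed :: "'a::euclidean_space set \<Rightarrow> ('a \<Rightarrow> real) \<Rightarrow> bool" where
  "smooth_on_closed K f \<longleftrightarrow>
     (\<exists>U F. open U \<and> K \<subseteq> U \<and> smooth_on U F \<and> (\<forall>x\<in>K. F x = f x))"

text \<open>
  Near each boundary point the domain is, in suitably rotated coordinates, the part of a ball
  lying above the graph of a smooth function. Here \<open>e\<close> is the ``vertical'' unit vector,
  \<open>x - (x \<bullet> e) *\<^sub>R e\<close> is the horizontal part of \<open>x\<close>, and \<open>f\<close> is only evaluated on the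
  hyperplane orthogonal to \<open>e\<close>.
\<close>

definition smooth_boundary :: "'a::euclidean_space set \<Rightarrow> bool" where
  "smooth_boundary \<Omega> \<longleftrightarrow>
     (\<forall>x0\<in>frontier \<Omega>. \<exists>r>0. \<exists>e f. norm e = 1 \<and> smooth_on UNIV f \<and>
        \<Omega> \<inter> ball x0 r = {x \<in> ball x0 r. x \<bullet> e > f (x - (x \<bullet> e) *\<^sub>R e)})"

definition smooth_bounded_domain :: "'a::euclidean_space set \<Rightarrow> bool" where
  "smooth_bounded_domain \<Omega> \<longleftrightarrow>
     open \<Omega> \<and> connected \<Omega> \<and> \<Omega> \<noteq> {} \<and> bounded \<Omega> \<and> smooth_boundary \<Omega>"

subsection \<open>Lebesgue and Sobolev spaces\<close>

definition Lspace :: "real \<Rightarrow> 'a::euclidean_space set \<Rightarrow> ('a \<Rightarrow> 'b::euclidean_space) set" where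
  "Lspace q S = {f \<in> borel_measurable (lebesgue_on S).
                   integrable (lebesgue_on S) (\<lambda>x. norm (f x) powr q)}"

definition Lnorm :: "real \<Rightarrow> 'a::euclidean_space set \<Rightarrow> ('a \<Rightarrow> 'b::euclidean_space) \<Rightarrow> real" where
  "Lnorm q S f = (\<integral>x. norm (f x) powr q \<partial>lebesgue_on S) powr (1 / q)"

definition Linf_space :: "'a::euclidean_space set \<Rightarrow> ('a \<Rightarrow> 'b::euclidean_space) set" where
  "Linf_space S = {f \<in> borel_measurable (lebesgue_on S).
                     \<exists>C. AE x in lebesgue_on S. norm (f x) \<le> C}"

definition L2_inner :: "'a::euclidean_space set \<Rightarrow> ('a \<Rightarrow> real) \<Rightarrow> ('a \<Rightarrow> real) \<Rightarrow> real" where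
  "L2_inner S f g = (\<integral>x. f x * g x \<partial>lebesgue_on S)"

text \<open>\<open>C\<^sub>c\<^sup>\<infinity>(\<Omega>)\<close>, each function being extended by zero.\<close>

definition test_functions :: "'a::euclidean_space set \<Rightarrow> ('a \<Rightarrow> real) set" where
  "test_functions \<Omega> = {\<phi>. smooth_on UNIV \<phi> \<and> compact (closure {x. \<phi> x \<noteq> 0}) \<and>
                          closure {x. \<phi> x \<noteq> 0} \<subseteq> \<Omega>}"

definition has_weak_gradient ::
  "'a::euclidean_space set \<Rightarrow> ('a \<Rightarrow> real) \<Rightarrow> ('a \<Rightarrow> 'a) \<Rightarrow> bool" where
  "has_weak_gradient \<Omega> u G \<longleftrightarrow>
     (\<forall>K. compact K \<and> K \<subseteq> \<Omega> \<longrightarrow> u absolutely_integrable_on K \<and> G absolutely_integrable_on K) \<and>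
     (\<forall>\<phi>\<in>test_functions \<Omega>. \<forall>i\<in>Basis.
        (\<integral>x. u x * frechet_derivative \<phi> (at x) i \<partial>lebesgue_on \<Omega>) =
        - (\<integral>x. (G x \<bullet> i) * \<phi> x \<partial>lebesgue_on \<Omega>))"

text \<open>Determined up to almost everywhere equality whenever a weak gradient exists.\<close>

definition weak_grad :: "'a::euclidean_space set \<Rightarrow> ('a \<Rightarrow> real) \<Rightarrow> 'a \<Rightarrow> 'a" where
  "weak_grad \<Omega> u = (SOME G. has_weak_gradient \<Omega> u G)"

definition H1 :: "'a::euclidean_space set \<Rightarrow> ('a \<Rightarrow> real) set" where
  "H1 \<Omega> = {u \<in> Lspace 2 \<Omega>. \<exists>G. has_weak_gradient \<Omega> u G \<and> G \<in> Lspace 2 \<Omega>}"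

definition H1_norm :: "'a::euclidean_space set \<Rightarrow> ('a \<Rightarrow> real) \<Rightarrow> real" where
  "H1_norm \<Omega> u = sqrt ((Lnorm 2 \<Omega> u)\<^sup>2 + (Lnorm 2 \<Omega> (weak_grad \<Omega> u))\<^sup>2)"

definition H10 :: "'a::euclidean_space set \<Rightarrow> ('a \<Rightarrow> real) set" where
  "H10 \<Omega> = {u \<in> H1 \<Omega>. \<exists>\<phi> :: nat \<Rightarrow> 'a \<Rightarrow> real. (\<forall>n. \<phi> n \<in> test_functions \<Omega>) \<and>
               (\<lambda>n. H1_norm \<Omega> (\<lambda>x. \<phi> n x - u x)) \<longlonglongrightarrow> 0}"

text \<open>
  \<open>W\<^sup>1\<^sup>,\<^sup>\<infinity>\<close> locally on the closed half-line \<open>[0,\<infinity>)\<close>, i.e. on \<open>(0,T)\<close> for every \<open>T\<close>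
  (up to and including the endpoint \<open>0\<close>).
\<close>

definition W1inf_loc_half_line :: "(real \<Rightarrow> real) \<Rightarrow> bool" where
  "W1inf_loc_half_line \<gamma> \<longleftrightarrow>
     (\<forall>T>0. \<gamma> \<in> Linf_space {0<..<T} \<and>
        (\<exists>\<eta>. has_weak_gradient {0<..<T} \<gamma> \<eta> \<and> \<eta> \<in> Linf_space {0<..<T}))"

text \<open>The optimal constant of the embedding of \<open>H10 \<Omega>\<close> (with the gradient norm) into \<open>L\<^sup>q\<close>.\<close>

definition embedding_constant :: "'a::euclidean_space set \<Rightarrow> real \<Rightarrow> real" where
  "embedding_constant \<Omega> q =
     (LEAST M. \<forall>v\<in>H10 \<Omega>. v \<in> Lspace q \<Omega> \<and> Lnorm q \<Omega> v \<le> M * Lnorm 2 \<Omega> (weak_grad \<Omega> v))"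

subsection \<open>Curves in function spaces\<close>

text \<open>\<open>w \<in> C([0,T]; X)\<close>, where \<open>X\<close> carries the norm \<open>N\<close>.\<close>

definition cont_curve ::
  "real \<Rightarrow> ('a \<Rightarrow> real) set \<Rightarrow> (('a \<Rightarrow> real) \<Rightarrow> real) \<Rightarrow> (real \<Rightarrow> 'a \<Rightarrow> real) \<Rightarrow> bool" where
  "cont_curve T X N w \<longleftrightarrow>
     (\<forall>t\<in>{0..T}. w t \<in> X \<and> ((\<lambda>s. N (\<lambda>x. w s x - w t x)) \<longlongrightarrow> 0) (at t within {0..T}))"

text \<open>
  \<open>w'\<close> is the time derivative of \<open>w\<close> on \<open>[0,T]\<close>, as a limit of difference quotients in
  \<open>L\<^sup>2(\<Omega>)\<close>; for \<open>w, w' \<in> C([0,T]; L\<^sup>2(\<Omega>))\<close> this is the same as the distributional derivative.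
\<close>

definition L2_time_derivative ::
  "real \<Rightarrow> 'a::euclidean_space set \<Rightarrow> (real \<Rightarrow> 'a \<Rightarrow> real) \<Rightarrow> (real \<Rightarrow> 'a \<Rightarrow> real) \<Rightarrow> bool" where
  "L2_time_derivative T \<Omega> w w' \<longleftrightarrow>
     (\<forall>t\<in>{0..T}. ((\<lambda>s. Lnorm 2 \<Omega> (\<lambda>x. (w s x - w t x) / (s - t) - w' t x)) \<longlongrightarrow> 0)
                   (at t within {0..T}))"

text \<open>
  \<open>w \<in> L\<^sup>q(\<Omega> \<times> (0,T))\<close>. This asks for a representative that is jointly measurable; every
  curve in \<open>C([0,T]; L\<^sup>2(\<Omega>))\<close> has one.
\<close>

definition in_space_time_L ::
  "real \<Rightarrow> real \<Rightarrow> 'a::euclidean_space set \<Rightarrow> (real \<Rightarrow> 'a \<Rightarrow> real) \<Rightarrow> bool" where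
  "in_space_time_L q T \<Omega> w \<longleftrightarrow> (\<lambda>(t, x). w t x) \<in> Lspace q ({0<..<T} \<times> \<Omega>)"

subsection \<open>Weak solutions and energy\<close>

definition form_a ::
  "(real^'n) set \<Rightarrow> (real^'n \<Rightarrow> real^'n^'n) \<Rightarrow> (real^'n \<Rightarrow> real) \<Rightarrow> (real^'n \<Rightarrow> real) \<Rightarrow> real" where
  "form_a \<Omega> A u v = (\<integral>x. (A x *v weak_grad \<Omega> u x) \<bullet> weak_grad \<Omega> v x \<partial>lebesgue_on \<Omega>)"

text \<open>\<open>\<phi>'\<close> plays the role of \<open>\<phi>\<^sub>t\<close>.\<close>

definition admissible_test_curve ::
  "(real^'n) set \<Rightarrow> real \<Rightarrow> real \<Rightarrow> (real \<Rightarrow> real^'n \<Rightarrow> real) \<Rightarrow> (real \<Rightarrow> real^'n \<Rightarrow> real) \<Rightarrow> bool"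
  where
  "admissible_test_curve \<Omega> m T \<phi> \<phi>' \<longleftrightarrow>
     cont_curve T (H10 \<Omega>) (H1_norm \<Omega>) \<phi> \<and>
     in_space_time_L (m + 1) T \<Omega> \<phi> \<and>
     L2_time_derivative T \<Omega> \<phi> \<phi>' \<and>
     cont_curve T (Lspace 2 \<Omega>) (Lnorm 2 \<Omega>) \<phi>'"

text \<open>\<open>u'\<close> plays the role of \<open>u\<^sub>t\<close>; the initial data are \<open>u0\<close> and \<open>u1\<close>.\<close>

definition weak_solution ::
  "(real^'n) set \<Rightarrow> (real^'n \<Rightarrow> real^'n^'n) \<Rightarrow> (real \<Rightarrow> real) \<Rightarrow> (real \<Rightarrow> real) \<Rightarrow> real \<Rightarrow> real \<Rightarrow>
   (real^'n \<Rightarrow> real) \<Rightarrow> (real^'n \<Rightarrow> real) \<Rightarrow> real \<Rightarrow>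
   (real \<Rightarrow> real^'n \<Rightarrow> real) \<Rightarrow> (real \<Rightarrow> real^'n \<Rightarrow> real) \<Rightarrow> bool" where
  "weak_solution \<Omega> A \<gamma> g p m u0 u1 T u u' \<longleftrightarrow>
     cont_curve T (H10 \<Omega>) (H1_norm \<Omega>) u \<and>
     L2_time_derivative T \<Omega> u u' \<and>
     cont_curve T (Lspace 2 \<Omega>) (Lnorm 2 \<Omega>) u' \<and>
     in_space_time_L (m + 1) T \<Omega> u' \<and>
     (AE x in lebesgue_on \<Omega>. u 0 x = u0 x) \<and>
     (AE x in lebesgue_on \<Omega>. u' 0 x = u1 x) \<and>
     (\<forall>t\<in>{0..T}. \<forall>\<phi> \<phi>'. admissible_test_curve \<Omega> m T \<phi> \<phi>' \<longrightarrow>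
        L2_inner \<Omega> (u' t) (\<phi> t) - L2_inner \<Omega> (u' 0) (\<phi> 0)
        + (\<integral>s. form_a \<Omega> A (u s) (\<phi> s) \<partial>lebesgue_on {0..t})
        - (\<integral>s. (\<integral>x. u' s x * \<phi>' s x \<partial>lebesgue_on \<Omega>) \<partial>lebesgue_on {0..t})
        + (\<integral>s. (\<integral>x. \<gamma> s * g (u' s x) * \<phi> s x \<partial>lebesgue_on \<Omega>) \<partial>lebesgue_on {0..t})
        = (\<integral>s. (\<integral>x. \<bar>u s x\<bar> powr (p - 1) * u s x * \<phi> s x \<partial>lebesgue_on \<Omega>) \<partial>lebesgue_on {0..t}))"

definition global_weak_solution ::
  "(real^'n) set \<Rightarrow> (real^'n \<Rightarrow> real^'n^'n) \<Rightarrow> (real \<Rightarrow> real) \<Rightarrow> (real \<Rightarrow> real) \<Rightarrow> real \<Rightarrow> real \<Rightarrow>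
   (real^'n \<Rightarrow> real) \<Rightarrow> (real^'n \<Rightarrow> real) \<Rightarrow>
   (real \<Rightarrow> real^'n \<Rightarrow> real) \<Rightarrow> (real \<Rightarrow> real^'n \<Rightarrow> real) \<Rightarrow> bool" where
  "global_weak_solution \<Omega> A \<gamma> g p m u0 u1 u u' \<longleftrightarrow>
     (\<forall>T>0. weak_solution \<Omega> A \<gamma> g p m u0 u1 T u u')"

text \<open>Energies of a state with position \<open>w\<close> and velocity \<open>v\<close>.\<close>

definition quadratic_energy ::
  "(real^'n) set \<Rightarrow> (real^'n \<Rightarrow> real^'n^'n) \<Rightarrow> (real^'n \<Rightarrow> real) \<Rightarrow> (real^'n \<Rightarrow> real) \<Rightarrow> real" where
  "quadratic_energy \<Omega> A w v = 1 / 2 * (Lnorm 2 \<Omega> v)\<^sup>2 + 1 / 2 * form_a \<Omega> A w w"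

definition total_energy ::
  "(real^'n) set \<Rightarrow> (real^'n \<Rightarrow> real^'n^'n) \<Rightarrow> real \<Rightarrow> (real^'n \<Rightarrow> real) \<Rightarrow> (real^'n \<Rightarrow> real) \<Rightarrow> real"
  where
  "total_energy \<Omega> A p w v =
     quadratic_energy \<Omega> A w v - 1 / (p + 1) * Lnorm (p + 1) \<Omega> w powr (p + 1)"

definition energy_identity ::
  "(real^'n) set \<Rightarrow> (real^'n \<Rightarrow> real^'n^'n) \<Rightarrow> (real \<Rightarrow> real) \<Rightarrow> (real \<Rightarrow> real) \<Rightarrow> real \<Rightarrow>
   (real \<Rightarrow> real^'n \<Rightarrow> real) \<Rightarrow> (real \<Rightarrow> real^'n \<Rightarrow> real) \<Rightarrow> bool" where
  "energy_identity \<Omega> A \<gamma> g p u u' \<longleftrightarrow>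
     (\<forall>t\<ge>0. total_energy \<Omega> A p (u t) (u' t)
        + (\<integral>s. (\<integral>x. \<gamma> s * g (u' s x) * u' s x \<partial>lebesgue_on \<Omega>) \<partial>lebesgue_on {0..t})
        = total_energy \<Omega> A p (u 0) (u' 0))"

definition C1_on_interval :: "real \<Rightarrow> real \<Rightarrow> (real \<Rightarrow> real) \<Rightarrow> bool" where
  "C1_on_interval a b h \<longleftrightarrow>
     (\<exists>h'. continuous_on {a..b} h' \<and>
        (\<forall>s\<in>{a..b}. (h has_real_derivative h' s) (at s within {a..b})))"

end

theory Submission
  imports Defs
begin

text \<open>
  Everything rests on one inequality: there are \<open>T\<close> and \<open>K\<close> with
  \<open>E (t + T) \<le> K (r\<^sup>2 + (E t - E (t + T)) / h r)\<close> for all \<open>t \<ge> 0\<close> and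
  \<open>0 < r \<le> 1\<close>. By condition (iv) the solution stays in the potential well, where the source
  term is at most a fixed fraction, less than one, of the form \<open>a\<close>. Testing the equation with
  \<open>u\<close> itself on \<open>[t, t + T]\<close> therefore bounds the integral of the energy by the kinetic
  energy, the damping and boundary terms. Where \<open>\<bar>u\<^sub>t\<bar> \<le> r\<close> the kinetic energy density
  is at most \<open>r\<^sup>2\<close>; elsewhere it is at most a multiple of the dissipation divided by
  \<open>h r\<close>. The boundary terms are absorbed by taking \<open>T\<close> large. Choosing \<open>r\<^sup>2\<close>
  proportional to \<open>E ((n + 1) T)\<close> turns the inequality into growth of \<open>1 / r\<close> by a multiple
  of \<open>h r\<close> in each step, which gives \<open>H r \<le> C / n\<close> after \<open>n\<close> steps.

  The multiplier \<open>u\<close> is admissible only after passing to a jointly measurable representative,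
  and the optimal constant \<open>M\<close> is meaningful only because of the Sobolev inequality.
\<close>

text \<open>\<open>H\<close> is not assumed convex, so Jensen's inequality is not at hand to turn
  pointwise bounds by \<open>h\<close> into bounds by the energy. The level \<open>r\<close> takes
  its place: it stays free in the window inequality, every pointwise estimate splits at it, and only
  the recursion over windows ties it to the energy. The multiplier creates the cross term
  \<open>g (u' s x) * u s x\<close>, for which the split is not at \<open>r\<close> but at
  \<open>h r\<close>: below \<open>h r\<close> the upper bound on \<open>g\<close> gives
  \<open>\<bar>g v\<bar> \<le> r\<close>, while above it \<open>\<bar>g v\<bar>\<close> is at most
  the dissipation divided by \<open>h r\<close>, up to speed one. Large speeds bring in the power
  \<open>m + 1\<close> of \<open>u\<close>, which the bounded energy reduces to a multiple of the
  form \<open>a\<close>; half of the margin left by the potential well absorbs it. A second obstacle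
  is that curves are families of representatives, one for each time, with no joint measurability
  built in. Hence every notion used on them is shown to be insensitive to null sets, and space-time
  integrals are reached through Borel representatives.\<close>

subsection \<open>Smooth bump functions\<close>

text \<open>The powers of \<open>1 / s\<close> are carried along because differentiating
  \<open>exp (- (1 / s))\<close> produces them; the family is thus closed under differentiation up
  to linear combinations. Index 0 is the classical flat function.\<close>

definition flat_exp :: "nat \<Rightarrow> real \<Rightarrow> real" where
  "flat_exp j s = (if s > 0 then (1 / s) ^ j * exp (- (1 / s)) else 0)"

text \<open>With \<open>x = 1 / s\<close> the right-hand limit is the decay of
  \<open>x ^ j / exp x\<close> at infinity; on the left the function is 0.\<close>

lemma flat_exp_at_0: "((\<lambda>s. flat_exp j s) \<longlongrightarrow> 0) (at 0)"
proof -
  have "((\<lambda>x. x ^ j / exp x) \<longlongrightarrow> 0) (at_top :: real filter)"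
    by (rule tendsto_power_div_exp_0)
  hence "((\<lambda>s. (inverse s) ^ j / exp (inverse s)) \<longlongrightarrow> 0) (at_right (0::real))"
    by (rule filterlim_compose) (rule filterlim_inverse_at_top_right)
  moreover have "eventually (\<lambda>s. (inverse s) ^ j / exp (inverse s) = flat_exp j s) (at_right (0::real))"
    unfolding eventually_at_right_field
    by (rule exI[of _ 1]) (auto simp: flat_exp_def exp_minus field_simps)
  ultimately have 1: "(flat_exp j \<longlongrightarrow> 0) (at_right 0)"
    by (blast intro: Lim_transform_eventually)
  have "eventually (\<lambda>s. 0 = flat_exp j s) (at_left (0::real))"
    unfolding eventually_at_left_field
    by (rule exI[of _ "-1"]) (auto simp: flat_exp_def)
  hence 2: "(flat_exp j \<longlongrightarrow> 0) (at_left 0)"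
    by (rule Lim_transform_eventually[rotated]) auto
  show ?thesis using 1 2 by (simp add: filterlim_split_at)
qed

lemma flat_exp_deriv:
  "(flat_exp j has_real_derivative (flat_exp (j + 2) s - real j * flat_exp (j + 1) s)) (at s)"
proof -
  consider "s > 0" | "s < 0" | "s = 0" by linarith
  thus ?thesis
  proof cases
    case 1
    have "((\<lambda>s. (1 / s) ^ j * exp (- (1 / s))) has_real_derivative
        (flat_exp (j + 2) s - real j * flat_exp (j + 1) s)) (at s)"
      using 1
      apply (auto intro!: derivative_eq_intros simp: flat_exp_def)
      apply (cases j)
       apply (auto simp: field_simps power2_eq_square)
      done
    moreover have "eventually (\<lambda>x. (1 / x) ^ j * exp (- (1 / x)) = flat_exp j x) (nhds s)"
      using eventually_nhds_in_open[of "{0<..}" s] 1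
      by (auto elim!: eventually_mono simp: flat_exp_def)
    ultimately show ?thesis
      by (subst DERIV_cong_ev[OF refl _ refl]) (auto simp: eq_commute elim: eventually_mono)
  next
    case 2
    have "eventually (\<lambda>x. flat_exp j x = 0) (nhds s)"
      using eventually_nhds_in_open[of "{..<0}" s] 2
      by (auto elim!: eventually_mono simp: flat_exp_def)
    hence "(flat_exp j has_real_derivative 0) (at s)"
      by (subst DERIV_cong_ev[OF refl _ refl, of _ "\<lambda>_. 0"]) auto
    thus ?thesis using 2 by (simp add: flat_exp_def)
  next
    case 3
    \<comment> \<open>At 0 the difference quotient of \<open>flat_exp j\<close> is
      \<open>flat_exp (Suc j)\<close> itself, so its limit is already known.\<close>
    have "eventually (\<lambda>s. flat_exp (Suc j) s = flat_exp j s / s) (at 0)"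
      by (rule eventually_mono[of "\<lambda>_. True"]) (auto simp: flat_exp_def)
    hence "((\<lambda>s. flat_exp j s / s) \<longlongrightarrow> 0) (at 0)"
      using flat_exp_at_0[of "Suc j"] by (rule Lim_transform_eventually[rotated])
    thus ?thesis using 3 by (simp add: has_field_derivative_iff flat_exp_def)
  qed
qed

lemma flat_exp_nonneg: "0 \<le> flat_exp j s" and flat_exp_0_le_1: "flat_exp 0 s \<le> 1"
  and flat_exp_0_eq_0_iff: "flat_exp 0 s = 0 \<longleftrightarrow> s \<le> 0"
  by (auto simp: flat_exp_def)

lemma flat_exp_0_tendsto: "0 < s \<Longrightarrow> (\<lambda>n. flat_exp 0 (real n * s)) \<longlonglongrightarrow> 1"
proof -
  assume s: "0 < s"
  have "(\<lambda>n. exp (- (1 / s) * (1 / real n))) \<longlonglongrightarrow> exp (- (1 / s) * 0)"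
    by (intro tendsto_intros lim_1_over_n)
  moreover have "eventually (\<lambda>n. exp (- (1 / s) * (1 / real n)) = flat_exp 0 (real n * s)) sequentially"
    using eventually_gt_at_top[of 0] by eventually_elim (use s in \<open>auto simp: flat_exp_def field_simps\<close>)
  ultimately show ?thesis by (auto intro: Lim_transform_eventually)
qed

text \<open>
  An algebra of functions that is closed under partial derivatives; this is what makes its members
  smooth without any further computation of higher derivatives.
\<close>

inductive_set flat_algebra :: "('a::euclidean_space \<Rightarrow> real) set" where
  const: "(\<lambda>_. c) \<in> flat_algebra"
| atom: "(\<lambda>x. flat_exp j (x \<bullet> a + d)) \<in> flat_algebra"
| add: "f \<in> flat_algebra \<Longrightarrow> g \<in> flat_algebra \<Longrightarrow> (\<lambda>x. f x + g x) \<in> flat_algebra"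
| mult: "f \<in> flat_algebra \<Longrightarrow> g \<in> flat_algebra \<Longrightarrow> (\<lambda>x. f x * g x) \<in> flat_algebra"

lemma flat_algebra_prod:
  "finite I \<Longrightarrow> (\<And>i. i \<in> I \<Longrightarrow> f i \<in> flat_algebra) \<Longrightarrow> (\<lambda>x. \<Prod>i\<in>I. f i x) \<in> flat_algebra"
  by (induction I rule: finite_induct) (auto intro: flat_algebra.intros)

lemma flat_algebra_derivative:
  assumes "f \<in> flat_algebra"
  shows "\<exists>D. (\<forall>x. (f has_derivative D x) (at x)) \<and> (\<forall>i. (\<lambda>x. D x i) \<in> flat_algebra)"
  using assms
proof induction
  case (const c)
  show ?case by (rule exI[of _ "\<lambda>_ _. 0"]) (auto intro: flat_algebra.const)
next
  case (atom j a d)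
  let ?D = "\<lambda>x i. (flat_exp (j + 2) (x \<bullet> a + d) + (- real j) * flat_exp (j + 1) (x \<bullet> a + d)) * (i \<bullet> a)"
  have "((\<lambda>x. flat_exp j (x \<bullet> a + d)) has_derivative ?D x) (at x)" for x
  proof -
    have 1: "((\<lambda>x. x \<bullet> a + d) has_derivative (\<lambda>i. i \<bullet> a)) (at x)"
      by (auto intro!: derivative_eq_intros)
    have 2: "(flat_exp j has_derivative
        (*) (flat_exp (j + 2) (x \<bullet> a + d) - real j * flat_exp (j + 1) (x \<bullet> a + d))) (at (x \<bullet> a + d))"
      using flat_exp_deriv[of j "x \<bullet> a + d"] by (simp add: has_field_derivative_def)
    show ?thesis using has_derivative_compose[OF 1 2] by simp
  qed
  moreover have "(\<lambda>x. ?D x i) \<in> flat_algebra" for i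
    by (intro flat_algebra.intros)
  ultimately show ?case by (intro exI[of _ ?D]) auto
next
  case (add f g)
  then obtain D D' where "\<forall>x. (f has_derivative D x) (at x)" "\<forall>i. (\<lambda>x. D x i) \<in> flat_algebra"
    "\<forall>x. (g has_derivative D' x) (at x)" "\<forall>i. (\<lambda>x. D' x i) \<in> flat_algebra" by blast
  thus ?case
    by (intro exI[of _ "\<lambda>x i. D x i + D' x i"])
       (auto intro!: flat_algebra.add has_derivative_add)
next
  case (mult f g)
  then obtain D D' where "\<forall>x. (f has_derivative D x) (at x)" "\<forall>i. (\<lambda>x. D x i) \<in> flat_algebra"
    "\<forall>x. (g has_derivative D' x) (at x)" "\<forall>i. (\<lambda>x. D' x i) \<in> flat_algebra" by blast
  thus ?case using mult.hyps
    by (intro exI[of _ "\<lambda>x i. f x * D' x i + D x i * g x"])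
       (auto intro!: flat_algebra.add flat_algebra.mult has_derivative_mult)
qed

lemma flat_algebra_smooth: "f \<in> flat_algebra \<Longrightarrow> smooth_on UNIV f"
proof -
  have "Ck_on k UNIV f" if "f \<in> flat_algebra" for k and f :: "'a \<Rightarrow> real"
    using that
  proof (induction k arbitrary: f)
    case 0
    then obtain D where "\<forall>x. (f has_derivative D x) (at x)" using flat_algebra_derivative by blast
    thus ?case by (auto intro!: continuous_at_imp_continuous_on has_derivative_continuous)
  next
    case (Suc k)
    then obtain D where D: "\<forall>x. (f has_derivative D x) (at x)" "\<forall>i. (\<lambda>x. D x i) \<in> flat_algebra"
      using flat_algebra_derivative by blast
    hence "frechet_derivative f (at x) = D x" for x
      by (metis frechet_derivative_at)
    thus ?case using D Suc.IH by (auto simp: differentiable_def)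
  qed
  thus "f \<in> flat_algebra \<Longrightarrow> smooth_on UNIV f" by (auto simp: smooth_on_def)
qed

text \<open>Each coordinate contributes one factor that vanishes to the left of \<open>a\<close> and
  one that vanishes to the right of \<open>b\<close>. Since \<open>exp (- 1 / (n s))\<close> tends
  to 1 for \<open>s > 0\<close>, the bumps increase with \<open>n\<close> to the indicator of the
  open box.\<close>

definition box_bump :: "'a::euclidean_space \<Rightarrow> 'a \<Rightarrow> nat \<Rightarrow> 'a \<Rightarrow> real" where
  "box_bump a b n x =
     (\<Prod>i\<in>Basis. flat_exp 0 (real n * ((x - a) \<bullet> i)) * flat_exp 0 (real n * ((b - x) \<bullet> i)))"

lemma box_bump_smooth: "smooth_on UNIV (box_bump a b n)"
proof -
  have "(\<lambda>x. \<Prod>i\<in>Basis. flat_exp 0 (x \<bullet> (real n *\<^sub>R i) + - (real n * (a \<bullet> i))) *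
          flat_exp 0 (x \<bullet> (- (real n *\<^sub>R i)) + real n * (b \<bullet> i))) \<in> flat_algebra"
    by (intro flat_algebra_prod flat_algebra.intros) auto
  also have "(\<lambda>x. \<Prod>i\<in>Basis. flat_exp 0 (x \<bullet> (real n *\<^sub>R i) + - (real n * (a \<bullet> i))) *
          flat_exp 0 (x \<bullet> (- (real n *\<^sub>R i)) + real n * (b \<bullet> i))) = box_bump a b n"
    unfolding box_bump_def by (auto simp: algebra_simps fun_eq_iff)
  finally show ?thesis by (rule flat_algebra_smooth)
qed

lemma box_bump_bounds: "0 \<le> box_bump a b n x" "box_bump a b n x \<le> 1"
  unfolding box_bump_def
  by (auto intro!: prod_nonneg prod_le_1 mult_nonneg_nonneg mult_le_one
      simp: flat_exp_nonneg flat_exp_0_le_1)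

lemma box_bump_outside: "x \<notin> box a b \<Longrightarrow> box_bump a b n x = 0"
  by (force simp: box_bump_def mem_box flat_exp_0_eq_0_iff inner_diff_left not_less
      mult_nonneg_nonpos)

lemma box_bump_tendsto: "(\<lambda>n. box_bump a b n x) \<longlonglongrightarrow> indicator (box a b) x"
proof (cases "x \<in> box a b")
  case True
  have "(\<lambda>n. box_bump a b n x) \<longlonglongrightarrow> (\<Prod>i\<in>(Basis::'a set). 1 * 1)"
    unfolding box_bump_def
    by (intro tendsto_prod tendsto_mult flat_exp_0_tendsto)
       (use True in \<open>auto simp: mem_box inner_diff_left\<close>)
  thus ?thesis using True by simp
next
  case False
  thus ?thesis by (simp add: box_bump_outside)
qed

lemma box_bump_test_function:
  assumes "cbox a b \<subseteq> \<Omega>"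
  shows "box_bump a b n \<in> test_functions \<Omega>"
proof -
  have "{x. box_bump a b n x \<noteq> 0} \<subseteq> cbox a b"
    using box_bump_outside box_subset_cbox by blast
  hence 1: "closure {x. box_bump a b n x \<noteq> 0} \<subseteq> cbox a b"
    by (rule closure_minimal) (rule closed_cbox)
  hence "compact (closure {x. box_bump a b n x \<noteq> 0})"
    by (metis bounded_cbox bounded_subset closed_closure compact_eq_bounded_closed)
  thus ?thesis using 1 assms box_bump_smooth by (auto simp: test_functions_def)
qed

section \<open>Integration tools and the fundamental lemma of the calculus of variations\<close>

lemma integrable_lebesgue_on:
  fixes f :: "'a::euclidean_space \<Rightarrow> 'b::{banach, second_countable_topology}"
  assumes "integrable lebesgue f" "S \<in> sets lebesgue"
  shows "integrable (lebesgue_on S) f"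
proof -
  have "integrable lebesgue (\<lambda>x. indicat_real S x *\<^sub>R f x)"
    using assms by (intro integrable_mult_indicator)
  thus ?thesis using assms by (subst integrable_restrict_space) auto
qed

lemma sets_lebesgue_open: "open S \<Longrightarrow> S \<in> sets lebesgue"
  by auto

lemma integral_translation_lborel:
  fixes f :: "'a::euclidean_space \<Rightarrow> real"
  assumes "f \<in> borel_measurable borel"
  shows "(\<integral>x. f (c + x) \<partial>lborel) = (\<integral>x. f x \<partial>lborel)"
proof -
  have "(\<integral>x. f x \<partial>lborel) = (\<integral>x. f x \<partial>(distr lborel borel ((+) c)))"
    by (simp add: lborel_distr_plus)
  also have "\<dots> = (\<integral>x. f (c + x) \<partial>lborel)"
    using assms by (subst integral_distr) auto
  finally show ?thesis by simp
qed

text \<open>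
  Integrals are translation invariant, so the integrals of all difference quotients vanish.
\<close>

lemma integral_directional_derivative_eq_0:
  fixes F :: "'a::euclidean_space \<Rightarrow> real"
  assumes D: "\<And>x. (F has_derivative D x) (at x)"
    and cont: "continuous_on UNIV (\<lambda>x. D x v)"
    and supp: "compact K" "\<And>x. x \<notin> K \<Longrightarrow> F x = 0" "\<And>x. x \<notin> K \<Longrightarrow> D x v = 0"
  shows "(\<integral>x. D x v \<partial>lborel) = 0"
proof -
  have "continuous_on UNIV F"
    using D by (auto intro!: continuous_at_imp_continuous_on has_derivative_continuous)
  hence F_meas [measurable]: "F \<in> borel_measurable borel"
    by (rule borel_measurable_continuous_onI)
  have D_meas [measurable]: "(\<lambda>x. D x v) \<in> borel_measurable borel"
    using cont by (rule borel_measurable_continuous_onI)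
  have "bounded ((\<lambda>x. D x v) ` K)"
    using supp(1) cont by (intro compact_imp_bounded compact_continuous_image) (auto intro: continuous_on_subset)
  then obtain B where B: "\<And>x. x \<in> K \<Longrightarrow> \<bar>D x v\<bar> \<le> B" "0 < B"
    by (auto simp: bounded_pos)
  have B': "\<bar>D x v\<bar> \<le> B" for x using B supp(3)[of x] by (cases "x \<in> K") auto
  obtain R where R: "K \<subseteq> cball 0 R"
    using compact_imp_bounded[OF supp(1)] by (auto simp: bounded_iff subset_iff)
  \<comment> \<open>Difference quotients in direction \<open>v\<close> with step
    \<open>1 / Suc n\<close>. They are dominated uniformly in \<open>n\<close>: the mean value
    theorem bounds them by \<open>B\<close>, and they vanish outside a ball enlarged by
    \<open>norm v\<close>, the largest shift.\<close>
  define q where "q n x = real (Suc n) * (F (v /\<^sub>R real (Suc n) + x) - F x)" for n x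
  have line: "((\<lambda>s. F (s *\<^sub>R v + x)) has_real_derivative D (s *\<^sub>R v + x) v) (at s)" for s x
  proof -
    have "((\<lambda>s. s *\<^sub>R v + x) has_derivative (\<lambda>s. s *\<^sub>R v)) (at s)"
      by (auto intro!: derivative_eq_intros)
    from has_derivative_compose[OF this D]
    have "((\<lambda>s. F (s *\<^sub>R v + x)) has_derivative (\<lambda>t. D (s *\<^sub>R v + x) (t *\<^sub>R v))) (at s)" .
    moreover have "D (s *\<^sub>R v + x) (t *\<^sub>R v) = D (s *\<^sub>R v + x) v * t" for t
      using has_derivative_linear[OF D] by (simp add: linear_cmul mult.commute)
    ultimately show ?thesis by (simp add: has_field_derivative_def mult.commute[of _ "D _ v"])
  qed
  have q_lim: "(\<lambda>n. q n x) \<longlonglongrightarrow> D x v" for x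
  proof -
    have "((\<lambda>h. (F (h *\<^sub>R v + x) - F x) / h) \<longlongrightarrow> D x v) (at 0)"
      using line[of x 0] by (simp add: DERIV_def)
    moreover have "filterlim (\<lambda>n. 1 / real (Suc n)) (at 0) sequentially"
      using LIMSEQ_Suc[OF lim_1_over_n[where 'a = real]] by (intro filterlim_atI) auto
    ultimately have "(\<lambda>n. (F ((1 / real (Suc n)) *\<^sub>R v + x) - F x) / (1 / real (Suc n))) \<longlonglongrightarrow> D x v"
      by (rule filterlim_compose)
    thus ?thesis by (simp add: q_def divide_inverse mult.commute)
  qed
  have q_bound: "\<bar>q n x\<bar> \<le> B * indicator (cball 0 (R + norm v)) x" for n x
  proof (cases "x \<in> cball 0 (R + norm v)")
    case True
    obtain z where "0 < z" "z < 1 / real (Suc n)" and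
      z: "F ((1 / real (Suc n)) *\<^sub>R v + x) - F (0 *\<^sub>R v + x) = (1 / real (Suc n) - 0) * D (z *\<^sub>R v + x) v"
      using MVT2[of 0 "1 / real (Suc n)" "\<lambda>s. F (s *\<^sub>R v + x)" "\<lambda>s. D (s *\<^sub>R v + x) v"] line by auto
    have "q n x = D (z *\<^sub>R v + x) v" using z by (simp add: q_def divide_inverse)
    thus ?thesis using B' True by simp
  next
    case False
    have "norm (v /\<^sub>R real (Suc n)) = norm v / real (Suc n)"
      by (simp add: divide_inverse mult.commute)
    also have "\<dots> \<le> norm v" by (simp add: field_simps)
    finally have "norm (v /\<^sub>R real (Suc n)) \<le> norm v" .
    hence "norm x \<le> norm (v /\<^sub>R real (Suc n) + x) + norm v"
      using norm_triangle_ineq4[of "v /\<^sub>R real (Suc n) + x" "v /\<^sub>R real (Suc n)"] by simp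
    moreover have "norm x > R + norm v" using False by simp
    ultimately have "\<not> norm (v /\<^sub>R real (Suc n) + x) \<le> R" "\<not> norm x \<le> R"
      using norm_ge_zero[of v] by linarith+
    hence "v /\<^sub>R real (Suc n) + x \<notin> K" "x \<notin> K"
      using R by (auto simp: subset_iff)
    thus ?thesis using supp False by (simp add: q_def)
  qed
  have q_meas [measurable]: "q n \<in> borel_measurable borel" for n
    unfolding q_def by measurable
  have F_int: "integrable lborel F"
  proof -
    have "F = (\<lambda>x. indicator K x *\<^sub>R F x)" using supp(2) by (auto simp: indicator_def fun_eq_iff)
    thus ?thesis
      using borel_integrable_compact[OF supp(1) continuous_on_subset[OF \<open>continuous_on UNIV F\<close>]] by simp
  qed
  have "(\<integral>x. q n x \<partial>lborel) = 0" for n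
  proof -
    have "integrable lborel (\<lambda>x. F (v /\<^sub>R real (Suc n) + x))"
    proof -
      have "integrable (distr lborel borel ((+) (v /\<^sub>R real (Suc n)))) F"
        using F_int by (simp add: lborel_distr_plus)
      thus ?thesis by (subst (asm) integrable_distr_eq) auto
    qed
    thus ?thesis unfolding q_def using F_int integral_translation_lborel[OF F_meas]
      by (simp add: Bochner_Integration.integral_diff)
  qed
  moreover have "(\<lambda>n. \<integral>x. q n x \<partial>lborel) \<longlonglongrightarrow> (\<integral>x. D x v \<partial>lborel)"
  proof (rule integral_dominated_convergence)
    show "integrable lborel (\<lambda>x. B * indicator (cball 0 (R + norm v)) x)"
      using emeasure_bounded_finite[of "cball 0 (R + norm v)"]
      by (intro integrable_mult_right integrable_real_indicator) auto
  qed (use q_lim q_bound in auto)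
  ultimately show ?thesis by (simp add: LIMSEQ_const_iff)
qed

text \<open>The bumps of the box are test functions and converge boundedly to its indicator.
  Dominated convergence, with \<open>\<bar>v\<bar>\<close> cut off to the closed box as majorant,
  carries the hypothesis over to the box.\<close>

lemma fundamental_lemma_box:
  fixes v :: "'a::euclidean_space \<Rightarrow> real"
  assumes "open \<Omega>" and loc: "\<And>K. compact K \<Longrightarrow> K \<subseteq> \<Omega> \<Longrightarrow> v absolutely_integrable_on K"
    and zero: "\<And>\<phi>. \<phi> \<in> test_functions \<Omega> \<Longrightarrow> (\<integral>x. v x * \<phi> x \<partial>lebesgue_on \<Omega>) = 0"
    and sub: "cbox a b \<subseteq> \<Omega>"
  shows "(\<integral>x. indicator (box a b) x *\<^sub>R v x \<partial>lebesgue) = 0"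
proof -
  define w where "w x = indicator (cbox a b) x *\<^sub>R v x" for x
  have \<Omega>: "\<Omega> \<in> sets lebesgue" using assms(1) by (rule sets_lebesgue_open)
  have box_meas [measurable]: "box a b \<in> sets lebesgue" by auto
  have w: "integrable lebesgue w"
    using loc[of "cbox a b"] sub by (simp add: set_integrable_def w_def[abs_def])
  hence [measurable]: "w \<in> borel_measurable lebesgue" by (rule borel_measurable_integrable)
  have [measurable]: "box_bump a b n \<in> borel_measurable lebesgue" for n
  proof -
    have "continuous_on UNIV (box_bump a b n)"
      using box_bump_smooth[of a b n] by (metis Ck_on.simps(1) smooth_on_def)
    hence "box_bump a b n \<in> borel_measurable borel" by (rule borel_measurable_continuous_onI)
    thus ?thesis by (intro measurable_completion) simp
  qed
  have bump: "v x * box_bump a b n x = w x * box_bump a b n x" for n x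
    using box_bump_outside[of x a b n] box_subset_cbox[of a b] by (auto simp: indicator_def w_def)
  have "(\<lambda>n. \<integral>x. w x * box_bump a b n x \<partial>lebesgue) \<longlonglongrightarrow> (\<integral>x. w x * indicator (box a b) x \<partial>lebesgue)"
  proof (rule integral_dominated_convergence)
    show "integrable lebesgue (\<lambda>x. norm (w x))" using w by (rule integrable_norm)
    show "AE x in lebesgue. norm (w x * box_bump a b n x) \<le> norm (w x)" for n
      using box_bump_bounds[of a b n]
      by (intro AE_I2) (auto simp: abs_mult intro!: mult_left_le)
    show "AE x in lebesgue. (\<lambda>n. w x * box_bump a b n x) \<longlonglongrightarrow> w x * indicator (box a b) x"
      by (intro AE_I2 tendsto_mult tendsto_const box_bump_tendsto)
  qed auto
  moreover have "(\<integral>x. w x * box_bump a b n x \<partial>lebesgue) = 0" for n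
  proof -
    have "(\<integral>x. w x * box_bump a b n x \<partial>lebesgue)
        = (\<integral>x. indicator \<Omega> x *\<^sub>R (v x * box_bump a b n x) \<partial>lebesgue)"
      using sub bump by (intro Bochner_Integration.integral_cong) (auto simp: indicator_def w_def)
    also have "\<dots> = (\<integral>x. v x * box_bump a b n x \<partial>lebesgue_on \<Omega>)"
      using \<Omega> by (subst integral_restrict_space) auto
    also have "\<dots> = 0" using zero box_bump_test_function[OF sub] by blast
    finally show ?thesis .
  qed
  ultimately have "(\<integral>x. w x * indicator (box a b) x \<partial>lebesgue) = 0"
    by (simp add: LIMSEQ_const_iff)
  also have "(\<lambda>x. w x * indicator (box a b) x) = (\<lambda>x. indicator (box a b) x *\<^sub>R v x)"
    using box_subset_cbox[of a b] by (auto simp: indicator_def fun_eq_iff w_def)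
  finally show ?thesis .
qed

text \<open>A Dynkin argument: boxes form an intersection-stable generator of the Borel sets, and
  the Borel sets over which \<open>f\<close> integrates to 0 are closed under complements, by
  \<open>tot\<close>, and under countable disjoint unions. A function whose integral over every
  Borel set is 0 vanishes almost everywhere.\<close>

lemma AE_0_if_box_integrals_0:
  fixes f :: "'a::euclidean_space \<Rightarrow> real"
  assumes int: "integrable lborel f" and tot: "(\<integral>x. f x \<partial>lborel) = 0"
    and box: "\<And>c d. (\<integral>x. indicator (box c d) x *\<^sub>R f x \<partial>lborel) = 0"
  shows "AE x in lborel. f x = 0"
proof (rule sigma_finite_measure.density_zero[OF sigma_finite_lborel int])
  have sets_eq: "sets lborel = sigma_sets UNIV (range (\<lambda>(a, b). box a b :: 'a set))"
    by (simp add: borel_eq_box)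
  fix A :: "'a set" assume "A \<in> sets lborel"
  hence "A \<in> sigma_sets UNIV (range (\<lambda>(a, b). box a b))"
    by (simp only: sets_eq)
  note A = this
  have I: "Int_stable (range (\<lambda>(a, b). box a b :: 'a set))"
    by (auto simp: Int_stable_def box_Int_box)
  have P: "range (\<lambda>(a, b). box a b :: 'a set) \<subseteq> Pow UNIV" by simp
  from I P A show "set_lebesgue_integral lborel A f = 0"
  proof (induction rule: sigma_sets_induct_disjoint)
    case (basic A)
    then obtain c d where "A = box c d" by auto
    thus ?case using box by (simp add: set_lebesgue_integral_def)
  next
    case empty thus ?case by (simp add: set_lebesgue_integral_def)
  next
    case (compl A)
    have A: "A \<in> sets lborel" using compl(1) by (simp only: sets_eq)
    have "set_lebesgue_integral lborel (UNIV - A) f = (\<integral>x. f x - indicator A x *\<^sub>R f x \<partial>lborel)"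
      unfolding set_lebesgue_integral_def by (intro Bochner_Integration.integral_cong) (auto simp: indicator_def)
    also have "\<dots> = (\<integral>x. f x \<partial>lborel) - set_lebesgue_integral lborel A f"
      using int integrable_mult_indicator[OF A int]
      by (simp add: set_lebesgue_integral_def)
    finally show ?case using tot compl by simp
  next
    case (union A)
    have A: "A i \<in> sets lborel" for i using union(2) unfolding sets_eq by blast
    have "set_lebesgue_integral lborel (\<Union> (range A)) f = (\<Sum>i. set_lebesgue_integral lborel (A i) f)"
      using union(1) A int integrable_mult_indicator[OF _ int, of "\<Union> (range A)"]
      by (intro lebesgue_integral_countable_add) (auto simp: disjoint_family_on_def set_integrable_def)
    thus ?case using union by simp
  qed
qed

text \<open>An open set is a countable union of closed boxes, so it suffices to argue on one box
  inside \<open>\<Omega>\<close>, where the integrals over all open subboxes vanish.\<close>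

lemma fundamental_lemma:
  fixes v :: "'a::euclidean_space \<Rightarrow> real"
  assumes "open \<Omega>" and loc: "\<And>K. compact K \<Longrightarrow> K \<subseteq> \<Omega> \<Longrightarrow> v absolutely_integrable_on K"
    and zero: "\<And>\<phi>. \<phi> \<in> test_functions \<Omega> \<Longrightarrow> (\<integral>x. v x * \<phi> x \<partial>lebesgue_on \<Omega>) = 0"
  shows "AE x in lebesgue_on \<Omega>. v x = 0"
proof -
  have *: "AE x in lebesgue. x \<in> cbox a b \<longrightarrow> v x = 0" if sub: "cbox a b \<subseteq> \<Omega>" for a b
  proof -
    have int: "integrable lebesgue (\<lambda>x. indicator (box a b) x *\<^sub>R v x)"
      using loc[of "cbox a b"] sub absolutely_integrable_on_open_interval[where f = v and a = a and b = b]
      by (simp add: set_integrable_def)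
    \<comment> \<open>The Dynkin argument concerns Borel functions and Borel sets, whereas
      \<open>v\<close> is only Lebesgue measurable; hence the Borel representative.\<close>
    obtain f where f [measurable]: "f \<in> borel_measurable lborel"
      and fe: "AE x in lborel. indicator (box a b) x *\<^sub>R v x = f x"
      using completion_ex_borel_measurable_real[OF borel_measurable_integrable[OF int]] by auto
    have fe': "AE x in lebesgue. indicator (box a b) x *\<^sub>R v x = f x"
      using fe by (rule AE_completion)
    have fm: "f \<in> borel_measurable lebesgue" using f by (rule measurable_completion)
    have "integrable lebesgue f"
      using int fe' fm by (subst integrable_cong_AE[symmetric]) auto
    hence fi: "integrable lborel f" by (simp add: integrable_completion)
    have boxes: "(\<integral>x. indicator (box c d) x *\<^sub>R f x \<partial>lborel) = 0" for c d
    proof -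
      have [measurable]: "(\<lambda>x. indicator (box a b) x *\<^sub>R v x) \<in> borel_measurable lebesgue"
        using int by (rule borel_measurable_integrable)
      have [measurable]: "box c d \<in> sets lebesgue" by auto
      have "(\<integral>x. indicator (box c d) x *\<^sub>R f x \<partial>lborel) = (\<integral>x. indicator (box c d) x *\<^sub>R f x \<partial>lebesgue)"
        by (subst integral_completion) auto
      also have "\<dots> = (\<integral>x. indicator (box c d) x *\<^sub>R (indicator (box a b) x *\<^sub>R v x) \<partial>lebesgue)"
        proof (intro integral_cong_AE)
        show "AE x in lebesgue. indicator (box c d) x *\<^sub>R f x
            = indicator (box c d) x *\<^sub>R (indicator (box a b) x *\<^sub>R v x)"
          using fe' by eventually_elim simp
      qed (use fm in measurable)
      also have "\<dots> = (\<integral>x. indicator (box c d \<inter> box a b) x *\<^sub>R v x \<partial>lebesgue)"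
        by (intro Bochner_Integration.integral_cong) (auto simp: indicator_def)
      also have "\<dots> = 0"
      proof -
        obtain c' d' where eq: "box c d \<inter> box a b = box c' d'" using box_Int_box[of c d a b] by blast
        show ?thesis
        \<comment> \<open>An empty open box is set apart because its corners say nothing about where
          \<open>cbox c' d'\<close> lies; a nonempty one has \<open>cbox c' d'\<close> as its
          closure, which stays inside \<open>cbox a b\<close>.\<close>
        proof (cases "box c' d' = {}")
          case True thus ?thesis using eq by simp
        next
          case False
          have "box c' d' \<subseteq> cbox a b" using eq box_subset_cbox by blast
          hence "cbox c' d' \<subseteq> cbox a b"
            using False by (metis closure_box closure_minimal closed_cbox)
          hence "cbox c' d' \<subseteq> \<Omega>" using sub by blast
          thus ?thesis using fundamental_lemma_box[OF assms(1) loc zero] eq by simp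
        qed
      qed
      finally show ?thesis .
    qed
    have "(\<integral>x. f x \<partial>lborel) = (\<integral>x. indicator (box a b) x *\<^sub>R f x \<partial>lborel)"
    proof (intro integral_cong_AE)
      show "AE x in lborel. f x = indicator (box a b) x *\<^sub>R f x"
        using fe by eventually_elim (auto simp: indicator_def split: if_splits)
    qed auto
    hence "AE x in lborel. f x = 0" using boxes by (intro AE_0_if_box_integrals_0[OF fi]) auto
    hence "AE x in lebesgue. f x = 0" by (rule AE_completion)
    moreover have "AE x in lebesgue. x \<notin> cbox a b - box a b"
    proof -
      have "negligible (cbox a b - box a b)" by (rule negligible_frontier_interval)
      hence "cbox a b - box a b \<in> null_sets lebesgue" by (simp only: negligible_iff_null_sets)
      thus ?thesis by (rule AE_not_in)
    qed
    ultimately show ?thesis using fe' by eventually_elim (auto simp: indicator_def split: if_splits)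
  qed
  obtain D where D: "countable D" "\<And>X. X \<in> D \<Longrightarrow> X \<subseteq> \<Omega> \<and> (\<exists>a b. X = cbox a b)" "\<Union>D = \<Omega>"
    using open_countable_Union_open_cbox[OF assms(1)] by (smt (verit, best) PowD subsetD)
  have "AE x in lebesgue. \<forall>X\<in>D. x \<in> X \<longrightarrow> v x = 0"
  proof (subst AE_ball_countable[OF D(1)], rule ballI)
    fix X assume "X \<in> D"
    then obtain a b where "X \<subseteq> \<Omega>" "X = cbox a b" using D(2) by blast
    thus "AE x in lebesgue. x \<in> X \<longrightarrow> v x = 0" using *[of a b] by simp
  qed
  hence "AE x in lebesgue. x \<in> \<Omega> \<longrightarrow> v x = 0" by eventually_elim (use D(3) in blast)
  thus ?thesis using assms(1) by (subst AE_restrict_space_iff) auto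
qed

subsection \<open>Weak gradients\<close>

definition grad :: "('a::euclidean_space \<Rightarrow> real) \<Rightarrow> 'a \<Rightarrow> 'a" where
  "grad \<phi> x = (\<Sum>i\<in>Basis. frechet_derivative \<phi> (at x) i *\<^sub>R i)"

lemma grad_inner_Basis: "i \<in> Basis \<Longrightarrow> grad \<phi> x \<bullet> i = frechet_derivative \<phi> (at x) i"
  by (simp add: grad_def inner_sum_left inner_Basis if_distrib cong: if_cong)

lemma test_function_has_derivative:
  assumes "\<phi> \<in> test_functions \<Omega>"
  shows "(\<phi> has_derivative (\<lambda>v. grad \<phi> x \<bullet> v)) (at x)"
proof -
  have "Ck_on (Suc 0) UNIV \<phi>" using assms by (simp only: test_functions_def smooth_on_def mem_Collect_eq)
  hence d: "(\<phi> has_derivative frechet_derivative \<phi> (at x)) (at x)"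
    by (simp add: frechet_derivative_works[symmetric])
  interpret linear "frechet_derivative \<phi> (at x)" using d by (rule has_derivative_linear)
  have "frechet_derivative \<phi> (at x) = (\<lambda>v. grad \<phi> x \<bullet> v)"
  proof
    fix v
    have "frechet_derivative \<phi> (at x) v = frechet_derivative \<phi> (at x) (\<Sum>i\<in>Basis. (v \<bullet> i) *\<^sub>R i)"
      by (simp add: euclidean_representation)
    also have "\<dots> = (\<Sum>i\<in>Basis. (v \<bullet> i) * frechet_derivative \<phi> (at x) i)"
      by (simp add: sum scale)
    also have "\<dots> = grad \<phi> x \<bullet> v"
      by (simp add: grad_def inner_sum_left inner_commute[of v] mult.commute)
    finally show "frechet_derivative \<phi> (at x) v = grad \<phi> x \<bullet> v" .
  qed
  thus ?thesis using d by simp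
qed

lemma test_function_continuous: "\<phi> \<in> test_functions \<Omega> \<Longrightarrow> continuous_on S \<phi>"
  by (meson continuous_at_imp_continuous_on has_derivative_continuous test_function_has_derivative)

lemma test_function_support:
  assumes "\<phi> \<in> test_functions \<Omega>"
  obtains K where "compact K" "K \<subseteq> \<Omega>" "\<And>x. x \<notin> K \<Longrightarrow> \<phi> x = 0" "\<And>x. x \<notin> K \<Longrightarrow> grad \<phi> x = 0"
proof -
  define K where "K = closure {x. \<phi> x \<noteq> 0}"
  have K: "compact K" "K \<subseteq> \<Omega>" "closed K" using assms by (auto simp: test_functions_def K_def)
  have z: "\<phi> x = 0" if "x \<notin> K" for x
    using that closure_subset[of "{x. \<phi> x \<noteq> 0}"] by (auto simp: K_def)
  have "grad \<phi> x = 0" if x: "x \<notin> K" for x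
  proof -
    have "((\<lambda>_. 0) has_derivative (\<lambda>v. grad \<phi> x \<bullet> v)) (at x)"
    proof (rule has_derivative_transform_within_open[OF test_function_has_derivative[OF assms]])
      show "open (- K)" using K(3) by (rule open_Compl)
      show "x \<in> - K" using x by simp
      show "\<phi> y = 0" if "y \<in> - K" for y using z that by simp
    qed
    hence "(\<lambda>v. grad \<phi> x \<bullet> v) = (\<lambda>v. 0)"
      by (rule has_derivative_unique) (rule has_derivative_const)
    hence "grad \<phi> x \<bullet> grad \<phi> x = 0" by (rule fun_cong)
    thus ?thesis by simp
  qed
  thus ?thesis using that K z by blast
qed

text \<open>Because of this closure property, integrability and continuity facts for test functions
  apply to their derivatives as well; in particular \<open>grad \<phi>\<close> is continuous
  componentwise.\<close>

lemma test_function_partial: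
  assumes "\<phi> \<in> test_functions \<Omega>" "i \<in> Basis"
  shows "(\<lambda>x. grad \<phi> x \<bullet> i) \<in> test_functions \<Omega>"
proof -
  obtain K where K: "compact K" "K \<subseteq> \<Omega>" "\<And>x. x \<notin> K \<Longrightarrow> grad \<phi> x = 0"
    using test_function_support[OF assms(1)] by metis
  have "Ck_on (Suc k) UNIV \<phi>" for k using assms by (simp only: test_functions_def smooth_on_def mem_Collect_eq)
  hence "smooth_on UNIV (\<lambda>x. grad \<phi> x \<bullet> i)"
    using assms(2) by (simp add: smooth_on_def grad_inner_Basis)
  moreover have "closure {x. grad \<phi> x \<bullet> i \<noteq> 0} \<subseteq> K"
    using K(1) by (intro closure_minimal) (use K(3) in \<open>force intro: compact_imp_closed\<close>)+
  moreover from this have "compact (closure {x. grad \<phi> x \<bullet> i \<noteq> 0})"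
    using compact_Int_closed[OF K(1) closed_closure] by (metis Int_absorb1)
  ultimately show ?thesis using K(2) by (auto simp: test_functions_def)
qed

lemma grad_continuous:
  assumes "\<phi> \<in> test_functions \<Omega>"
  shows "continuous_on S (grad \<phi>)"
  by (subst continuous_on_componentwise) (auto intro: test_function_continuous[OF test_function_partial[OF assms]])

lemma continuous_measurable_lebesgue:
  "continuous_on UNIV f \<Longrightarrow> f \<in> borel_measurable lebesgue"
  for f :: "'a::euclidean_space \<Rightarrow> 'b::topological_space"
  by (intro measurable_completion) (simp add: borel_measurable_continuous_onI)

lemma integrable_compact_support:
  fixes f :: "'a::euclidean_space \<Rightarrow> 'b::{banach, second_countable_topology}"
  assumes "continuous_on UNIV f" "compact K" "\<And>x. x \<notin> K \<Longrightarrow> f x = 0"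
  shows "integrable lborel f"
proof -
  have "f = (\<lambda>x. indicator K x *\<^sub>R f x)" using assms(3) by (auto simp: indicator_def fun_eq_iff)
  thus ?thesis using borel_integrable_compact[OF assms(2) continuous_on_subset[OF assms(1)]] by simp
qed

lemma integrable_mult_test_function:
  fixes v :: "'a::euclidean_space \<Rightarrow> real"
  assumes loc: "\<And>K. compact K \<Longrightarrow> K \<subseteq> \<Omega> \<Longrightarrow> v absolutely_integrable_on K"
    and \<phi>: "\<phi> \<in> test_functions \<Omega>" and \<Omega>: "open \<Omega>"
  shows "integrable (lebesgue_on \<Omega>) (\<lambda>x. v x * \<phi> x)"
proof -
  obtain K where K: "compact K" "K \<subseteq> \<Omega>" "\<And>x. x \<notin> K \<Longrightarrow> \<phi> x = 0"
    using test_function_support[OF \<phi>] by metis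
  have "bounded (\<phi> ` K)"
    by (intro compact_imp_bounded compact_continuous_image test_function_continuous[OF \<phi>] K)
  then obtain B where B: "\<And>x. x \<in> K \<Longrightarrow> \<bar>\<phi> x\<bar> \<le> B" by (auto simp: bounded_iff)
  have v: "integrable lebesgue (\<lambda>x. indicator K x *\<^sub>R v x)"
    using loc K by (simp add: set_integrable_def)
  have "integrable lebesgue (\<lambda>x. (indicator K x *\<^sub>R v x) * \<phi> x)"
  proof (rule Bochner_Integration.integrable_bound)
    show "integrable lebesgue (\<lambda>x. B * norm (indicator K x *\<^sub>R v x))"
      by (intro integrable_mult_right integrable_norm v)
    show "(\<lambda>x. (indicator K x *\<^sub>R v x) * \<phi> x) \<in> borel_measurable lebesgue"
      by (intro borel_measurable_times borel_measurable_integrable[OF v]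
          continuous_measurable_lebesgue test_function_continuous[OF \<phi>])
    show "AE x in lebesgue. norm ((indicator K x *\<^sub>R v x) * \<phi> x) \<le> norm (B * norm (indicator K x *\<^sub>R v x))"
    proof (intro AE_I2)
      fix x
      show "norm ((indicator K x *\<^sub>R v x) * \<phi> x) \<le> norm (B * norm (indicator K x *\<^sub>R v x))"
        using B[of x] by (cases "x \<in> K") (auto simp: abs_mult mult.commute[of _ "\<bar>v x\<bar>"] intro!: mult_left_mono)
    qed
  qed
  also have "(\<lambda>x. (indicator K x *\<^sub>R v x) * \<phi> x) = (\<lambda>x. v x * \<phi> x)"
    using K(3) by (auto simp: fun_eq_iff indicator_def)
  finally show ?thesis by (rule integrable_lebesgue_on) (use \<Omega> in auto)
qed

lemma absolutely_integrable_continuous_compact: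
  fixes f :: "'a::euclidean_space \<Rightarrow> 'b::{banach, second_countable_topology}"
  assumes "continuous_on UNIV f" "compact K"
  shows "f absolutely_integrable_on K"
proof -
  have i: "integrable lborel (\<lambda>x. indicator K x *\<^sub>R f x)"
    using assms(2) continuous_on_subset[OF assms(1) subset_UNIV] by (rule borel_integrable_compact)
  hence "integrable lebesgue (\<lambda>x. indicator K x *\<^sub>R f x)"
    by (subst integrable_completion) (rule borel_measurable_integrable)
  thus ?thesis by (simp add: set_integrable_def)
qed

lemma integral_lebesgue_on_support:
  fixes f :: "'a::euclidean_space \<Rightarrow> real"
  assumes f: "continuous_on UNIV f" and K: "\<And>x. x \<notin> K \<Longrightarrow> f x = 0" "K \<subseteq> \<Omega>" and \<Omega>: "open \<Omega>"
  shows "(\<integral>x. f x \<partial>lebesgue_on \<Omega>) = (\<integral>x. f x \<partial>lborel)"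
proof -
  have "(\<integral>x. f x \<partial>lebesgue_on \<Omega>) = (\<integral>x. indicator \<Omega> x *\<^sub>R f x \<partial>lebesgue)"
    using \<Omega> by (subst integral_restrict_space) auto
  also have "(\<lambda>x. indicator \<Omega> x *\<^sub>R f x) = f" using K by (auto simp: fun_eq_iff indicator_def)
  also have "(\<integral>x. f x \<partial>lebesgue) = (\<integral>x. f x \<partial>lborel)"
    using f by (intro integral_completion) (simp add: borel_measurable_continuous_onI)
  finally show ?thesis .
qed

text \<open>The product \<open>\<phi> x * \<psi> x\<close> has compact support, so the integral of
  its directional derivative vanishes; by the product rule this is integration by parts.\<close>

lemma test_function_weak_gradient:
  assumes \<phi>: "\<phi> \<in> test_functions \<Omega>" and \<Omega>: "open \<Omega>"
  shows "has_weak_gradient \<Omega> \<phi> (grad \<phi>)"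
  unfolding has_weak_gradient_def
proof (intro conjI allI impI ballI)
  show "\<phi> absolutely_integrable_on K" "grad \<phi> absolutely_integrable_on K"
    if "compact K \<and> K \<subseteq> \<Omega>" for K
    using that test_function_continuous[OF \<phi>] grad_continuous[OF \<phi>]
    by (blast intro: absolutely_integrable_continuous_compact)+
  fix \<psi> :: "'a \<Rightarrow> real" and i :: 'a assume \<psi>: "\<psi> \<in> test_functions \<Omega>" and i: "i \<in> Basis"
  obtain K where K: "compact K" "K \<subseteq> \<Omega>" "\<And>x. x \<notin> K \<Longrightarrow> \<phi> x = 0" "\<And>x. x \<notin> K \<Longrightarrow> grad \<phi> x = 0"
    using test_function_support[OF \<phi>] by metis
  let ?D = "\<lambda>x v. \<phi> x * (grad \<psi> x \<bullet> v) + (grad \<phi> x \<bullet> v) * \<psi> x"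
  have cont: "continuous_on UNIV (\<lambda>x. \<phi> x * (grad \<psi> x \<bullet> i))" "continuous_on UNIV (\<lambda>x. (grad \<phi> x \<bullet> i) * \<psi> x)"
    by (intro continuous_intros test_function_continuous[OF \<phi>] test_function_continuous[OF \<psi>]
        grad_continuous[OF \<phi>] grad_continuous[OF \<psi>])+
  have int: "integrable lborel (\<lambda>x. \<phi> x * (grad \<psi> x \<bullet> i))" "integrable lborel (\<lambda>x. (grad \<phi> x \<bullet> i) * \<psi> x)"
    using K cont by (auto intro: integrable_compact_support)
  have "(\<integral>x. ?D x i \<partial>lborel) = 0"
  proof (rule integral_directional_derivative_eq_0)
    show "((\<lambda>x. \<phi> x * \<psi> x) has_derivative ?D x) (at x)" for x
      by (intro has_derivative_mult test_function_has_derivative[OF \<phi>] test_function_has_derivative[OF \<psi>])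
    show "continuous_on UNIV (\<lambda>x. ?D x i)" by (intro continuous_on_add cont)
  qed (use K in auto)
  hence eq: "(\<integral>x. \<phi> x * (grad \<psi> x \<bullet> i) \<partial>lborel) = - (\<integral>x. (grad \<phi> x \<bullet> i) * \<psi> x \<partial>lborel)"
    using int by simp
  show "(\<integral>x. \<phi> x * frechet_derivative \<psi> (at x) i \<partial>lebesgue_on \<Omega>) =
        - (\<integral>x. (grad \<phi> x \<bullet> i) * \<psi> x \<partial>lebesgue_on \<Omega>)"
    using i K eq cont by (simp add: grad_inner_Basis[symmetric]
        integral_lebesgue_on_support[OF _ _ K(2) \<Omega>])
qed

text \<open>The components of two weak gradients have the same integrals against all test functions,
  so the fundamental lemma applies to their difference. This is what makes the choice in
  \<open>weak_grad\<close> harmless.\<close>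

lemma weak_gradient_unique:
  assumes u: "has_weak_gradient \<Omega> u G" "has_weak_gradient \<Omega> u G'" and \<Omega>: "open \<Omega>"
  shows "AE x in lebesgue_on \<Omega>. G x = G' x"
proof -
  have loc: "(\<lambda>x. F x \<bullet> i) absolutely_integrable_on K"
    if "has_weak_gradient \<Omega> u F" "compact K" "K \<subseteq> \<Omega>" for F K i
  proof -
    have "integrable lebesgue (\<lambda>x. indicator K x *\<^sub>R F x)"
      using that by (auto simp: has_weak_gradient_def set_integrable_def)
    hence "integrable lebesgue (\<lambda>x. (indicator K x *\<^sub>R F x) \<bullet> i)" by (rule integrable_inner_left)
    thus ?thesis by (simp add: set_integrable_def)
  qed
  have "AE x in lebesgue_on \<Omega>. G x \<bullet> i - G' x \<bullet> i = 0" if i: "i \<in> Basis" for i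
  proof (rule fundamental_lemma[OF \<Omega>])
    show "(\<lambda>x. G x \<bullet> i - G' x \<bullet> i) absolutely_integrable_on K" if "compact K" "K \<subseteq> \<Omega>" for K
      using loc u that by (intro set_integral_diff)
    fix \<phi> :: "'a \<Rightarrow> real" assume \<phi>: "\<phi> \<in> test_functions \<Omega>"
    have "integrable (lebesgue_on \<Omega>) (\<lambda>x. (G x \<bullet> i) * \<phi> x)" "integrable (lebesgue_on \<Omega>) (\<lambda>x. (G' x \<bullet> i) * \<phi> x)"
      using loc u by (auto intro!: integrable_mult_test_function \<phi> \<Omega>)
    moreover have "(\<integral>x. (G x \<bullet> i) * \<phi> x \<partial>lebesgue_on \<Omega>) = (\<integral>x. (G' x \<bullet> i) * \<phi> x \<partial>lebesgue_on \<Omega>)"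
      using u \<phi> i by (fastforce simp: has_weak_gradient_def)
    ultimately show "(\<integral>x. (G x \<bullet> i - G' x \<bullet> i) * \<phi> x \<partial>lebesgue_on \<Omega>) = 0"
      by (simp add: left_diff_distrib)
  qed
  hence "AE x in lebesgue_on \<Omega>. \<forall>i\<in>Basis. G x \<bullet> i - G' x \<bullet> i = 0"
    by (simp add: AE_finite_all)
  thus ?thesis by eventually_elim (auto intro: euclidean_eqI)
qed

subsection \<open>The Sobolev inequality in dimension three\<close>

lemma measurable_vector_3:
  "(\<lambda>(a, b, c). vector [a, b, c] :: real^3) \<in> borel_measurable (lborel \<Otimes>\<^sub>M lborel \<Otimes>\<^sub>M lborel)"
proof -
  let ?c = "\<lambda>i p. if i = (1::3) then fst p else if i = 2 then fst (snd p) else snd (snd p) :: real"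
  have "(\<lambda>(a, b, c). vector [a, b, c] :: real^3) = (\<lambda>p. \<chi> i. ?c i p)"
    by (auto simp: fun_eq_iff vec_eq_iff forall_3)
  moreover have "continuous_on UNIV (?c i)" for i
    by (cases "i = 1"; cases "i = 2") (auto intro!: continuous_intros)
  hence "continuous_on UNIV (\<lambda>p. \<chi> i. ?c i p)"
    by (intro continuous_on_vec_lambda)
  ultimately show ?thesis by (simp add: lborel_prod borel_measurable_continuous_onI)
qed

text \<open>A measure that agrees with the volume on boxes is Lebesgue measure. The identification
  makes integration over one coordinate at a time available, as the Loomis-Whitney inequality
  requires.\<close>

lemma lborel_real3_eq_distr:
  "(lborel :: (real^3) measure) =
     distr (lborel \<Otimes>\<^sub>M lborel \<Otimes>\<^sub>M lborel) borel (\<lambda>(a, b, c). vector [a, b, c])"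
  (is "_ = distr ?P borel ?T")
proof (rule lborel_eqI)
  have T: "?T \<in> borel_measurable ?P" by (rule measurable_vector_3)
  fix l u :: "real^3" assume lu: "\<And>b. b \<in> Basis \<Longrightarrow> l \<bullet> b \<le> u \<bullet> b"
  have Basis: "(Basis :: (real^3) set) = (\<lambda>i. axis i 1) ` UNIV"
    by (auto simp: Basis_vec_def)
  have le: "l $ i \<le> u $ i" for i
    using lu[of "axis i 1"] by (simp add: inner_axis Basis)
  have "?T -` box l u \<inter> space ?P =
      {l $ 1<..<u $ 1} \<times> {l $ 2<..<u $ 2} \<times> {l $ 3<..<u $ 3}"
    by (auto simp: mem_box_cart forall_3 space_pair_measure)
  hence "emeasure (distr ?P borel ?T) (box l u) =
      emeasure ?P ({l $ 1<..<u $ 1} \<times> {l $ 2<..<u $ 2} \<times> {l $ 3<..<u $ 3})"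
    using T by (subst emeasure_distr) auto
  also have "\<dots> = ennreal (u $ 1 - l $ 1) * (ennreal (u $ 2 - l $ 2) * ennreal (u $ 3 - l $ 3))"
    using le
    by (subst sigma_finite_measure.emeasure_pair_measure_Times,
        auto simp: lborel_prod sigma_finite_lborel)
       (subst lborel_prod[symmetric], subst sigma_finite_measure.emeasure_pair_measure_Times,
        auto simp: sigma_finite_lborel)
  also have "\<dots> = ennreal (\<Prod>b\<in>Basis. (u - l) \<bullet> b)"
  proof -
    have "(\<Prod>b\<in>Basis. (u - l) \<bullet> b) = (\<Prod>i\<in>UNIV. u $ i - l $ i)"
      unfolding Basis by (subst prod.reindex) (auto simp: inj_on_def axis_eq_axis inner_axis)
    also have "\<dots> = (u $ 1 - l $ 1) * ((u $ 2 - l $ 2) * (u $ 3 - l $ 3))"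
      unfolding UNIV_3 by simp
    finally show ?thesis using le by (simp add: ennreal_mult)
  qed
  finally show "emeasure (distr ?P borel ?T) (box l u) = ennreal (\<Prod>b\<in>Basis. (u - l) \<bullet> b)" .
qed simp

lemma nn_integral_real3:
  fixes f :: "real^3 \<Rightarrow> ennreal"
  assumes [measurable]: "f \<in> borel_measurable borel"
  shows "(\<integral>\<^sup>+x. f x \<partial>lborel) = (\<integral>\<^sup>+a. \<integral>\<^sup>+b. \<integral>\<^sup>+c. f (vector [a, b, c]) \<partial>lborel \<partial>lborel \<partial>lborel)"
proof -
  let ?g = "\<lambda>p. f (vector [fst p, fst (snd p), snd (snd p)])"
  have g: "?g \<in> borel_measurable (lborel \<Otimes>\<^sub>M lborel \<Otimes>\<^sub>M lborel)"
    using measurable_compose[OF measurable_vector_3 assms] by (simp add: case_prod_beta)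
  have sf: "sigma_finite_measure (lborel \<Otimes>\<^sub>M lborel :: (real \<times> real) measure)"
    by (simp add: lborel_prod sigma_finite_lborel)
  have "(\<integral>\<^sup>+x. f x \<partial>lborel) = (\<integral>\<^sup>+p. ?g p \<partial>(lborel \<Otimes>\<^sub>M lborel \<Otimes>\<^sub>M lborel))"
    by (subst lborel_real3_eq_distr, subst nn_integral_distr[OF measurable_vector_3]) (auto simp: case_prod_beta)
  also have "\<dots> = (\<integral>\<^sup>+a. \<integral>\<^sup>+q. f (vector [a, fst q, snd q]) \<partial>(lborel \<Otimes>\<^sub>M lborel) \<partial>lborel)"
    by (subst sigma_finite_measure.nn_integral_fst[OF sf g, symmetric]) simp
  also have "\<dots> = (\<integral>\<^sup>+a. \<integral>\<^sup>+b. \<integral>\<^sup>+c. f (vector [a, b, c]) \<partial>lborel \<partial>lborel \<partial>lborel)"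
  proof (rule nn_integral_cong)
    fix a :: real
    have "(\<lambda>q. f (vector [a, fst q, snd q])) \<in> borel_measurable (lborel \<Otimes>\<^sub>M lborel)"
      using measurable_compose[OF measurable_Pair1' g, of a] by simp
    thus "(\<integral>\<^sup>+q. f (vector [a, fst q, snd q]) \<partial>(lborel \<Otimes>\<^sub>M lborel)) = (\<integral>\<^sup>+b. \<integral>\<^sup>+c. f (vector [a, b, c]) \<partial>lborel \<partial>lborel)"
      by (subst lborel.nn_integral_fst[symmetric]) auto
  qed
  finally show ?thesis .
qed

text \<open>Two applications of the Cauchy-Schwarz inequality: one in \<open>z\<close> for fixed
  \<open>x\<close> and \<open>y\<close>, one in the pair \<open>(x, y)\<close>. The bound for the
  integral of the square of \<open>d\<close> factors because \<open>a\<close> does not involve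
  \<open>x\<close> and \<open>b\<close> does not involve \<open>y\<close>.\<close>

lemma loomis_whitney:
  fixes a b c :: "real \<times> real \<Rightarrow> ennreal"
  assumes [measurable]: "a \<in> borel_measurable (lborel \<Otimes>\<^sub>M lborel)"
    "b \<in> borel_measurable (lborel \<Otimes>\<^sub>M lborel)" "c \<in> borel_measurable (lborel \<Otimes>\<^sub>M lborel)"
  shows "(\<integral>\<^sup>+x. \<integral>\<^sup>+y. \<integral>\<^sup>+z. a (y, z) * b (x, z) * c (x, y) \<partial>lborel \<partial>lborel \<partial>lborel)\<^sup>2
    \<le> (\<integral>\<^sup>+y. \<integral>\<^sup>+z. (a (y, z))\<^sup>2 \<partial>lborel \<partial>lborel) * (\<integral>\<^sup>+x. \<integral>\<^sup>+z. (b (x, z))\<^sup>2 \<partial>lborel \<partial>lborel)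
      * (\<integral>\<^sup>+x. \<integral>\<^sup>+y. (c (x, y))\<^sup>2 \<partial>lborel \<partial>lborel)"
proof -
  define d where "d p = (\<integral>\<^sup>+z. a (snd p, z) * b (fst p, z) \<partial>lborel)" for p
  have d_meas [measurable]: "d \<in> borel_measurable (lborel \<Otimes>\<^sub>M lborel)"
    unfolding d_def by measurable
  have d: "(d (x, y))\<^sup>2 \<le> (\<integral>\<^sup>+z. (a (y, z))\<^sup>2 \<partial>lborel) * (\<integral>\<^sup>+z. (b (x, z))\<^sup>2 \<partial>lborel)" for x y
    unfolding d_def fst_conv snd_conv by (rule Cauchy_Schwarz_nn_integral) measurable
  have "(\<integral>\<^sup>+x. \<integral>\<^sup>+y. \<integral>\<^sup>+z. a (y, z) * b (x, z) * c (x, y) \<partial>lborel \<partial>lborel \<partial>lborel)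
      = (\<integral>\<^sup>+x. \<integral>\<^sup>+y. c (x, y) * d (x, y) \<partial>lborel \<partial>lborel)"
    unfolding d_def fst_conv snd_conv
    by (intro nn_integral_cong) (simp add: nn_integral_cmult[symmetric] mult.commute)
  also have "\<dots> = (\<integral>\<^sup>+p. c p * d p \<partial>(lborel \<Otimes>\<^sub>M lborel))"
    by (subst lborel.nn_integral_fst[symmetric]) auto
  also have "\<dots>\<^sup>2 \<le> (\<integral>\<^sup>+p. (c p)\<^sup>2 \<partial>(lborel \<Otimes>\<^sub>M lborel)) * (\<integral>\<^sup>+p. (d p)\<^sup>2 \<partial>(lborel \<Otimes>\<^sub>M lborel))"
    by (rule Cauchy_Schwarz_nn_integral) measurable
  also have "(\<integral>\<^sup>+p. (c p)\<^sup>2 \<partial>(lborel \<Otimes>\<^sub>M lborel)) = (\<integral>\<^sup>+x. \<integral>\<^sup>+y. (c (x, y))\<^sup>2 \<partial>lborel \<partial>lborel)"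
    by (subst lborel.nn_integral_fst[symmetric]) auto
  also have "(\<integral>\<^sup>+p. (d p)\<^sup>2 \<partial>(lborel \<Otimes>\<^sub>M lborel)) = (\<integral>\<^sup>+x. \<integral>\<^sup>+y. (d (x, y))\<^sup>2 \<partial>lborel \<partial>lborel)"
    by (subst lborel.nn_integral_fst[symmetric]) auto
  finally have "(\<integral>\<^sup>+x. \<integral>\<^sup>+y. \<integral>\<^sup>+z. a (y, z) * b (x, z) * c (x, y) \<partial>lborel \<partial>lborel \<partial>lborel)\<^sup>2
    \<le> (\<integral>\<^sup>+x. \<integral>\<^sup>+y. (c (x, y))\<^sup>2 \<partial>lborel \<partial>lborel) * (\<integral>\<^sup>+x. \<integral>\<^sup>+y. (d (x, y))\<^sup>2 \<partial>lborel \<partial>lborel)" .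
  note 1 = this
  have "(\<integral>\<^sup>+x. \<integral>\<^sup>+y. (d (x, y))\<^sup>2 \<partial>lborel \<partial>lborel) \<le> (\<integral>\<^sup>+x. \<integral>\<^sup>+y. (\<integral>\<^sup>+z. (a (y, z))\<^sup>2 \<partial>lborel) * (\<integral>\<^sup>+z. (b (x, z))\<^sup>2 \<partial>lborel) \<partial>lborel \<partial>lborel)"
    by (intro nn_integral_mono d)
  also have "\<dots> = (\<integral>\<^sup>+y. \<integral>\<^sup>+z. (a (y, z))\<^sup>2 \<partial>lborel \<partial>lborel) * (\<integral>\<^sup>+x. \<integral>\<^sup>+z. (b (x, z))\<^sup>2 \<partial>lborel \<partial>lborel)"
    by (simp add: nn_integral_multc nn_integral_cmult)
  finally have "(\<integral>\<^sup>+x. \<integral>\<^sup>+y. (d (x, y))\<^sup>2 \<partial>lborel \<partial>lborel) \<le> (\<integral>\<^sup>+y. \<integral>\<^sup>+z. (a (y, z))\<^sup>2 \<partial>lborel \<partial>lborel) *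
      (\<integral>\<^sup>+x. \<integral>\<^sup>+z. (b (x, z))\<^sup>2 \<partial>lborel \<partial>lborel)" .
  from order_trans[OF 1 mult_left_mono[OF this]] show ?thesis
    by (subst mult.commute) simp
qed

text \<open>The fundamental theorem of calculus is applied from a point to the left of the support,
  where \<open>f\<close> vanishes.\<close>

lemma abs_le_nn_integral_derivative:
  fixes f f' :: "real \<Rightarrow> real"
  assumes "\<And>s. (f has_real_derivative f' s) (at s)" "continuous_on UNIV f'"
    and "\<And>s. R < \<bar>s\<bar> \<Longrightarrow> f s = 0"
  shows "ennreal \<bar>f x\<bar> \<le> (\<integral>\<^sup>+s. ennreal \<bar>f' s\<bar> \<partial>lborel)"
proof -
  define r where "r = - (\<bar>R\<bar> + \<bar>x\<bar> + 1)"
  have r: "f r = 0" "r \<le> x" using assms(3)[of r] by (auto simp: r_def)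
  have c: "continuous_on {r..x} f'" using assms(2) continuous_on_subset by blast
  have "f x = f x - f r" using r by simp
  also have "\<dots> = (\<integral>s. indicator {r..x} s *\<^sub>R f' s \<partial>lborel)"
    using r assms(1) c
    by (intro integral_FTC_atLeastAtMost[symmetric])
       (auto simp: has_real_derivative_iff_has_vector_derivative intro: has_vector_derivative_at_within)
  finally have "ennreal \<bar>f x\<bar> \<le> ennreal (\<integral>s. norm (indicator {r..x} s *\<^sub>R f' s) \<partial>lborel)"
    using integral_norm_bound[of lborel "\<lambda>s. indicator {r..x} s *\<^sub>R f' s"] by (intro ennreal_leI) simp
  also have "\<dots> = (\<integral>\<^sup>+s. ennreal (norm (indicator {r..x} s *\<^sub>R f' s)) \<partial>lborel)"
    using borel_integrable_atLeastAtMost'[OF c]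
    by (intro nn_integral_eq_integral[symmetric]) (auto simp: set_integrable_def intro!: integrable_norm)
  also have "\<dots> \<le> (\<integral>\<^sup>+s. ennreal \<bar>f' s\<bar> \<partial>lborel)"
    by (intro nn_integral_mono) (auto simp: indicator_def)
  finally show ?thesis .
qed

lemma measurable_vector_real3 [measurable]:
  assumes [measurable]: "f \<in> borel_measurable M" "g \<in> borel_measurable M" "h \<in> borel_measurable M"
  shows "(\<lambda>x. vector [f x, g x, h x] :: real^3) \<in> borel_measurable M"
proof -
  have "(\<lambda>x. (f x, g x, h x)) \<in> measurable M (lborel \<Otimes>\<^sub>M lborel \<Otimes>\<^sub>M lborel)"
    by simp
  from measurable_compose[OF this measurable_vector_3] show ?thesis by simp
qed

lemma vector_real3_shift:
  fixes a b c :: real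
  shows "(vector [0, b, c] :: real^3) + a *\<^sub>R axis 1 1 = vector [a, b, c]"
    "(vector [a, 0, c] :: real^3) + b *\<^sub>R axis 2 1 = vector [a, b, c]"
    "(vector [a, b, 0] :: real^3) + c *\<^sub>R axis 3 1 = vector [a, b, c]"
  by (auto simp: vec_eq_iff forall_3 axis_def)

text \<open>The fourth power is the one that closes the estimate: its derivative carries the cube of
  \<open>\<phi>\<close>, whose square is the sixth power to be bounded, and the product of three
  square roots of fourth powers is that same sixth power. Finiteness is recorded so that real square
  roots of the line integrals can be taken.\<close>

lemma test_function_pow4_le_line_integral:
  fixes \<phi> :: "real^3 \<Rightarrow> real" and q e :: "real^3"
  assumes \<phi>: "\<phi> \<in> test_functions \<Omega>" and e: "norm e = 1"
  defines "G \<equiv> \<lambda>x. 4 * \<bar>\<phi> x\<bar> ^ 3 * \<bar>grad \<phi> x \<bullet> e\<bar>"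
  shows "ennreal (\<phi> (q + t *\<^sub>R e) ^ 4) \<le> (\<integral>\<^sup>+s. ennreal (G (q + s *\<^sub>R e)) \<partial>lborel)"
    and "(\<integral>\<^sup>+s. ennreal (G (q + s *\<^sub>R e)) \<partial>lborel) < \<infinity>"
proof -
  obtain K where K: "compact K" "\<And>x. x \<notin> K \<Longrightarrow> \<phi> x = 0"
    using test_function_support[OF \<phi>] by metis
  obtain R where R: "\<And>x. x \<in> K \<Longrightarrow> norm x \<le> R"
    using compact_imp_bounded[OF K(1)] by (auto simp: bounded_iff)
  have out: "\<phi> (q + s *\<^sub>R e) = 0" if "R + norm q < \<bar>s\<bar>" for s
  proof -
    have "\<bar>s\<bar> = norm ((q + s *\<^sub>R e) - q)" using e by simp
    also have "\<dots> \<le> norm (q + s *\<^sub>R e) + norm q" by (rule norm_triangle_ineq4)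
    finally have "\<not> norm (q + s *\<^sub>R e) \<le> R" using that by linarith
    thus ?thesis using R K(2) by blast
  qed
  let ?f = "\<lambda>s. \<phi> (q + s *\<^sub>R e) ^ 4" and ?f' = "\<lambda>s. 4 * \<phi> (q + s *\<^sub>R e) ^ 3 * (grad \<phi> (q + s *\<^sub>R e) \<bullet> e)"
  have D: "(?f has_real_derivative ?f' s) (at s)" for s
  proof -
    have "((\<lambda>s. q + s *\<^sub>R e) has_derivative (\<lambda>s. s *\<^sub>R e)) (at s)"
      by (auto intro!: derivative_eq_intros)
    from has_derivative_compose[OF this test_function_has_derivative[OF \<phi>]]
    have "((\<lambda>s. \<phi> (q + s *\<^sub>R e)) has_real_derivative (grad \<phi> (q + s *\<^sub>R e) \<bullet> e)) (at s)"
      by (simp add: has_field_derivative_def mult_commute_abs)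
    from DERIV_power[OF this, of 4] show ?thesis by (simp add: mult_ac)
  qed
  have line: "continuous_on UNIV (\<lambda>s. q + s *\<^sub>R e)" by (intro continuous_intros)
  have c1: "continuous_on UNIV (\<lambda>s. \<phi> (q + s *\<^sub>R e))"
    by (rule continuous_on_compose2[OF test_function_continuous[OF \<phi>] line subset_UNIV])
  have c2: "continuous_on UNIV (\<lambda>s. grad \<phi> (q + s *\<^sub>R e))"
    by (rule continuous_on_compose2[OF grad_continuous[OF \<phi>] line subset_UNIV])
  have c: "continuous_on UNIV ?f'" by (intro continuous_intros c1 c2)
  have eq: "\<bar>?f' s\<bar> = G (q + s *\<^sub>R e)" for s by (simp add: G_def abs_mult power_abs)
  have "ennreal \<bar>?f t\<bar> \<le> (\<integral>\<^sup>+s. ennreal \<bar>?f' s\<bar> \<partial>lborel)"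
    by (rule abs_le_nn_integral_derivative[OF D c, of "R + norm q"]) (use out in auto)
  thus "ennreal (\<phi> (q + t *\<^sub>R e) ^ 4) \<le> (\<integral>\<^sup>+s. ennreal (G (q + s *\<^sub>R e)) \<partial>lborel)"
    by (simp add: eq)
  have "integrable lborel ?f'"
  proof (rule integrable_compact_support[OF c])
    show "compact {- (R + norm q)..R + norm q}" by simp
    show "?f' s = 0" if "s \<notin> {- (R + norm q)..R + norm q}" for s
      using out[of s] that by auto
  qed
  hence "(\<integral>\<^sup>+s. ennreal (norm (?f' s)) \<partial>lborel) < \<infinity>" by (simp add: integrable_iff_bounded)
  thus "(\<integral>\<^sup>+s. ennreal (G (q + s *\<^sub>R e)) \<partial>lborel) < \<infinity>" by (simp add: eq)
qed

text \<open>
  By the fundamental theorem of calculus \<open>\<phi>\<^sup>4\<close> is bounded by the integral of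
  \<open>4 \<bar>\<phi>\<bar>\<^sup>3 \<bar>\<nabla>\<phi>\<bar>\<close> along each of the three coordinate lines. With
  \<open>I\<close> the left-hand side and \<open>d\<close> the Dirichlet integral, the Loomis-Whitney and
  Cauchy-Schwarz inequalities give \<open>I ^ 4 \<le> (16 I d) ^ 3\<close>.
\<close>

lemma sobolev_test_function:
  fixes \<phi> :: "real^3 \<Rightarrow> real"
  assumes \<phi>: "\<phi> \<in> test_functions \<Omega>"
  shows "(\<integral>x. \<phi> x ^ 6 \<partial>lborel) \<le> 4096 * (\<integral>x. (norm (grad \<phi> x))\<^sup>2 \<partial>lborel) ^ 3"
proof -
  obtain K where K: "compact K" "\<And>x. x \<notin> K \<Longrightarrow> \<phi> x = 0" "\<And>x. x \<notin> K \<Longrightarrow> grad \<phi> x = 0"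
    using test_function_support[OF \<phi>] by metis
  have cont: "continuous_on UNIV \<phi>" "continuous_on UNIV (grad \<phi>)"
    by (rule test_function_continuous[OF \<phi>] grad_continuous[OF \<phi>])+
  have [measurable]: "\<phi> \<in> borel_measurable borel" "grad \<phi> \<in> borel_measurable borel"
    using cont by (auto intro: borel_measurable_continuous_onI)
  define G where "G i x = 4 * \<bar>\<phi> x\<bar> ^ 3 * \<bar>grad \<phi> x \<bullet> axis i 1\<bar>" for i x
  have G_meas [measurable]: "G i \<in> borel_measurable borel" for i unfolding G_def by measurable
  define I where "I = (\<integral>x. \<phi> x ^ 6 \<partial>lborel)"
  define d where "d = (\<integral>x. (norm (grad \<phi> x))\<^sup>2 \<partial>lborel)"
  have "integrable lborel (\<lambda>x. \<phi> x ^ 6)"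
    by (rule integrable_compact_support[OF _ K(1)]) (use K cont in \<open>auto intro!: continuous_intros\<close>)
  hence I: "(\<integral>\<^sup>+x. ennreal (\<phi> x ^ 6) \<partial>lborel) = ennreal I"
    unfolding I_def by (rule nn_integral_eq_integral) auto
  have "integrable lborel (\<lambda>x. (norm (grad \<phi> x))\<^sup>2)"
    by (rule integrable_compact_support[OF _ K(1)]) (use K cont in \<open>auto intro!: continuous_intros\<close>)
  hence d: "(\<integral>\<^sup>+x. ennreal ((norm (grad \<phi> x))\<^sup>2) \<partial>lborel) = ennreal d"
    unfolding d_def by (rule nn_integral_eq_integral) auto
  have I0: "0 \<le> I" and d0: "0 \<le> d" unfolding I_def d_def by (auto intro!: integral_nonneg_AE)
  \<comment> \<open>Integrating a line integral over the two remaining coordinates gives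
    \<open>P i\<close>. Cauchy-Schwarz separates the cube of \<open>\<phi>\<close> from the
    gradient; the factor is \<open>16 = 4^2\<close>.\<close>
  define P where "P i = (\<integral>\<^sup>+x. ennreal (G i x) \<partial>lborel)" for i
  have P2: "(P i)\<^sup>2 \<le> ennreal (16 * I * d)" for i
  proof -
    have "P i = (\<integral>\<^sup>+x. ennreal (4 * \<bar>\<phi> x\<bar> ^ 3) * ennreal \<bar>grad \<phi> x \<bullet> axis i 1\<bar> \<partial>lborel)"
      unfolding P_def G_def by (intro nn_integral_cong) (simp add: ennreal_mult)
    also have "\<dots>\<^sup>2 \<le> (\<integral>\<^sup>+x. (ennreal (4 * \<bar>\<phi> x\<bar> ^ 3))\<^sup>2 \<partial>lborel) * (\<integral>\<^sup>+x. (ennreal \<bar>grad \<phi> x \<bullet> axis i 1\<bar>)\<^sup>2 \<partial>lborel)"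
      by (rule Cauchy_Schwarz_nn_integral) measurable
    also have "\<dots> \<le> (\<integral>\<^sup>+x. ennreal 16 * ennreal (\<phi> x ^ 6) \<partial>lborel) * (\<integral>\<^sup>+x. ennreal ((norm (grad \<phi> x))\<^sup>2) \<partial>lborel)"
    proof (intro mult_mono nn_integral_mono)
      fix x
      show "(ennreal (4 * \<bar>\<phi> x\<bar> ^ 3))\<^sup>2 \<le> ennreal 16 * ennreal (\<phi> x ^ 6)"
        by (simp add: ennreal_power ennreal_mult[symmetric] power_mult_distrib power_mult[symmetric] power_even_abs
          del: ennreal_numeral)
      have "\<bar>grad \<phi> x \<bullet> axis i 1\<bar> \<le> norm (grad \<phi> x) * norm (axis i 1 :: real^3)" by (rule Cauchy_Schwarz_ineq2)
      hence "\<bar>grad \<phi> x \<bullet> axis i 1\<bar>\<^sup>2 \<le> (norm (grad \<phi> x))\<^sup>2" by (intro power_mono) auto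
      thus "(ennreal \<bar>grad \<phi> x \<bullet> axis i 1\<bar>)\<^sup>2 \<le> ennreal ((norm (grad \<phi> x))\<^sup>2)"
        by (simp add: ennreal_power)
    qed auto
    also have "\<dots> = ennreal 16 * ennreal I * ennreal d"
      by (subst nn_integral_cmult) (auto simp: I d)
    also have "\<dots> = ennreal (16 * I * d)" using I0 d0 by (simp add: ennreal_mult del: ennreal_numeral)
    finally show ?thesis .
  qed
  \<comment> \<open>Each of the three functions has one coordinate integrated out and so depends on
    the other two only, which is the shape the Loomis-Whitney inequality asks of its
    factors.\<close>
  define f1 where "f1 p = (\<integral>\<^sup>+s. ennreal (G 1 (vector [s, fst p, snd p])) \<partial>lborel)" for p :: "real \<times> real"
  define f2 where "f2 p = (\<integral>\<^sup>+s. ennreal (G 2 (vector [fst p, s, snd p])) \<partial>lborel)" for p :: "real \<times> real"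
  define f3 where "f3 p = (\<integral>\<^sup>+s. ennreal (G 3 (vector [fst p, snd p, s])) \<partial>lborel)" for p :: "real \<times> real"
  have f_meas [measurable]: "f1 \<in> borel_measurable (lborel \<Otimes>\<^sub>M lborel)"
    "f2 \<in> borel_measurable (lborel \<Otimes>\<^sub>M lborel)" "f3 \<in> borel_measurable (lborel \<Otimes>\<^sub>M lborel)"
    unfolding f1_def f2_def f3_def by measurable
  note L = test_function_pow4_le_line_integral[OF \<phi>, folded G_def]
  have n1: "norm (axis i 1 :: real^3) = 1" for i by simp
  have fin: "f1 p < \<infinity>" "f2 p < \<infinity>" "f3 p < \<infinity>" for p
    using L(2)[OF n1[of 1], of "vector [0, fst p, snd p]"]
      L(2)[OF n1[of 2], of "vector [fst p, 0, snd p]"] L(2)[OF n1[of 3], of "vector [fst p, snd p, 0]"]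
    by (simp_all only: f1_def f2_def f3_def G_def vector_real3_shift)
  have le: "ennreal (\<phi> (vector [x, y, z]) ^ 4) \<le> f1 (y, z)" "ennreal (\<phi> (vector [x, y, z]) ^ 4) \<le> f2 (x, z)"
    "ennreal (\<phi> (vector [x, y, z]) ^ 4) \<le> f3 (x, y)" for x y z
    using L(1)[OF n1[of 1], of "vector [0, y, z]" x] L(1)[OF n1[of 2], of "vector [x, 0, z]" y]
      L(1)[OF n1[of 3], of "vector [x, y, 0]" z]
    by (simp_all only: f1_def f2_def f3_def G_def fst_conv snd_conv vector_real3_shift)
  \<comment> \<open>A square root for \<open>ennreal\<close> values that passes through
    \<open>enn2real\<close>; it squares back to \<open>f p\<close> only where \<open>f p\<close> is
    finite, hence \<open>fin\<close>.\<close>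
  define rt where "rt f p = ennreal (sqrt (enn2real (f p)))" for f :: "real \<times> real \<Rightarrow> ennreal" and p
  have rt_meas [measurable]: "rt f \<in> borel_measurable (lborel \<Otimes>\<^sub>M lborel)"
    if [measurable]: "f \<in> borel_measurable (lborel \<Otimes>\<^sub>M lborel)" for f
    unfolding rt_def by measurable
  have rt2: "(rt f p)\<^sup>2 = f p" if "f p < \<infinity>" for f p
    using that by (simp add: rt_def ennreal_power)
  have pt: "ennreal (\<phi> (vector [x, y, z]) ^ 6) \<le> rt f1 (y, z) * rt f2 (x, z) * rt f3 (x, y)" for x y z
  proof -
    define w where "w = \<phi> (vector [x, y, z])"
    define r1 r2 r3 where "r1 = enn2real (f1 (y, z))" and "r2 = enn2real (f2 (x, z))" and "r3 = enn2real (f3 (x, y))"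
    have r: "w ^ 4 \<le> r1" "w ^ 4 \<le> r2" "w ^ 4 \<le> r3"
      using enn2real_mono[OF le(1)[of x y z] fin(1)[unfolded infinity_ennreal_def]] enn2real_mono[OF le(2)[of x y z] fin(2)[unfolded infinity_ennreal_def]]
        enn2real_mono[OF le(3)[of x y z] fin(3)[unfolded infinity_ennreal_def]]
      by (simp_all add: r1_def r2_def r3_def w_def)
    have "w\<^sup>2 \<le> sqrt r1" "w\<^sup>2 \<le> sqrt r2" "w\<^sup>2 \<le> sqrt r3"
      using r by (auto intro!: real_le_rsqrt simp: power_mult[symmetric])
    moreover from this have "0 \<le> sqrt r1" "0 \<le> sqrt r2" "0 \<le> sqrt r3"
      using zero_le_power2[of w] by linarith+
    ultimately have "w\<^sup>2 * w\<^sup>2 * w\<^sup>2 \<le> sqrt r1 * sqrt r2 * sqrt r3"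
      by (intro mult_mono mult_nonneg_nonneg) auto
    also have "w\<^sup>2 * w\<^sup>2 * w\<^sup>2 = w ^ 6" by (simp add: power_add[symmetric])
    finally have "ennreal (w ^ 6) \<le> ennreal (sqrt r1 * sqrt r2 * sqrt r3)" by (rule ennreal_leI)
    thus ?thesis unfolding rt_def w_def r1_def r2_def r3_def by (simp add: ennreal_mult)
  qed
  have "ennreal I = (\<integral>\<^sup>+x. \<integral>\<^sup>+y. \<integral>\<^sup>+z. ennreal (\<phi> (vector [x, y, z]) ^ 6) \<partial>lborel \<partial>lborel \<partial>lborel)"
    unfolding I[symmetric] by (rule nn_integral_real3) measurable
  also have "\<dots> \<le> (\<integral>\<^sup>+x. \<integral>\<^sup>+y. \<integral>\<^sup>+z. rt f1 (y, z) * rt f2 (x, z) * rt f3 (x, y) \<partial>lborel \<partial>lborel \<partial>lborel)"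
    by (intro nn_integral_mono pt)
  finally have "(ennreal I)\<^sup>2 \<le> (\<integral>\<^sup>+x. \<integral>\<^sup>+y. \<integral>\<^sup>+z. rt f1 (y, z) * rt f2 (x, z) * rt f3 (x, y) \<partial>lborel \<partial>lborel \<partial>lborel)\<^sup>2"
    by (intro power_mono) auto
  also have "\<dots> \<le> (\<integral>\<^sup>+y. \<integral>\<^sup>+z. (rt f1 (y, z))\<^sup>2 \<partial>lborel \<partial>lborel) * (\<integral>\<^sup>+x. \<integral>\<^sup>+z. (rt f2 (x, z))\<^sup>2 \<partial>lborel \<partial>lborel)
      * (\<integral>\<^sup>+x. \<integral>\<^sup>+y. (rt f3 (x, y))\<^sup>2 \<partial>lborel \<partial>lborel)"
    by (rule loomis_whitney) measurable
  also have "(\<integral>\<^sup>+y. \<integral>\<^sup>+z. (rt f1 (y, z))\<^sup>2 \<partial>lborel \<partial>lborel) = P 1"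
  proof -
    have "(\<integral>\<^sup>+y. \<integral>\<^sup>+z. (rt f1 (y, z))\<^sup>2 \<partial>lborel \<partial>lborel)
        = (\<integral>\<^sup>+y. \<integral>\<^sup>+z. \<integral>\<^sup>+x. ennreal (G 1 (vector [x, y, z])) \<partial>lborel \<partial>lborel \<partial>lborel)"
      by (simp only: rt2[OF fin(1)]) (simp add: f1_def)
    also have "\<dots> = (\<integral>\<^sup>+y. \<integral>\<^sup>+x. \<integral>\<^sup>+z. ennreal (G 1 (vector [x, y, z])) \<partial>lborel \<partial>lborel \<partial>lborel)"
      by (intro nn_integral_cong lborel_pair.Fubini') measurable
    also have "\<dots> = (\<integral>\<^sup>+x. \<integral>\<^sup>+y. \<integral>\<^sup>+z. ennreal (G 1 (vector [x, y, z])) \<partial>lborel \<partial>lborel \<partial>lborel)"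
      by (rule lborel_pair.Fubini') measurable
    also have "\<dots> = P 1" unfolding P_def by (rule nn_integral_real3[symmetric]) measurable
    finally show ?thesis .
  qed
  also have "(\<integral>\<^sup>+x. \<integral>\<^sup>+z. (rt f2 (x, z))\<^sup>2 \<partial>lborel \<partial>lborel) = P 2"
  proof -
    have "(\<integral>\<^sup>+x. \<integral>\<^sup>+z. (rt f2 (x, z))\<^sup>2 \<partial>lborel \<partial>lborel)
        = (\<integral>\<^sup>+x. \<integral>\<^sup>+z. \<integral>\<^sup>+y. ennreal (G 2 (vector [x, y, z])) \<partial>lborel \<partial>lborel \<partial>lborel)"
      by (simp only: rt2[OF fin(2)]) (simp add: f2_def)
    also have "\<dots> = (\<integral>\<^sup>+x. \<integral>\<^sup>+y. \<integral>\<^sup>+z. ennreal (G 2 (vector [x, y, z])) \<partial>lborel \<partial>lborel \<partial>lborel)"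
      by (intro nn_integral_cong lborel_pair.Fubini') measurable
    also have "\<dots> = P 2" unfolding P_def by (rule nn_integral_real3[symmetric]) measurable
    finally show ?thesis .
  qed
  also have "(\<integral>\<^sup>+x. \<integral>\<^sup>+y. (rt f3 (x, y))\<^sup>2 \<partial>lborel \<partial>lborel) = P 3"
  proof -
    have "(\<integral>\<^sup>+x. \<integral>\<^sup>+y. (rt f3 (x, y))\<^sup>2 \<partial>lborel \<partial>lborel)
        = (\<integral>\<^sup>+x. \<integral>\<^sup>+y. \<integral>\<^sup>+z. ennreal (G 3 (vector [x, y, z])) \<partial>lborel \<partial>lborel \<partial>lborel)"
      by (simp only: rt2[OF fin(3)]) (simp add: f3_def)
    also have "\<dots> = P 3" unfolding P_def by (rule nn_integral_real3[symmetric]) measurable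
    finally show ?thesis .
  qed
  \<comment> \<open>The Loomis-Whitney bound is squared once more because \<open>P2\<close> controls
    the squares of the \<open>P i\<close>.\<close>
  finally have "((ennreal I)\<^sup>2)\<^sup>2 \<le> (P 1 * P 2 * P 3)\<^sup>2" by (intro power_mono) auto
  also have "\<dots> = (P 1)\<^sup>2 * (P 2)\<^sup>2 * (P 3)\<^sup>2" by (simp add: power_mult_distrib)
  also have "\<dots> \<le> ennreal (16 * I * d) * ennreal (16 * I * d) * ennreal (16 * I * d)"
    by (intro mult_mono P2) auto
  also have "\<dots> = ennreal ((16 * I * d) ^ 3)"
    using I0 d0 by (simp add: ennreal_mult[symmetric] power3_eq_cube del: ennreal_numeral)
  also have "((ennreal I)\<^sup>2)\<^sup>2 = ennreal (I ^ 4)"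
    using I0 by (simp add: ennreal_power power_mult[symmetric])
  finally have "I ^ 4 \<le> (16 * I * d) ^ 3"
    using I0 d0 by (simp add: ennreal_le_iff)
  \<comment> \<open>The power \<open>I ^ 3\<close> can be cancelled because \<open>I\<close> is a
    real number, the function having compact support; \<open>4096 = 16^3\<close>. The case
    \<open>I = 0\<close> is trivial.\<close>
  hence "I ^ 3 * I \<le> I ^ 3 * (4096 * d ^ 3)"
    by (simp add: power_mult_distrib eval_nat_numeral algebra_simps)
  hence "I = 0 \<or> I \<le> 4096 * d ^ 3" using I0 by (auto simp: mult_le_cancel_left)
  thus ?thesis unfolding I_def[symmetric] d_def[symmetric] using d0 by auto
qed

subsection \<open>The Sobolev space with zero boundary values\<close>

lemma Lspace_2_iff:
  "f \<in> Lspace 2 S \<longleftrightarrow> f \<in> borel_measurable (lebesgue_on S) \<and> integrable (lebesgue_on S) (\<lambda>x. (norm (f x))\<^sup>2)"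
  by (simp add: Lspace_def)

lemma Lnorm_2_squared: "(Lnorm 2 S f)\<^sup>2 = (\<integral>x. (norm (f x))\<^sup>2 \<partial>lebesgue_on S)"
proof -
  have "0 \<le> (\<integral>x. (norm (f x))\<^sup>2 \<partial>lebesgue_on S)" by (intro integral_nonneg_AE) auto
  thus ?thesis by (simp add: Lnorm_def powr_half_sqrt)
qed

lemma norm_add_squared_le:
  fixes a b :: "'a::real_normed_vector"
  shows "(norm (a + b))\<^sup>2 \<le> 2 * (norm a)\<^sup>2 + 2 * (norm b)\<^sup>2"
proof -
  have "(norm (a + b))\<^sup>2 \<le> (norm a + norm b)\<^sup>2"
    by (intro power_mono norm_triangle_ineq) auto
  moreover have "0 \<le> (norm a - norm b)\<^sup>2" by simp
  ultimately show ?thesis by (simp add: power2_sum power2_diff)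
qed

lemma Lspace_2_add:
  assumes "f \<in> Lspace 2 S" "g \<in> Lspace 2 S"
  shows "(\<lambda>x. f x + g x) \<in> Lspace 2 S"
  unfolding Lspace_2_iff
proof
  have m: "f \<in> borel_measurable (lebesgue_on S)" "g \<in> borel_measurable (lebesgue_on S)"
    and i: "integrable (lebesgue_on S) (\<lambda>x. (norm (f x))\<^sup>2)" "integrable (lebesgue_on S) (\<lambda>x. (norm (g x))\<^sup>2)"
    using assms by (auto simp: Lspace_2_iff)
  show fg: "(\<lambda>x. f x + g x) \<in> borel_measurable (lebesgue_on S)"
    using m by (rule borel_measurable_add)
  show "integrable (lebesgue_on S) (\<lambda>x. (norm (f x + g x))\<^sup>2)"
  proof (rule Bochner_Integration.integrable_bound)
    show "integrable (lebesgue_on S) (\<lambda>x. 2 * (norm (f x))\<^sup>2 + 2 * (norm (g x))\<^sup>2)"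
      using i by simp
    show "(\<lambda>x. (norm (f x + g x))\<^sup>2) \<in> borel_measurable (lebesgue_on S)"
      using fg by measurable
    show "AE x in lebesgue_on S. norm ((norm (f x + g x))\<^sup>2) \<le> norm (2 * (norm (f x))\<^sup>2 + 2 * (norm (g x))\<^sup>2)"
      using norm_add_squared_le by (auto intro!: AE_I2)
  qed
qed

lemma Lspace_2_scale: "f \<in> Lspace 2 S \<Longrightarrow> (\<lambda>x. c *\<^sub>R f x) \<in> Lspace 2 S"
  by (auto simp: Lspace_2_iff power_mult_distrib)

lemma Lspace_2_diff: "f \<in> Lspace 2 S \<Longrightarrow> g \<in> Lspace 2 S \<Longrightarrow> (\<lambda>x. f x - g x) \<in> Lspace 2 S"
  using Lspace_2_add[of f S "\<lambda>x. (-1) *\<^sub>R g x"] Lspace_2_scale[of g S "-1"] by simp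

lemma Lspace_2_integral_le:
  assumes "f \<in> Lspace 2 S" "g \<in> Lspace 2 S"
  shows "(\<integral>x. (norm (f x))\<^sup>2 \<partial>lebesgue_on S)
    \<le> 2 * (\<integral>x. (norm (g x))\<^sup>2 \<partial>lebesgue_on S) + 2 * (\<integral>x. (norm (f x - g x))\<^sup>2 \<partial>lebesgue_on S)"
proof -
  have i: "integrable (lebesgue_on S) (\<lambda>x. (norm (f x))\<^sup>2)" "integrable (lebesgue_on S) (\<lambda>x. (norm (g x))\<^sup>2)"
    "integrable (lebesgue_on S) (\<lambda>x. (norm (f x - g x))\<^sup>2)"
    using assms Lspace_2_diff[OF assms] by (auto simp: Lspace_2_iff)
  have "(\<integral>x. (norm (f x))\<^sup>2 \<partial>lebesgue_on S) \<le> (\<integral>x. 2 * (norm (g x))\<^sup>2 + 2 * (norm (f x - g x))\<^sup>2 \<partial>lebesgue_on S)"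
  proof (rule integral_mono)
    show "(norm (f x))\<^sup>2 \<le> 2 * (norm (g x))\<^sup>2 + 2 * (norm (f x - g x))\<^sup>2" for x
      using norm_add_squared_le[of "g x" "f x - g x"] by simp
  qed (use i in auto)
  also have "\<dots> = 2 * (\<integral>x. (norm (g x))\<^sup>2 \<partial>lebesgue_on S) + 2 * (\<integral>x. (norm (f x - g x))\<^sup>2 \<partial>lebesgue_on S)"
    using i by simp
  finally show ?thesis .
qed

lemma inner_le_squares: "\<bar>a \<bullet> b\<bar> \<le> 1 / 2 * (norm a)\<^sup>2 + 1 / 2 * (norm b)\<^sup>2"
  for a b :: "'a::real_inner"
proof -
  have "0 \<le> (norm a - norm b)\<^sup>2" by simp
  thus ?thesis using Cauchy_Schwarz_ineq2[of a b] by (simp add: power2_diff)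
qed

lemma Lspace_2_inner:
  fixes f g :: "'a::euclidean_space \<Rightarrow> 'b::euclidean_space"
  assumes "f \<in> Lspace 2 S" "g \<in> Lspace 2 S"
  shows "integrable (lebesgue_on S) (\<lambda>x. f x \<bullet> g x)"
    and "\<bar>\<integral>x. f x \<bullet> g x \<partial>lebesgue_on S\<bar>
      \<le> 1 / 2 * (\<integral>x. (norm (f x))\<^sup>2 \<partial>lebesgue_on S) + 1 / 2 * (\<integral>x. (norm (g x))\<^sup>2 \<partial>lebesgue_on S)"
proof -
  have [measurable]: "f \<in> borel_measurable (lebesgue_on S)" "g \<in> borel_measurable (lebesgue_on S)"
    and i: "integrable (lebesgue_on S) (\<lambda>x. (norm (f x))\<^sup>2)" "integrable (lebesgue_on S) (\<lambda>x. (norm (g x))\<^sup>2)"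
    using assms by (auto simp: Lspace_2_iff)
  have I: "integrable (lebesgue_on S) (\<lambda>x. 1 / 2 * (norm (f x))\<^sup>2 + 1 / 2 * (norm (g x))\<^sup>2)"
    using i by simp
  show int: "integrable (lebesgue_on S) (\<lambda>x. f x \<bullet> g x)"
  proof (rule Bochner_Integration.integrable_bound[OF I])
    show "AE x in lebesgue_on S. norm (f x \<bullet> g x) \<le> norm (1 / 2 * (norm (f x))\<^sup>2 + 1 / 2 * (norm (g x))\<^sup>2)"
      using inner_le_squares by (intro AE_I2) (fastforce simp: abs_of_nonneg)
  qed measurable
  have "\<bar>\<integral>x. f x \<bullet> g x \<partial>lebesgue_on S\<bar> \<le> (\<integral>x. \<bar>f x \<bullet> g x\<bar> \<partial>lebesgue_on S)"
    by (rule integral_abs_bound)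
  also have "\<dots> \<le> (\<integral>x. 1 / 2 * (norm (f x))\<^sup>2 + 1 / 2 * (norm (g x))\<^sup>2 \<partial>lebesgue_on S)"
    using inner_le_squares by (intro integral_mono I integrable_abs int) auto
  also have "\<dots> = 1 / 2 * (\<integral>x. (norm (f x))\<^sup>2 \<partial>lebesgue_on S) + 1 / 2 * (\<integral>x. (norm (g x))\<^sup>2 \<partial>lebesgue_on S)"
    using i by simp
  finally show "\<bar>\<integral>x. f x \<bullet> g x \<partial>lebesgue_on S\<bar>
      \<le> 1 / 2 * (\<integral>x. (norm (f x))\<^sup>2 \<partial>lebesgue_on S) + 1 / 2 * (\<integral>x. (norm (g x))\<^sup>2 \<partial>lebesgue_on S)" .
qed

lemma has_weak_gradient_diff:
  assumes u: "has_weak_gradient \<Omega> u G" and v: "has_weak_gradient \<Omega> v F" and \<Omega>: "open \<Omega>"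
  shows "has_weak_gradient \<Omega> (\<lambda>x. u x - v x) (\<lambda>x. G x - F x)"
  unfolding has_weak_gradient_def
proof (intro conjI allI impI ballI)
  fix K assume "compact K \<and> K \<subseteq> \<Omega>"
  thus "(\<lambda>x. u x - v x) absolutely_integrable_on K" "(\<lambda>x. G x - F x) absolutely_integrable_on K"
    using u v by (auto simp: has_weak_gradient_def intro!: set_integral_diff)
next
  fix \<phi> :: "'a \<Rightarrow> real" and i :: 'a assume \<phi>: "\<phi> \<in> test_functions \<Omega>" and i: "i \<in> Basis"
  have eq: "(\<integral>x. w x * frechet_derivative \<phi> (at x) i \<partial>lebesgue_on \<Omega>) = - (\<integral>x. (W x \<bullet> i) * \<phi> x \<partial>lebesgue_on \<Omega>)"
    and int: "integrable (lebesgue_on \<Omega>) (\<lambda>x. w x * frechet_derivative \<phi> (at x) i)"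
      "integrable (lebesgue_on \<Omega>) (\<lambda>x. (W x \<bullet> i) * \<phi> x)"
    if w: "has_weak_gradient \<Omega> w W" for w :: "'a \<Rightarrow> real" and W
  proof -
    show "(\<integral>x. w x * frechet_derivative \<phi> (at x) i \<partial>lebesgue_on \<Omega>) = - (\<integral>x. (W x \<bullet> i) * \<phi> x \<partial>lebesgue_on \<Omega>)"
      using w \<phi> i by (simp add: has_weak_gradient_def)
    have "integrable (lebesgue_on \<Omega>) (\<lambda>x. w x * (grad \<phi> x \<bullet> i))"
      using w by (intro integrable_mult_test_function test_function_partial \<phi> i \<Omega>) (simp add: has_weak_gradient_def)
    thus "integrable (lebesgue_on \<Omega>) (\<lambda>x. w x * frechet_derivative \<phi> (at x) i)"
      using i by (simp add: grad_inner_Basis)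
    show "integrable (lebesgue_on \<Omega>) (\<lambda>x. (W x \<bullet> i) * \<phi> x)"
    proof (rule integrable_mult_test_function[OF _ \<phi> \<Omega>])
      fix K assume "compact K" "K \<subseteq> \<Omega>"
      hence "integrable lebesgue (\<lambda>x. indicator K x *\<^sub>R W x)"
        using w by (auto simp: has_weak_gradient_def set_integrable_def)
      hence "integrable lebesgue (\<lambda>x. (indicator K x *\<^sub>R W x) \<bullet> i)" by (rule integrable_inner_left)
      thus "(\<lambda>x. W x \<bullet> i) absolutely_integrable_on K" by (simp add: set_integrable_def)
    qed
  qed
  show "(\<integral>x. (u x - v x) * frechet_derivative \<phi> (at x) i \<partial>lebesgue_on \<Omega>)
      = - (\<integral>x. ((G x - F x) \<bullet> i) * \<phi> x \<partial>lebesgue_on \<Omega>)"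
    using eq[OF u] eq[OF v] int[OF u] int[OF v] by (simp add: left_diff_distrib inner_diff_left)
qed

lemma AE_lebesgue_on_iff:
  "S \<in> sets lebesgue \<Longrightarrow> (AE x in lebesgue_on S. P x) \<longleftrightarrow> (AE x in lebesgue. x \<in> S \<longrightarrow> P x)"
  by (subst AE_restrict_space_iff) auto

lemma borel_measurable_lebesgue_AE_cong:
  fixes f g :: "'a::euclidean_space \<Rightarrow> 'b::euclidean_space"
  assumes f: "f \<in> borel_measurable (lebesgue_on S)" and eq: "AE x in lebesgue_on S. f x = g x"
    and S: "S \<in> sets lebesgue"
  shows "g \<in> borel_measurable (lebesgue_on S)"
proof -
  have 1: "(\<lambda>x. if x \<in> S then f x else 0) \<in> borel_measurable lebesgue"
    using borel_measurable_if_I[OF f S] .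
  have "AE x in lebesgue. (if x \<in> S then f x else 0) = (if x \<in> S then g x else 0)"
    using eq unfolding AE_lebesgue_on_iff[OF S] by eventually_elim auto
  from borel_measurable_AE[OF 1 this] show ?thesis by (rule borel_measurable_if_D)
qed

lemma Lspace_AE_cong:
  assumes f: "f \<in> Lspace q S" and eq: "AE x in lebesgue_on S. f x = g x" and S: "S \<in> sets lebesgue"
  shows "g \<in> Lspace q S"
proof -
  have g: "g \<in> borel_measurable (lebesgue_on S)"
    using f eq S by (auto simp: Lspace_def intro: borel_measurable_lebesgue_AE_cong)
  have "integrable (lebesgue_on S) (\<lambda>x. norm (g x) powr q)"
  proof (subst integrable_cong_AE)
    show "integrable (lebesgue_on S) (\<lambda>x. norm (f x) powr q)" using f by (simp add: Lspace_def)
    show "AE x in lebesgue_on S. norm (g x) powr q = norm (f x) powr q" using eq by eventually_elim simp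
    show "(\<lambda>x. norm (g x) powr q) \<in> borel_measurable (lebesgue_on S)"
      "(\<lambda>x. norm (f x) powr q) \<in> borel_measurable (lebesgue_on S)"
      using g f by (auto simp: Lspace_def)
  qed
  thus ?thesis using g by (simp add: Lspace_def)
qed

text \<open>No measurability is assumed: by completeness of Lebesgue measure \<open>f\<close> and
  \<open>g\<close> are measurable together, and if they are not, neither is integrable and both
  integrals take the default value 0.\<close>

lemma integral_lebesgue_on_AE_cong:
  fixes f g :: "'a::euclidean_space \<Rightarrow> 'b::euclidean_space"
  assumes eq: "AE x in lebesgue_on S. f x = g x" and S: "S \<in> sets lebesgue"
  shows "(\<integral>x. f x \<partial>lebesgue_on S) = (\<integral>x. g x \<partial>lebesgue_on S)"
proof (cases "f \<in> borel_measurable (lebesgue_on S)")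
  case True
  thus ?thesis using borel_measurable_lebesgue_AE_cong[OF True eq S] eq by (intro integral_cong_AE)
next
  case False
  have "AE x in lebesgue_on S. g x = f x" using eq by eventually_elim simp
  hence "g \<notin> borel_measurable (lebesgue_on S)"
    using False borel_measurable_lebesgue_AE_cong[OF _ _ S] by blast
  thus ?thesis using False
    by (metis borel_measurable_integrable not_integrable_integral_eq)
qed

text \<open>Stated as an equality of predicates so that the choice operator in
  \<open>weak_grad\<close> selects the very same function for \<open>u\<close> and
  \<open>v\<close>.\<close>

lemma has_weak_gradient_AE_cong:
  assumes eq: "AE x in lebesgue_on \<Omega>. u x = v x" and \<Omega>: "open \<Omega>"
  shows "has_weak_gradient \<Omega> u = has_weak_gradient \<Omega> v"
proof -
  have S: "\<Omega> \<in> sets lebesgue" using \<Omega> by (rule sets_lebesgue_open)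
  have *: "has_weak_gradient \<Omega> v G"
    if w: "has_weak_gradient \<Omega> u G" and eq: "AE x in lebesgue_on \<Omega>. u x = v x"
    for u v :: "'a \<Rightarrow> real" and G
    unfolding has_weak_gradient_def
  proof (intro conjI allI impI ballI)
    fix K assume K: "compact K \<and> K \<subseteq> \<Omega>"
    show "G absolutely_integrable_on K" using w K by (simp add: has_weak_gradient_def)
    have i: "integrable lebesgue (\<lambda>x. indicator K x *\<^sub>R u x)"
      using w K by (auto simp: has_weak_gradient_def set_integrable_def)
    have e: "AE x in lebesgue. indicator K x *\<^sub>R u x = indicator K x *\<^sub>R v x"
      using eq K unfolding AE_lebesgue_on_iff[OF S] by (auto elim!: eventually_mono simp: indicator_def)
    have m: "(\<lambda>x. indicator K x *\<^sub>R v x) \<in> borel_measurable lebesgue"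
      by (rule borel_measurable_AE[OF borel_measurable_integrable[OF i] e])
    have "integrable lebesgue (\<lambda>x. indicator K x *\<^sub>R v x)"
      using integrable_cong_AE[OF borel_measurable_integrable[OF i] m e] i by blast
    thus "v absolutely_integrable_on K" by (simp add: set_integrable_def)
  next
    fix \<phi> :: "'a \<Rightarrow> real" and i :: 'a assume \<phi>: "\<phi> \<in> test_functions \<Omega>" and i: "i \<in> Basis"
    have "(\<integral>x. v x * frechet_derivative \<phi> (at x) i \<partial>lebesgue_on \<Omega>)
        = (\<integral>x. u x * frechet_derivative \<phi> (at x) i \<partial>lebesgue_on \<Omega>)"
      using eq by (intro integral_lebesgue_on_AE_cong S) (auto elim!: eventually_mono)
    also have "\<dots> = - (\<integral>x. (G x \<bullet> i) * \<phi> x \<partial>lebesgue_on \<Omega>)"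
      using w \<phi> i by (simp add: has_weak_gradient_def)
    finally show "(\<integral>x. v x * frechet_derivative \<phi> (at x) i \<partial>lebesgue_on \<Omega>)
        = - (\<integral>x. (G x \<bullet> i) * \<phi> x \<partial>lebesgue_on \<Omega>)" .
  qed
  have eq': "AE x in lebesgue_on \<Omega>. v x = u x" using eq by eventually_elim simp
  show ?thesis using *[OF _ eq] *[OF _ eq'] by (intro ext) blast
qed

lemma weak_grad_AE_cong:
  "AE x in lebesgue_on \<Omega>. u x = v x \<Longrightarrow> open \<Omega> \<Longrightarrow> weak_grad \<Omega> u = weak_grad \<Omega> v"
  unfolding weak_grad_def by (simp add: has_weak_gradient_AE_cong)

text \<open>The weak gradient known to be square integrable may differ from the chosen one;
  uniqueness up to null sets transfers the property.\<close>

lemma H1_weak_grad: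
  assumes u: "u \<in> H1 \<Omega>" and \<Omega>: "open \<Omega>"
  shows "u \<in> Lspace 2 \<Omega>" "has_weak_gradient \<Omega> u (weak_grad \<Omega> u)" "weak_grad \<Omega> u \<in> Lspace 2 \<Omega>"
proof -
  obtain G where G: "has_weak_gradient \<Omega> u G" "G \<in> Lspace 2 \<Omega>" using u by (auto simp: H1_def)
  show "u \<in> Lspace 2 \<Omega>" using u by (simp add: H1_def)
  show w: "has_weak_gradient \<Omega> u (weak_grad \<Omega> u)"
    unfolding weak_grad_def using G(1) by (rule someI[of "has_weak_gradient \<Omega> u"])
  show "weak_grad \<Omega> u \<in> Lspace 2 \<Omega>"
    by (rule Lspace_AE_cong[OF G(2) weak_gradient_unique[OF G(1) w \<Omega>] sets_lebesgue_open[OF \<Omega>]])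
qed

lemma H1_diff:
  assumes u: "u \<in> H1 \<Omega>" and v: "v \<in> H1 \<Omega>" and \<Omega>: "open \<Omega>"
  shows "(\<lambda>x. u x - v x) \<in> H1 \<Omega>"
    and "AE x in lebesgue_on \<Omega>. weak_grad \<Omega> (\<lambda>x. u x - v x) x = weak_grad \<Omega> u x - weak_grad \<Omega> v x"
proof -
  note U = H1_weak_grad[OF u \<Omega>] and V = H1_weak_grad[OF v \<Omega>]
  have w: "has_weak_gradient \<Omega> (\<lambda>x. u x - v x) (\<lambda>x. weak_grad \<Omega> u x - weak_grad \<Omega> v x)"
    by (rule has_weak_gradient_diff[OF U(2) V(2) \<Omega>])
  show H: "(\<lambda>x. u x - v x) \<in> H1 \<Omega>"
    using w Lspace_2_diff[OF U(1) V(1)] Lspace_2_diff[OF U(3) V(3)] by (auto simp: H1_def)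
  show "AE x in lebesgue_on \<Omega>. weak_grad \<Omega> (\<lambda>x. u x - v x) x = weak_grad \<Omega> u x - weak_grad \<Omega> v x"
    by (rule weak_gradient_unique[OF H1_weak_grad(2)[OF H \<Omega>] w \<Omega>])
qed

lemma H1_norm_diff_squared:
  assumes u: "u \<in> H1 \<Omega>" and v: "v \<in> H1 \<Omega>" and \<Omega>: "open \<Omega>"
  shows "(H1_norm \<Omega> (\<lambda>x. u x - v x))\<^sup>2 = (\<integral>x. (u x - v x)\<^sup>2 \<partial>lebesgue_on \<Omega>)
    + (\<integral>x. (norm (weak_grad \<Omega> u x - weak_grad \<Omega> v x))\<^sup>2 \<partial>lebesgue_on \<Omega>)"
proof -
  have "(\<integral>x. (norm (weak_grad \<Omega> (\<lambda>x. u x - v x) x))\<^sup>2 \<partial>lebesgue_on \<Omega>)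
    = (\<integral>x. (norm (weak_grad \<Omega> u x - weak_grad \<Omega> v x))\<^sup>2 \<partial>lebesgue_on \<Omega>)"
    using H1_diff(2)[OF assms] by (intro integral_lebesgue_on_AE_cong sets_lebesgue_open[OF \<Omega>])
      (auto elim!: eventually_mono)
  thus ?thesis by (simp add: H1_norm_def Lnorm_2_squared)
qed

lemma continuous_compact_support_Lspace_2:
  fixes f :: "'a::euclidean_space \<Rightarrow> 'b::euclidean_space"
  assumes c: "continuous_on UNIV f" and K: "compact K" "\<And>x. x \<notin> K \<Longrightarrow> f x = 0" and S: "S \<in> sets lebesgue"
  shows "f \<in> Lspace 2 S"
proof -
  have "integrable lborel (\<lambda>x. (norm (f x))\<^sup>2)"
    by (rule integrable_compact_support[OF _ K(1)]) (use K c in \<open>auto intro!: continuous_intros\<close>)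
  hence "integrable lebesgue (\<lambda>x. (norm (f x))\<^sup>2)"
    by (subst integrable_completion) (rule borel_measurable_integrable)
  thus ?thesis
    using continuous_measurable_lebesgue[OF c] S
    by (auto simp: Lspace_2_iff intro: integrable_lebesgue_on measurable_restrict_space1)
qed

lemma test_function_H1:
  assumes \<phi>: "\<phi> \<in> test_functions \<Omega>" and \<Omega>: "open \<Omega>"
  shows "\<phi> \<in> H1 \<Omega>" "AE x in lebesgue_on \<Omega>. weak_grad \<Omega> \<phi> x = grad \<phi> x" "grad \<phi> \<in> Lspace 2 \<Omega>"
proof -
  obtain K where K: "compact K" "\<And>x. x \<notin> K \<Longrightarrow> \<phi> x = 0" "\<And>x. x \<notin> K \<Longrightarrow> grad \<phi> x = 0"
    using test_function_support[OF \<phi>] by metis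
  show g: "grad \<phi> \<in> Lspace 2 \<Omega>"
    by (rule continuous_compact_support_Lspace_2[OF grad_continuous[OF \<phi>] K(1,3) sets_lebesgue_open[OF \<Omega>]])
  have "\<phi> \<in> Lspace 2 \<Omega>"
    by (rule continuous_compact_support_Lspace_2[OF test_function_continuous[OF \<phi>] K(1,2) sets_lebesgue_open[OF \<Omega>]])
  thus H: "\<phi> \<in> H1 \<Omega>" using g test_function_weak_gradient[OF \<phi> \<Omega>] by (auto simp: H1_def)
  show "AE x in lebesgue_on \<Omega>. weak_grad \<Omega> \<phi> x = grad \<phi> x"
    by (rule weak_gradient_unique[OF H1_weak_grad(2)[OF H \<Omega>] test_function_weak_gradient[OF \<phi> \<Omega>] \<Omega>])
qed

text \<open>Convergence in \<open>H1_norm\<close> is split into its two parts, with the classical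
  gradients of the approximations in place of their chosen weak ones.\<close>

lemma H10_approximation:
  assumes u: "u \<in> H10 \<Omega>" and \<Omega>: "open \<Omega>"
  shows "\<exists>\<phi>. (\<forall>n. \<phi> n \<in> test_functions \<Omega>) \<and>
    (\<lambda>n. \<integral>x. (\<phi> n x - u x)\<^sup>2 \<partial>lebesgue_on \<Omega>) \<longlonglongrightarrow> 0 \<and>
    (\<lambda>n. \<integral>x. (norm (grad (\<phi> n) x - weak_grad \<Omega> u x))\<^sup>2 \<partial>lebesgue_on \<Omega>) \<longlonglongrightarrow> 0"
proof -
  obtain \<phi> where \<phi>: "\<And>n. \<phi> n \<in> test_functions \<Omega>"
    and lim: "(\<lambda>n. H1_norm \<Omega> (\<lambda>x. \<phi> n x - u x)) \<longlonglongrightarrow> 0" and uH: "u \<in> H1 \<Omega>"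
    using u by (auto simp: H10_def)
  have eq: "(H1_norm \<Omega> (\<lambda>x. \<phi> n x - u x))\<^sup>2 = (\<integral>x. (\<phi> n x - u x)\<^sup>2 \<partial>lebesgue_on \<Omega>)
      + (\<integral>x. (norm (grad (\<phi> n) x - weak_grad \<Omega> u x))\<^sup>2 \<partial>lebesgue_on \<Omega>)" for n
  proof -
    have "(\<integral>x. (norm (weak_grad \<Omega> (\<phi> n) x - weak_grad \<Omega> u x))\<^sup>2 \<partial>lebesgue_on \<Omega>)
        = (\<integral>x. (norm (grad (\<phi> n) x - weak_grad \<Omega> u x))\<^sup>2 \<partial>lebesgue_on \<Omega>)"
      using test_function_H1(2)[OF \<phi> \<Omega>, of n]
      by (intro integral_lebesgue_on_AE_cong sets_lebesgue_open[OF \<Omega>]) (auto elim!: eventually_mono)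
    thus ?thesis using H1_norm_diff_squared[OF test_function_H1(1)[OF \<phi> \<Omega>] uH \<Omega>] by simp
  qed
  have lim2: "(\<lambda>n. (H1_norm \<Omega> (\<lambda>x. \<phi> n x - u x))\<^sup>2) \<longlonglongrightarrow> 0"
    using tendsto_power[OF lim, of 2] by simp
  have nn: "0 \<le> (\<integral>x. (\<phi> n x - u x)\<^sup>2 \<partial>lebesgue_on \<Omega>)"
    "0 \<le> (\<integral>x. (norm (grad (\<phi> n) x - weak_grad \<Omega> u x))\<^sup>2 \<partial>lebesgue_on \<Omega>)" for n
    by (intro integral_nonneg_AE; simp)+
  show ?thesis
  proof (intro exI conjI allI)
    show "\<phi> n \<in> test_functions \<Omega>" for n by (rule \<phi>)
    show "(\<lambda>n. \<integral>x. (\<phi> n x - u x)\<^sup>2 \<partial>lebesgue_on \<Omega>) \<longlonglongrightarrow> 0"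
      by (rule tendsto_sandwich[OF _ _ tendsto_const lim2]) (use nn eq in auto)
    show "(\<lambda>n. \<integral>x. (norm (grad (\<phi> n) x - weak_grad \<Omega> u x))\<^sup>2 \<partial>lebesgue_on \<Omega>) \<longlonglongrightarrow> 0"
      by (rule tendsto_sandwich[OF _ _ tendsto_const lim2]) (use nn eq in auto)
  qed
qed

text \<open>Approximation by test functions and Fatou's lemma along an almost everywhere convergent
  subsequence. The constant is \<open>32768 = 8 * 4096\<close>, where 8 is the cube of the factor 2
  lost in the squared triangle inequality for the gradients.\<close>

lemma sobolev_H10_6:
  fixes u :: "real^3 \<Rightarrow> real"
  assumes u: "u \<in> H10 \<Omega>" and \<Omega>: "open \<Omega>"
  defines "W \<equiv> (\<integral>x. (norm (weak_grad \<Omega> u x))\<^sup>2 \<partial>lebesgue_on \<Omega>)"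
  shows "integrable (lebesgue_on \<Omega>) (\<lambda>x. u x ^ 6)" "(\<integral>x. u x ^ 6 \<partial>lebesgue_on \<Omega>) \<le> 32768 * W ^ 3"
proof -
  let ?M = "lebesgue_on \<Omega>"
  have S: "\<Omega> \<in> sets lebesgue" using \<Omega> by (rule sets_lebesgue_open)
  obtain \<phi> where \<phi>: "\<And>n. \<phi> n \<in> test_functions \<Omega>"
    and lim1: "(\<lambda>n. \<integral>x. (\<phi> n x - u x)\<^sup>2 \<partial>?M) \<longlonglongrightarrow> 0"
    and lim2: "(\<lambda>n. \<integral>x. (norm (grad (\<phi> n) x - weak_grad \<Omega> u x))\<^sup>2 \<partial>?M) \<longlonglongrightarrow> 0"
    using H10_approximation[OF u \<Omega>] by blast
  have uH: "u \<in> H1 \<Omega>" using u by (simp add: H10_def)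
  note U = H1_weak_grad[OF uH \<Omega>]
  have um [measurable]: "u \<in> borel_measurable ?M" using U(1) by (simp add: Lspace_2_iff)
  have \<phi>m [measurable]: "\<phi> n \<in> borel_measurable ?M" for n
    by (intro measurable_restrict_space1 continuous_measurable_lebesgue test_function_continuous[OF \<phi>])
  have W0: "0 \<le> W" unfolding W_def by (intro integral_nonneg_AE) auto
  define \<epsilon> where "\<epsilon> n = (\<integral>x. (norm (grad (\<phi> n) x - weak_grad \<Omega> u x))\<^sup>2 \<partial>?M)" for n
  have bound: "(\<integral>\<^sup>+x. ennreal (\<phi> n x ^ 6) \<partial>?M) \<le> ennreal (4096 * (2 * W + 2 * \<epsilon> n) ^ 3)" for n
  proof -
    obtain K where K: "compact K" "K \<subseteq> \<Omega>" "\<And>x. x \<notin> K \<Longrightarrow> \<phi> n x = 0" "\<And>x. x \<notin> K \<Longrightarrow> grad (\<phi> n) x = 0"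
      using test_function_support[OF \<phi>] by metis
    have c: "continuous_on UNIV (\<lambda>x. \<phi> n x ^ 6)" "continuous_on UNIV (\<lambda>x. (norm (grad (\<phi> n) x))\<^sup>2)"
      by (intro continuous_intros test_function_continuous[OF \<phi>] grad_continuous[OF \<phi>])+
    have "integrable lborel (\<lambda>x. \<phi> n x ^ 6)"
      using K by (intro integrable_compact_support[OF c(1) K(1)]) auto
    hence "integrable lebesgue (\<lambda>x. \<phi> n x ^ 6)"
      by (subst integrable_completion) (rule borel_measurable_integrable)
    hence "integrable ?M (\<lambda>x. \<phi> n x ^ 6)" by (rule integrable_lebesgue_on[OF _ S])
    hence "(\<integral>\<^sup>+x. ennreal (\<phi> n x ^ 6) \<partial>?M) = ennreal (\<integral>x. \<phi> n x ^ 6 \<partial>?M)"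
      by (rule nn_integral_eq_integral) auto
    also have "(\<integral>x. \<phi> n x ^ 6 \<partial>?M) = (\<integral>x. \<phi> n x ^ 6 \<partial>lborel)"
      using K by (intro integral_lebesgue_on_support[OF c(1) _ K(2) \<Omega>]) auto
    also have "\<dots> \<le> 4096 * (\<integral>x. (norm (grad (\<phi> n) x))\<^sup>2 \<partial>lborel) ^ 3"
      by (rule sobolev_test_function[OF \<phi>])
    also have "(\<integral>x. (norm (grad (\<phi> n) x))\<^sup>2 \<partial>lborel) = (\<integral>x. (norm (grad (\<phi> n) x))\<^sup>2 \<partial>?M)"
      using K by (intro integral_lebesgue_on_support[OF c(2) _ K(2) \<Omega>, symmetric]) auto
    also have "4096 * \<dots> ^ 3 \<le> 4096 * (2 * W + 2 * \<epsilon> n) ^ 3"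
      unfolding W_def \<epsilon>_def
      by (intro mult_left_mono power_mono Lspace_2_integral_le test_function_H1(3)[OF \<phi> \<Omega>] U(3))
         (auto intro!: integral_nonneg_AE)
    finally show ?thesis by (simp add: ennreal_leI)
  qed
  have "\<exists>r. strict_mono r \<and> (AE x in ?M. (\<lambda>n. (\<phi> (r n) x - u x)\<^sup>2) \<longlonglongrightarrow> 0)"
  proof (rule tendsto_L1_AE_subseq)
    show "integrable ?M (\<lambda>x. (\<phi> n x - u x)\<^sup>2)" for n
      using Lspace_2_diff[OF H1_weak_grad(1)[OF test_function_H1(1)[OF \<phi> \<Omega>] \<Omega>] U(1)]
      by (simp add: Lspace_2_iff)
    show "(\<lambda>n. \<integral>x. norm ((\<phi> n x - u x)\<^sup>2) \<partial>?M) \<longlonglongrightarrow> 0" using lim1 by simp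
  qed
  then obtain r where r: "strict_mono r" "AE x in ?M. (\<lambda>n. (\<phi> (r n) x - u x)\<^sup>2) \<longlonglongrightarrow> 0" by blast
  have "(\<integral>\<^sup>+x. ennreal (u x ^ 6) \<partial>?M) = (\<integral>\<^sup>+x. liminf (\<lambda>n. ennreal (\<phi> (r n) x ^ 6)) \<partial>?M)"
  proof (rule nn_integral_cong_AE)
    show "AE x in ?M. ennreal (u x ^ 6) = liminf (\<lambda>n. ennreal (\<phi> (r n) x ^ 6))"
      using r(2)
    proof eventually_elim
      case (elim x)
      have "(\<lambda>n. \<bar>\<phi> (r n) x - u x\<bar>) \<longlonglongrightarrow> 0" using tendsto_real_sqrt[OF elim] by simp
      hence "(\<lambda>n. \<phi> (r n) x) \<longlonglongrightarrow> u x" by (simp add: tendsto_rabs_zero_iff LIM_zero_iff)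
      hence "(\<lambda>n. ennreal (\<phi> (r n) x ^ 6)) \<longlonglongrightarrow> ennreal (u x ^ 6)"
        by (intro tendsto_ennrealI tendsto_power)
      thus ?case by (intro lim_imp_Liminf[symmetric]) auto
    qed
  qed
  also have "\<dots> \<le> liminf (\<lambda>n. \<integral>\<^sup>+x. ennreal (\<phi> (r n) x ^ 6) \<partial>?M)"
    by (intro nn_integral_liminf) measurable
  also have "\<dots> \<le> liminf (\<lambda>n. ennreal (4096 * (2 * W + 2 * \<epsilon> (r n)) ^ 3))"
    by (intro Liminf_mono always_eventually allI bound)
  also have "\<dots> = ennreal (4096 * (2 * W + 2 * 0) ^ 3)"
  proof (intro lim_imp_Liminf tendsto_ennrealI tendsto_intros)
    show "(\<lambda>n. \<epsilon> (r n)) \<longlonglongrightarrow> 0"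
      using LIMSEQ_subseq_LIMSEQ[OF lim2 r(1)] by (simp add: \<epsilon>_def[abs_def] o_def)
  qed auto
  finally have le: "(\<integral>\<^sup>+x. ennreal (u x ^ 6) \<partial>?M) \<le> ennreal (32768 * W ^ 3)"
    by (simp add: power_mult_distrib)
  show int: "integrable ?M (\<lambda>x. u x ^ 6)"
  proof (rule integrableI_bounded)
    show "(\<integral>\<^sup>+x. ennreal (norm (u x ^ 6)) \<partial>?M) < \<infinity>"
      using le by (auto intro: le_less_trans)
  qed measurable
  have "ennreal (\<integral>x. u x ^ 6 \<partial>?M) \<le> ennreal (32768 * W ^ 3)"
    using nn_integral_eq_integral[OF int] le by simp
  thus "(\<integral>x. u x ^ 6 \<partial>?M) \<le> 32768 * W ^ 3" using W0 by (simp add: ennreal_le_iff)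
qed

text \<open>Splitting the values of \<open>u\<close> at a level \<open>l\<close> bounds the power
  \<open>q\<close> by \<open>l powr q + l powr (q - 6) * u x ^ 6\<close>. The level
  \<open>sqrt W\<close> gives both terms, after integration, the same homogeneity
  \<open>W powr (q / 2)\<close>.\<close>

lemma sobolev_H10:
  fixes u :: "real^3 \<Rightarrow> real"
  assumes u: "u \<in> H10 \<Omega>" and \<Omega>: "open \<Omega>" "bounded \<Omega>" and q: "0 < q" "q \<le> 6"
  defines "W \<equiv> (\<integral>x. (norm (weak_grad \<Omega> u x))\<^sup>2 \<partial>lebesgue_on \<Omega>)"
  shows "integrable (lebesgue_on \<Omega>) (\<lambda>x. \<bar>u x\<bar> powr q)"
    "(\<integral>x. \<bar>u x\<bar> powr q \<partial>lebesgue_on \<Omega>) \<le> (measure lebesgue \<Omega> + 32768) * W powr (q / 2)"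
proof -
  let ?M = "lebesgue_on \<Omega>"
  have S: "\<Omega> \<in> lmeasurable" using \<Omega> by (simp add: bounded_set_imp_lmeasurable)
  interpret finite_measure ?M using S by (rule finite_measure_lebesgue_on)
  note u6 = sobolev_H10_6[OF u \<Omega>(1), folded W_def]
  have [measurable]: "u \<in> borel_measurable ?M"
    using u H1_weak_grad(1)[OF _ \<Omega>(1)] by (auto simp: H10_def Lspace_2_iff)
  have W0: "0 \<le> W" unfolding W_def by (intro integral_nonneg_AE) auto
  have meas: "measure ?M (space ?M) = measure lebesgue \<Omega>"
    using S by (subst measure_restrict_space) auto
  have pt: "\<bar>v\<bar> powr q \<le> l powr q + l powr (q - 6) * v ^ 6" if l: "0 < l" for l v :: real
  proof (cases "\<bar>v\<bar> \<le> l")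
    case True
    hence "\<bar>v\<bar> powr q \<le> l powr q" using q by (intro powr_mono2) auto
    thus ?thesis by (simp add: add_increasing2)
  next
    case False
    have "\<bar>v\<bar> powr q = \<bar>v\<bar> powr (q - 6) * \<bar>v\<bar> powr 6" using powr_add[of "\<bar>v\<bar>" "q - 6" 6] by simp
    also have "\<dots> \<le> l powr (q - 6) * \<bar>v\<bar> powr 6"
      using False l q by (intro mult_right_mono powr_mono2') auto
    also have "\<bar>v\<bar> powr 6 = v ^ 6" by simp
    finally show ?thesis by (simp add: add_increasing)
  qed
  show int: "integrable ?M (\<lambda>x. \<bar>u x\<bar> powr q)"
  proof (rule Bochner_Integration.integrable_bound)
    show "integrable ?M (\<lambda>x. 1 + u x ^ 6)" using u6(1) by simp
    show "AE x in ?M. norm (\<bar>u x\<bar> powr q) \<le> norm (1 + u x ^ 6)"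
      using pt[of 1] by (intro AE_I2) simp
  qed measurable
  have C: "0 \<le> measure lebesgue \<Omega> + 32768" by (simp add: add_nonneg_nonneg)
  show "(\<integral>x. \<bar>u x\<bar> powr q \<partial>?M) \<le> (measure lebesgue \<Omega> + 32768) * W powr (q / 2)"
  \<comment> \<open>The level \<open>sqrt W\<close> has to be positive, so a vanishing gradient is
    treated separately: the bound on the sixth power then forces \<open>u = 0\<close> almost
    everywhere.\<close>
  proof (cases "W = 0")
    case True
    have "(\<integral>x. u x ^ 6 \<partial>?M) = 0" using u6(2) True by (intro antisym integral_nonneg_AE) auto
    hence "AE x in ?M. u x ^ 6 = 0" using integral_nonneg_eq_0_iff_AE[OF u6(1)] by simp
    hence "AE x in ?M. \<bar>u x\<bar> powr q = 0" by eventually_elim simp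
    hence "(\<integral>x. \<bar>u x\<bar> powr q \<partial>?M) = 0" by (rule integral_eq_zero_AE)
    thus ?thesis using C by simp
  next
    case False
    hence W: "0 < W" using W0 by simp
    define l where "l = W powr (1 / 2)"
    have l: "0 < l" using W by (simp add: l_def)
    have "(\<integral>x. \<bar>u x\<bar> powr q \<partial>?M) \<le> (\<integral>x. l powr q + l powr (q - 6) * u x ^ 6 \<partial>?M)"
      using pt[OF l] u6(1) by (intro integral_mono int) auto
    also have "\<dots> = l powr q * measure lebesgue \<Omega> + l powr (q - 6) * (\<integral>x. u x ^ 6 \<partial>?M)"
      using u6(1) meas by simp
    also have "\<dots> \<le> l powr q * measure lebesgue \<Omega> + l powr (q - 6) * (32768 * W ^ 3)"
      using u6(2) by (intro add_left_mono mult_left_mono) auto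
    also have "l powr q = W powr (q / 2)" by (simp add: l_def powr_powr)
    also have "l powr (q - 6) * (32768 * W ^ 3) = 32768 * (W powr ((q - 6) / 2) * W powr 3)"
      using W by (simp add: l_def powr_powr)
    also have "W powr ((q - 6) / 2) * W powr 3 = W powr (q / 2)"
      using W by (simp add: powr_add[symmetric] diff_divide_distrib del: powr_numeral)
    finally show ?thesis by (simp add: algebra_simps)
  qed
qed

lemma sobolev_H10_Lnorm:
  fixes u :: "real^3 \<Rightarrow> real"
  assumes u: "u \<in> H10 \<Omega>" and \<Omega>: "open \<Omega>" "bounded \<Omega>" and q: "0 < q" "q \<le> 6"
  shows "u \<in> Lspace q \<Omega>"
    "Lnorm q \<Omega> u \<le> (measure lebesgue \<Omega> + 32768) powr (1 / q) * Lnorm 2 \<Omega> (weak_grad \<Omega> u)"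
proof -
  have "u \<in> borel_measurable (lebesgue_on \<Omega>)"
    using u H1_weak_grad(1)[OF _ \<Omega>(1)] by (auto simp: H10_def Lspace_2_iff)
  thus "u \<in> Lspace q \<Omega>" using sobolev_H10(1)[OF assms] by (simp add: Lspace_def)
  have N: "0 \<le> Lnorm 2 \<Omega> (weak_grad \<Omega> u)" by (simp add: Lnorm_def)
  have "Lnorm q \<Omega> u \<le> ((measure lebesgue \<Omega> + 32768) * (Lnorm 2 \<Omega> (weak_grad \<Omega> u))\<^sup>2 powr (q / 2)) powr (1 / q)"
    unfolding Lnorm_def[of q] using sobolev_H10(2)[OF assms] q
    by (intro powr_mono2) (auto simp: Lnorm_2_squared intro!: integral_nonneg_AE)
  also have "(Lnorm 2 \<Omega> (weak_grad \<Omega> u))\<^sup>2 powr (q / 2) = Lnorm 2 \<Omega> (weak_grad \<Omega> u) powr q"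
  proof -
    have "(Lnorm 2 \<Omega> (weak_grad \<Omega> u))\<^sup>2 = Lnorm 2 \<Omega> (weak_grad \<Omega> u) powr 2" using N by simp
    thus ?thesis by (simp only: powr_powr) simp
  qed
  also have "((measure lebesgue \<Omega> + 32768) * Lnorm 2 \<Omega> (weak_grad \<Omega> u) powr q) powr (1 / q)
      = (measure lebesgue \<Omega> + 32768) powr (1 / q) * Lnorm 2 \<Omega> (weak_grad \<Omega> u)"
    using q N by (simp add: powr_mult powr_powr)
  finally show "Lnorm q \<Omega> u \<le> (measure lebesgue \<Omega> + 32768) powr (1 / q) * Lnorm 2 \<Omega> (weak_grad \<Omega> u)" .
qed

text \<open>\<open>LEAST\<close> on the reals gives the intended constant only if the minimum is
  attained. The set of admissible constants is nonempty by the Sobolev inequality, bounded below by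
  0 because of \<open>w\<close>, and contains its infimum since all the conditions are
  non-strict.\<close>

lemma embedding_constant_H10:
  fixes \<Omega> :: "(real^3) set"
  assumes \<Omega>: "open \<Omega>" "bounded \<Omega>" and q: "0 < q" "q \<le> 6"
    and w: "w \<in> H10 \<Omega>" "0 < Lnorm 2 \<Omega> (weak_grad \<Omega> w)"
  shows "0 \<le> embedding_constant \<Omega> q"
    "\<And>v. v \<in> H10 \<Omega> \<Longrightarrow> Lnorm q \<Omega> v \<le> embedding_constant \<Omega> q * Lnorm 2 \<Omega> (weak_grad \<Omega> v)"
proof -
  let ?N = "\<lambda>v. Lnorm 2 \<Omega> (weak_grad \<Omega> v)"
  define S where "S = {M. \<forall>v\<in>H10 \<Omega>. v \<in> Lspace q \<Omega> \<and> Lnorm q \<Omega> v \<le> M * ?N v}"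
  have N: "0 \<le> ?N v" for v by (simp add: Lnorm_def)
  have S0: "0 \<le> M" if "M \<in> S" for M
  proof -
    have "0 \<le> Lnorm q \<Omega> w" by (simp add: Lnorm_def)
    also have "\<dots> \<le> M * ?N w" using that w(1) by (simp add: S_def)
    finally show ?thesis using w(2) by (simp add: zero_le_mult_iff)
  qed
  have ne: "(measure lebesgue \<Omega> + 32768) powr (1 / q) \<in> S"
    using sobolev_H10_Lnorm[OF _ \<Omega> q] by (auto simp: S_def)
  have bdd: "bdd_below S" using S0 by (rule bdd_belowI)
  have P: "\<forall>v\<in>H10 \<Omega>. v \<in> Lspace q \<Omega> \<and> Lnorm q \<Omega> v \<le> Inf S * ?N v"
  proof (intro ballI conjI)
    fix v assume v: "v \<in> H10 \<Omega>"
    show "v \<in> Lspace q \<Omega>" by (rule sobolev_H10_Lnorm(1)[OF v \<Omega> q])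
    show "Lnorm q \<Omega> v \<le> Inf S * ?N v"
    \<comment> \<open>For a zero gradient the bound does not depend on the constant, so any
      admissible one supplies it; otherwise the quotient of the norms is a lower bound for the
      admissible constants.\<close>
    proof (cases "?N v = 0")
      case True
      thus ?thesis using ne v by (auto simp: S_def)
    next
      case False
      hence Nv: "0 < ?N v" using N[of v] by simp
      have "Lnorm q \<Omega> v / ?N v \<le> Inf S"
        using ne v Nv by (intro cInf_greatest) (auto simp: S_def divide_le_eq)
      thus ?thesis using Nv by (simp add: divide_le_eq)
    qed
  qed
  have "embedding_constant \<Omega> q = Inf S"
    unfolding embedding_constant_def
  proof (rule Least_equality)
    show "\<forall>v\<in>H10 \<Omega>. v \<in> Lspace q \<Omega> \<and> Lnorm q \<Omega> v \<le> Inf S * ?N v" by (rule P)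
    fix y assume "\<forall>v\<in>H10 \<Omega>. v \<in> Lspace q \<Omega> \<and> Lnorm q \<Omega> v \<le> y * ?N v"
    hence "y \<in> S" by (simp only: S_def mem_Collect_eq)
    thus "Inf S \<le> y" using bdd by (rule cInf_lower)
  qed
  hence E: "embedding_constant \<Omega> q \<in> S" using P by (simp only: S_def mem_Collect_eq)
  show "0 \<le> embedding_constant \<Omega> q" by (rule S0[OF E])
  show "Lnorm q \<Omega> v \<le> embedding_constant \<Omega> q * ?N v" if "v \<in> H10 \<Omega>" for v
    using E that by (simp add: S_def)
qed

subsection \<open>The bilinear form\<close>

text \<open>The hypothesis is what Young's inequality with weight \<open>\<delta>\<close> makes of
  the cross term of a quadratic quantity: a fixed part times \<open>\<delta>\<close> and a vanishing
  part times a constant depending on \<open>\<delta>\<close>. The weight is fixed before the limit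
  is taken.\<close>

lemma tendsto_if_quadratic_bound:
  fixes N D :: "'a \<Rightarrow> real"
  assumes D: "(D \<longlongrightarrow> 0) F" and C: "0 \<le> C" and K: "0 \<le> K"
    and bound: "\<And>\<delta>. 0 < \<delta> \<Longrightarrow> \<forall>\<^sub>F s in F. \<bar>N s - L\<bar> \<le> C * (\<delta> * K + (1 + 1 / \<delta>) * D s)"
  shows "(N \<longlongrightarrow> L) F"
proof (rule tendstoI)
  fix e :: real assume e: "0 < e"
  \<comment> \<open>The added 1 keeps the denominator positive when
    \<open>C * K = 0\<close>.\<close>
  define \<delta> where "\<delta> = e / (2 * (C * K + 1))"
  have CK: "0 \<le> C * K" using C K by simp
  hence \<delta>: "0 < \<delta>" using e by (simp add: \<delta>_def)
  have "C * (\<delta> * K) = e / 2 * (C * K / (C * K + 1))" by (simp add: \<delta>_def)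
  also have "\<dots> \<le> e / 2 * 1" using e CK by (intro mult_left_mono) auto
  finally have 1: "C * (\<delta> * K) \<le> e / 2" by simp
  have "((\<lambda>s. C * ((1 + 1 / \<delta>) * D s)) \<longlongrightarrow> C * ((1 + 1 / \<delta>) * 0)) F"
    by (intro tendsto_intros D)
  hence "\<forall>\<^sub>F s in F. C * ((1 + 1 / \<delta>) * D s) < e / 2"
    using e by (intro order_tendstoD) auto
  with bound[OF \<delta>] show "\<forall>\<^sub>F s in F. dist (N s) L < e"
  proof eventually_elim
    case (elim s)
    thus ?case using 1 unfolding dist_real_def by (simp only: distrib_left)
  qed
qed

lemma matrix_field_bound:
  fixes A :: "real^'n \<Rightarrow> real^'n^'n"
  assumes A: "\<And>i j. continuous_on (closure \<Omega>) (\<lambda>x. A x $ i $ j)" and "bounded \<Omega>"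
  obtains B where "0 < B" "\<And>x p. x \<in> \<Omega> \<Longrightarrow> norm (A x *v p) \<le> B * norm p"
proof -
  have cA: "continuous_on (closure \<Omega>) A"
  proof -
    have "continuous_on (closure \<Omega>) (\<lambda>x. \<chi> i. \<chi> j. A x $ i $ j)"
      by (intro continuous_on_vec_lambda A)
    thus ?thesis by simp
  qed
  have "bounded (A ` closure \<Omega>)"
    using assms(2) by (intro compact_imp_bounded compact_continuous_image cA) (simp add: compact_closure)
  then obtain b where b: "\<And>x. x \<in> closure \<Omega> \<Longrightarrow> norm (A x) \<le> b" by (auto simp: bounded_iff)
  show ?thesis
  proof (rule that[of "real CARD('n) * \<bar>b\<bar> + 1"])
    show "0 < real CARD('n) * \<bar>b\<bar> + 1" by (simp add: add_nonneg_pos)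
    fix x p assume "x \<in> \<Omega>"
    hence nb: "norm (A x) \<le> \<bar>b\<bar>" using b[of x] closure_subset by fastforce
    have "norm (A x *v p) \<le> (\<Sum>i\<in>UNIV. \<bar>(A x *v p) $ i\<bar>)" by (rule norm_le_l1_cart)
    also have "\<dots> \<le> (\<Sum>i\<in>(UNIV :: 'n set). \<bar>b\<bar> * norm p)"
    proof (rule sum_mono)
      fix i
      have "\<bar>(A x *v p) $ i\<bar> \<le> norm (A x $ i) * norm p"
        unfolding matrix_vector_mul_component by (rule Cauchy_Schwarz_ineq2)
      also have "\<dots> \<le> \<bar>b\<bar> * norm p"
        using order_trans[OF Finite_Cartesian_Product.norm_nth_le nb] by (intro mult_right_mono) auto
      finally show "\<bar>(A x *v p) $ i\<bar> \<le> \<bar>b\<bar> * norm p" .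
    qed
    also have "\<dots> \<le> (real CARD('n) * \<bar>b\<bar> + 1) * norm p" by (simp add: algebra_simps)
    finally show "norm (A x *v p) \<le> (real CARD('n) * \<bar>b\<bar> + 1) * norm p" .
  qed
qed

lemma matrix_field_measurable:
  fixes A :: "real^'n \<Rightarrow> real^'n^'n"
  assumes A: "\<And>i j. continuous_on (closure \<Omega>) (\<lambda>x. A x $ i $ j)" and \<Omega>: "open \<Omega>"
    and p: "p \<in> borel_measurable (lebesgue_on \<Omega>)"
  shows "(\<lambda>x. A x *v p x) \<in> borel_measurable (lebesgue_on \<Omega>)"
proof -
  have "continuous_on \<Omega> (\<lambda>x. \<chi> i. \<chi> j. A x $ i $ j)"
    by (intro continuous_on_vec_lambda continuous_on_subset[OF A closure_subset])
  hence "continuous_on \<Omega> A" by simp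
  hence Am: "A \<in> borel_measurable (lebesgue_on \<Omega>)"
    by (rule continuous_imp_measurable_on_sets_lebesgue) (use \<Omega> in auto)
  have "continuous_on UNIV (\<lambda>q. fst q *v snd q :: real^'n)"
    unfolding matrix_vector_mult_def by (intro continuous_on_vec_lambda continuous_intros)
  thus ?thesis by (rule borel_measurable_continuous_Pair[OF Am p])
qed

context
  fixes \<Omega> :: "(real^'n) set" and A :: "real^'n \<Rightarrow> real^'n^'n" and B :: real
  assumes A: "\<And>i j. continuous_on (closure \<Omega>) (\<lambda>x. A x $ i $ j)" and \<Omega>: "open \<Omega>"
    and B: "0 < B" "\<And>x p. x \<in> \<Omega> \<Longrightarrow> norm (A x *v p) \<le> B * norm p"
begin

lemma form_bound: "x \<in> \<Omega> \<Longrightarrow> \<bar>(A x *v p) \<bullet> q\<bar> \<le> B * (norm p * norm q)"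
proof -
  assume x: "x \<in> \<Omega>"
  have "\<bar>(A x *v p) \<bullet> q\<bar> \<le> norm (A x *v p) * norm q" by (rule Cauchy_Schwarz_ineq2)
  also have "\<dots> \<le> (B * norm p) * norm q" by (intro mult_right_mono B x) auto
  finally show ?thesis by (simp add: mult.assoc)
qed

lemma form_integrable:
  assumes p: "p \<in> Lspace 2 \<Omega>"
  shows "integrable (lebesgue_on \<Omega>) (\<lambda>x. (A x *v p x) \<bullet> p x)"
proof (rule Bochner_Integration.integrable_bound)
  have [measurable]: "p \<in> borel_measurable (lebesgue_on \<Omega>)" using p by (simp add: Lspace_2_iff)
  have [measurable]: "(\<lambda>x. A x *v p x) \<in> borel_measurable (lebesgue_on \<Omega>)"
    by (rule matrix_field_measurable[OF A \<Omega>]) measurable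
  show "(\<lambda>x. (A x *v p x) \<bullet> p x) \<in> borel_measurable (lebesgue_on \<Omega>)" by measurable
  show "integrable (lebesgue_on \<Omega>) (\<lambda>x. B * (norm (p x))\<^sup>2)"
    using p by (simp add: Lspace_2_iff)
  show "AE x in lebesgue_on \<Omega>. norm ((A x *v p x) \<bullet> p x) \<le> norm (B * (norm (p x))\<^sup>2)"
    using form_bound B(1) by (intro AE_I2) (simp add: power2_eq_square)
qed

lemma form_a_lower:
  assumes u: "u \<in> H1 \<Omega>" and ell: "\<And>x \<xi>. x \<in> \<Omega> \<Longrightarrow> \<omega> * (norm \<xi>)\<^sup>2 \<le> (A x *v \<xi>) \<bullet> \<xi>"
  shows "\<omega> * (\<integral>x. (norm (weak_grad \<Omega> u x))\<^sup>2 \<partial>lebesgue_on \<Omega>) \<le> form_a \<Omega> A u u"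
proof -
  note p = H1_weak_grad(3)[OF u \<Omega>]
  have "(\<integral>x. \<omega> * (norm (weak_grad \<Omega> u x))\<^sup>2 \<partial>lebesgue_on \<Omega>) \<le> form_a \<Omega> A u u"
    unfolding form_a_def
  proof (rule integral_mono[OF _ form_integrable[OF p]])
    show "integrable (lebesgue_on \<Omega>) (\<lambda>x. \<omega> * (norm (weak_grad \<Omega> u x))\<^sup>2)"
      using p by (simp add: Lspace_2_iff)
  qed (use ell in auto)
  thus ?thesis by simp
qed

text \<open>With \<open>p x = q x + d\<close> the part quadratic in \<open>q x\<close> cancels;
  Young's inequality with weight \<open>\<delta>\<close> splits the two cross terms into the form
  that \<open>tendsto_if_quadratic_bound\<close> expects.\<close>

lemma form_a_diff_le:
  assumes u: "u \<in> H1 \<Omega>" and v: "v \<in> H1 \<Omega>" and \<delta>: "0 < \<delta>"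
  shows "\<bar>form_a \<Omega> A u u - form_a \<Omega> A v v\<bar>
    \<le> B * (\<delta> * (\<integral>x. (norm (weak_grad \<Omega> v x))\<^sup>2 \<partial>lebesgue_on \<Omega>) +
           (1 + 1 / \<delta>) * (\<integral>x. (norm (weak_grad \<Omega> u x - weak_grad \<Omega> v x))\<^sup>2 \<partial>lebesgue_on \<Omega>))"
proof -
  define p q where "p = weak_grad \<Omega> u" and "q = weak_grad \<Omega> v"
  have L: "p \<in> Lspace 2 \<Omega>" "q \<in> Lspace 2 \<Omega>" unfolding p_def q_def
    using H1_weak_grad(3) u v \<Omega> by auto
  have pt: "\<bar>(A x *v p x) \<bullet> p x - (A x *v q x) \<bullet> q x\<bar>
      \<le> B * (\<delta> * (norm (q x))\<^sup>2 + (1 + 1 / \<delta>) * (norm (p x - q x))\<^sup>2)" if x: "x \<in> \<Omega>" for x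
  proof -
    define d where "d = p x - q x"
    define a b where "a = norm d" and "b = norm (q x)"
    have px: "p x = q x + d" by (simp add: d_def)
    have "(A x *v p x) \<bullet> p x - (A x *v q x) \<bullet> q x
        = (A x *v d) \<bullet> d + (A x *v q x) \<bullet> d + (A x *v d) \<bullet> q x"
      unfolding px by (simp add: matrix_vector_right_distrib inner_add_left inner_add_right)
    also have "\<bar>\<dots>\<bar> \<le> B * (a * a) + B * (b * a) + B * (a * b)"
      unfolding a_def b_def by (intro abs_triangle_ineq[THEN order_trans] add_mono form_bound x)
    also have "\<dots> = B * (a * a + 2 * (a * b))" by (simp add: algebra_simps)
    also have "\<dots> \<le> B * (a * a + (\<delta> * b\<^sup>2 + a\<^sup>2 / \<delta>))"
    proof -
      have "0 \<le> (\<delta> * b - a)\<^sup>2 / \<delta>" using \<delta> by simp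
      also have "\<dots> = \<delta> * b\<^sup>2 + a\<^sup>2 / \<delta> - 2 * (a * b)"
        using \<delta> by (simp add: power2_eq_square field_simps)
      finally show ?thesis using B(1) by (intro mult_left_mono) auto
    qed
    also have "a * a + (\<delta> * b\<^sup>2 + a\<^sup>2 / \<delta>) = \<delta> * b\<^sup>2 + (1 + 1 / \<delta>) * a\<^sup>2"
      by (simp add: power2_eq_square algebra_simps)
    finally show ?thesis by (simp add: a_def b_def d_def)
  qed
  have i: "integrable (lebesgue_on \<Omega>) (\<lambda>x. (A x *v p x) \<bullet> p x - (A x *v q x) \<bullet> q x)"
    using form_integrable L by simp
  have j: "integrable (lebesgue_on \<Omega>) (\<lambda>x. (norm (q x))\<^sup>2)" "integrable (lebesgue_on \<Omega>) (\<lambda>x. (norm (p x - q x))\<^sup>2)"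
    using L Lspace_2_diff[OF L] by (auto simp: Lspace_2_iff)
  have "form_a \<Omega> A u u - form_a \<Omega> A v v = (\<integral>x. (A x *v p x) \<bullet> p x - (A x *v q x) \<bullet> q x \<partial>lebesgue_on \<Omega>)"
    unfolding form_a_def p_def[symmetric] q_def[symmetric] using form_integrable L by simp
  also have "\<bar>\<dots>\<bar> \<le> (\<integral>x. \<bar>(A x *v p x) \<bullet> p x - (A x *v q x) \<bullet> q x\<bar> \<partial>lebesgue_on \<Omega>)"
    by (rule integral_abs_bound)
  also have "\<dots> \<le> (\<integral>x. B * (\<delta> * (norm (q x))\<^sup>2 + (1 + 1 / \<delta>) * (norm (p x - q x))\<^sup>2) \<partial>lebesgue_on \<Omega>)"
    using pt by (intro integral_mono integrable_abs i integrable_mult_right Bochner_Integration.integrable_add j) auto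
  also have "\<dots> = B * (\<delta> * (\<integral>x. (norm (q x))\<^sup>2 \<partial>lebesgue_on \<Omega>) + (1 + 1 / \<delta>) * (\<integral>x. (norm (p x - q x))\<^sup>2 \<partial>lebesgue_on \<Omega>))"
    using j by simp
  finally show ?thesis by (simp add: p_def q_def)
qed

lemma form_a_continuous:
  assumes u: "cont_curve T (H10 \<Omega>) (H1_norm \<Omega>) u"
  shows "continuous_on {0..T} (\<lambda>t. form_a \<Omega> A (u t) (u t))"
  unfolding continuous_on_def
proof
  fix t assume t: "t \<in> {0..T}"
  have H: "u s \<in> H1 \<Omega>" if "s \<in> {0..T}" for s using u that by (auto simp: cont_curve_def H10_def)
  let ?D = "\<lambda>s. (H1_norm \<Omega> (\<lambda>x. u s x - u t x))\<^sup>2"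
  have "((\<lambda>s. H1_norm \<Omega> (\<lambda>x. u s x - u t x)) \<longlongrightarrow> 0) (at t within {0..T})"
    using u t by (simp add: cont_curve_def)
  from tendsto_power[OF this, of 2] have D: "(?D \<longlongrightarrow> 0) (at t within {0..T})" by simp
  show "((\<lambda>t. form_a \<Omega> A (u t) (u t)) \<longlongrightarrow> form_a \<Omega> A (u t) (u t)) (at t within {0..T})"
  proof (rule tendsto_if_quadratic_bound[OF D less_imp_le[OF B(1)]])
    show "0 \<le> (\<integral>x. (norm (weak_grad \<Omega> (u t) x))\<^sup>2 \<partial>lebesgue_on \<Omega>)" by (intro integral_nonneg_AE) auto
    fix \<delta> :: real assume \<delta>: "0 < \<delta>"
    have "\<bar>form_a \<Omega> A (u s) (u s) - form_a \<Omega> A (u t) (u t)\<bar>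
        \<le> B * (\<delta> * (\<integral>x. (norm (weak_grad \<Omega> (u t) x))\<^sup>2 \<partial>lebesgue_on \<Omega>) + (1 + 1 / \<delta>) * ?D s)"
      if s: "s \<in> {0..T}" for s
    proof -
      have "0 \<le> (\<integral>x. (u s x - u t x)\<^sup>2 \<partial>lebesgue_on \<Omega>)" by (intro integral_nonneg_AE) auto
      hence "(\<integral>x. (norm (weak_grad \<Omega> (u s) x - weak_grad \<Omega> (u t) x))\<^sup>2 \<partial>lebesgue_on \<Omega>) \<le> ?D s"
        using H1_norm_diff_squared[OF H[OF s] H[OF t] \<Omega>] by simp
      hence "B * (\<delta> * (\<integral>x. (norm (weak_grad \<Omega> (u t) x))\<^sup>2 \<partial>lebesgue_on \<Omega>) + (1 + 1 / \<delta>) *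
          (\<integral>x. (norm (weak_grad \<Omega> (u s) x - weak_grad \<Omega> (u t) x))\<^sup>2 \<partial>lebesgue_on \<Omega>))
        \<le> B * (\<delta> * (\<integral>x. (norm (weak_grad \<Omega> (u t) x))\<^sup>2 \<partial>lebesgue_on \<Omega>) + (1 + 1 / \<delta>) * ?D s)"
        using B(1) \<delta> by (intro mult_left_mono add_left_mono) auto
      thus ?thesis using form_a_diff_le[OF H[OF s] H[OF t] \<delta>] by linarith
    qed
    thus "\<forall>\<^sub>F s in at t within {0..T}. \<bar>form_a \<Omega> A (u s) (u s) - form_a \<Omega> A (u t) (u t)\<bar>
        \<le> B * (\<delta> * (\<integral>x. (norm (weak_grad \<Omega> (u t) x))\<^sup>2 \<partial>lebesgue_on \<Omega>) + (1 + 1 / \<delta>) * ?D s)"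
      by (auto simp: eventually_at_filter)
  qed
qed

end

lemma Lnorm_2_squared_continuous:
  fixes v :: "real \<Rightarrow> 'a::euclidean_space \<Rightarrow> real"
  assumes v: "cont_curve T (Lspace 2 \<Omega>) (Lnorm 2 \<Omega>) v"
  shows "continuous_on {0..T} (\<lambda>t. (Lnorm 2 \<Omega> (v t))\<^sup>2)"
  unfolding continuous_on_def
proof
  fix t assume t: "t \<in> {0..T}"
  have H: "v s \<in> Lspace 2 \<Omega>" if "s \<in> {0..T}" for s using v that by (auto simp: cont_curve_def)
  let ?D = "\<lambda>s. (Lnorm 2 \<Omega> (\<lambda>x. v s x - v t x))\<^sup>2"
  have "((\<lambda>s. Lnorm 2 \<Omega> (\<lambda>x. v s x - v t x)) \<longlongrightarrow> 0) (at t within {0..T})"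
    using v t by (simp add: cont_curve_def)
  from tendsto_power[OF this, of 2] have D: "(?D \<longlongrightarrow> 0) (at t within {0..T})" by simp
  show "((\<lambda>t. (Lnorm 2 \<Omega> (v t))\<^sup>2) \<longlongrightarrow> (Lnorm 2 \<Omega> (v t))\<^sup>2) (at t within {0..T})"
  proof (rule tendsto_if_quadratic_bound[OF D, of 1 "(Lnorm 2 \<Omega> (v t))\<^sup>2"])
    fix \<delta> :: real assume \<delta>: "0 < \<delta>"
    have "\<bar>(Lnorm 2 \<Omega> (v s))\<^sup>2 - (Lnorm 2 \<Omega> (v t))\<^sup>2\<bar> \<le> 1 * (\<delta> * (Lnorm 2 \<Omega> (v t))\<^sup>2 + (1 + 1 / \<delta>) * ?D s)"
      if s: "s \<in> {0..T}" for s
    proof -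
      have pt: "\<bar>a\<^sup>2 - b\<^sup>2\<bar> \<le> \<delta> * b\<^sup>2 + (1 + 1 / \<delta>) * (a - b)\<^sup>2" for a b :: real
      proof -
        have "0 \<le> (\<delta> * b - (a - b))\<^sup>2 / \<delta>" "0 \<le> (\<delta> * b + (a - b))\<^sup>2 / \<delta>" using \<delta> by auto
        hence "2 * (b * (a - b)) \<le> \<delta> * b\<^sup>2 + (a - b)\<^sup>2 / \<delta>" "- (2 * (b * (a - b))) \<le> \<delta> * b\<^sup>2 + (a - b)\<^sup>2 / \<delta>"
          using \<delta> by (simp_all add: power2_sum power2_diff power_mult_distrib add_divide_distrib diff_divide_distrib
            power2_eq_square[of \<delta>])
        moreover have "a\<^sup>2 - b\<^sup>2 = (a - b)\<^sup>2 + 2 * (b * (a - b))"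
          by (simp add: power2_eq_square algebra_simps)
        moreover have "(1 + 1 / \<delta>) * (a - b)\<^sup>2 = (a - b)\<^sup>2 + (a - b)\<^sup>2 / \<delta>" by (simp add: algebra_simps)
        moreover have "0 \<le> (a - b)\<^sup>2" by simp
        ultimately show ?thesis by linarith
      qed
      have i: "integrable (lebesgue_on \<Omega>) (\<lambda>x. (v s x)\<^sup>2)" "integrable (lebesgue_on \<Omega>) (\<lambda>x. (v t x)\<^sup>2)"
        "integrable (lebesgue_on \<Omega>) (\<lambda>x. (v s x - v t x)\<^sup>2)"
        using H[OF s] H[OF t] Lspace_2_diff[OF H[OF s] H[OF t]] by (auto simp: Lspace_2_iff)
      have "(Lnorm 2 \<Omega> (v s))\<^sup>2 - (Lnorm 2 \<Omega> (v t))\<^sup>2 = (\<integral>x. (v s x)\<^sup>2 - (v t x)\<^sup>2 \<partial>lebesgue_on \<Omega>)"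
        using i by (simp add: Lnorm_2_squared)
      also have "\<bar>\<dots>\<bar> \<le> (\<integral>x. \<bar>(v s x)\<^sup>2 - (v t x)\<^sup>2\<bar> \<partial>lebesgue_on \<Omega>)" by (rule integral_abs_bound)
      also have "\<dots> \<le> (\<integral>x. \<delta> * (v t x)\<^sup>2 + (1 + 1 / \<delta>) * (v s x - v t x)\<^sup>2 \<partial>lebesgue_on \<Omega>)"
        using i by (intro integral_mono pt integrable_abs) auto
      also have "\<dots> = \<delta> * (Lnorm 2 \<Omega> (v t))\<^sup>2 + (1 + 1 / \<delta>) * ?D s"
        using i by (simp add: Lnorm_2_squared)
      finally show ?thesis by simp
    qed
    thus "\<forall>\<^sub>F s in at t within {0..T}. \<bar>(Lnorm 2 \<Omega> (v s))\<^sup>2 - (Lnorm 2 \<Omega> (v t))\<^sup>2\<bar>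
        \<le> 1 * (\<delta> * (Lnorm 2 \<Omega> (v t))\<^sup>2 + (1 + 1 / \<delta>) * ?D s)"
      by (auto simp: eventually_at_filter)
  qed auto
qed

subsection \<open>Joint measurability of curves\<close>

text \<open>The Heine-Cantor argument along sequences, the values of the curve being functions
  compared by a seminorm. Two sequences of times that approach each other have subsequences with a
  common limit \<open>l\<close>, and both values come close to \<open>u l\<close>.\<close>

lemma Lspace_2_curve_uniformly_continuous:
  fixes u :: "real \<Rightarrow> 'a::euclidean_space \<Rightarrow> real"
  assumes u: "cont_curve T (Lspace 2 \<Omega>) (Lnorm 2 \<Omega>) u" and e: "0 < e"
  shows "\<exists>N::nat. \<forall>s\<in>{0..T}. \<forall>t\<in>{0..T}. \<bar>s - t\<bar> \<le> 1 / real (Suc N) \<longrightarrow>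
    (\<integral>x. (u s x - u t x)\<^sup>2 \<partial>lebesgue_on \<Omega>) < e"
proof (rule ccontr)
  define d where "d s t = (\<integral>x. (u s x - u t x)\<^sup>2 \<partial>lebesgue_on \<Omega>)" for s t
  assume "\<not> ?thesis"
  hence "\<forall>N. \<exists>s t. s \<in> {0..T} \<and> t \<in> {0..T} \<and> \<bar>s - t\<bar> \<le> 1 / real (Suc N) \<and> e \<le> d s t"
    by (fastforce simp: not_less d_def)
  then obtain s t where st: "\<And>n. s n \<in> {0..T}" "\<And>n. t n \<in> {0..T}"
    "\<And>n. \<bar>s n - t n\<bar> \<le> 1 / real (Suc n)" "\<And>n. e \<le> d (s n) (t n)" by metis
  have L: "u s \<in> Lspace 2 \<Omega>" if "s \<in> {0..T}" for s using u that by (auto simp: cont_curve_def)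
  obtain l r where l: "l \<in> {0..T}" and r: "strict_mono r" and sl: "(s \<circ> r) \<longlonglongrightarrow> l"
    using st(1) compact_Icc[of 0 T, unfolded compact_def] by (metis (no_types, lifting))
  have "(\<lambda>n. s (r n) - t (r n)) \<longlonglongrightarrow> 0"
  proof (rule tendsto_rabs_zero_cancel, rule tendsto_sandwich[OF _ _ tendsto_const])
    have "(\<lambda>n. 1 / real (Suc n)) \<longlonglongrightarrow> 0" by (rule LIMSEQ_Suc[OF lim_1_over_n])
    from LIMSEQ_subseq_LIMSEQ[OF this r] show "(\<lambda>n. 1 / real (Suc (r n))) \<longlonglongrightarrow> 0" by (simp add: o_def)
  qed (use st(3) in auto)
  from tendsto_diff[OF sl this] have tl: "(t \<circ> r) \<longlonglongrightarrow> l" by (simp add: o_def)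
  have "((\<lambda>s. Lnorm 2 \<Omega> (\<lambda>x. u s x - u l x)) \<longlongrightarrow> 0) (at l within {0..T})"
    using u l by (simp add: cont_curve_def)
  from tendsto_power[OF this, of 2] have "((\<lambda>s. d s l) \<longlongrightarrow> d l l) (at l within {0..T})"
    by (simp add: Lnorm_2_squared d_def)
  hence "continuous (at l within {0..T}) (\<lambda>s. d s l)" by (simp add: continuous_within)
  hence seq: "(\<lambda>n. d (x n) l) \<longlonglongrightarrow> 0" if "\<And>n. x n \<in> {0..T}" "x \<longlonglongrightarrow> l" for x :: "nat \<Rightarrow> real"
    using that unfolding continuous_within_sequentially by (force simp: o_def d_def)
  have "(\<lambda>n. 2 * d (t (r n)) l + 2 * d (s (r n)) l) \<longlonglongrightarrow> 2 * 0 + 2 * 0"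
    using sl tl st by (intro tendsto_intros seq) (auto simp: o_def)
  moreover have "e \<le> 2 * d (t (r n)) l + 2 * d (s (r n)) l" for n
  proof -
    have "e \<le> d (s (r n)) (t (r n))" by (rule st)
    also have "\<dots> \<le> 2 * d (s (r n)) l + 2 * (\<integral>x. (norm ((u (s (r n)) x - u (t (r n)) x) - (u (s (r n)) x - u l x)))\<^sup>2 \<partial>lebesgue_on \<Omega>)"
      unfolding d_def
      using Lspace_2_integral_le[OF Lspace_2_diff[OF L[OF st(1)[of "r n"]] L[OF st(2)[of "r n"]]] Lspace_2_diff[OF L[OF st(1)[of "r n"]] L[OF l]]]
      by simp
    also have "(\<integral>x. (norm ((u (s (r n)) x - u (t (r n)) x) - (u (s (r n)) x - u l x)))\<^sup>2 \<partial>lebesgue_on \<Omega>) = d (t (r n)) l"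
      unfolding d_def by (intro Bochner_Integration.integral_cong) (auto simp: power2_commute)
    finally show ?thesis by simp
  qed
  ultimately have "e \<le> 2 * 0 + 2 * 0" by (intro LIMSEQ_le_const) auto
  thus False using e by simp
qed

lemma borel_representative:
  fixes f :: "'a::euclidean_space \<Rightarrow> real"
  assumes f: "f \<in> borel_measurable (lebesgue_on S)" and S: "S \<in> sets lebesgue"
  shows "\<exists>g\<in>borel_measurable borel. AE x in lebesgue_on S. f x = g x"
proof -
  obtain g where g: "g \<in> borel_measurable lborel" "AE x in lborel. (if x \<in> S then f x else 0) = g x"
    using completion_ex_borel_measurable_real[OF borel_measurable_if_I[OF f S]] by blast
  have "AE x in lebesgue_on S. f x = g x"
    unfolding AE_lebesgue_on_iff[OF S] using AE_completion[OF g(2)] by eventually_elim auto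
  thus ?thesis using g(1) by auto
qed

text \<open>
  The values of a curve in \<open>L\<^sup>2\<close> are determined only almost everywhere, separately for each time.
  Evaluating Borel representatives on ever finer grids of times, with an \<open>L\<^sup>2\<close> error that is
  summable uniformly in time, gives a jointly measurable limit that is right at every time.
\<close>

lemma joint_representative:
  fixes u :: "real \<Rightarrow> 'a::euclidean_space \<Rightarrow> real"
  assumes u: "cont_curve T (Lspace 2 \<Omega>) (Lnorm 2 \<Omega>) u" and \<Omega>: "open \<Omega>"
  shows "\<exists>w\<in>borel_measurable (borel :: (real \<times> 'a) measure). \<forall>t\<in>{0..T}. AE x in lebesgue_on \<Omega>. w (t, x) = u t x"
proof -
  have S: "\<Omega> \<in> sets lebesgue" using \<Omega> by (rule sets_lebesgue_open)
  have L: "u t \<in> Lspace 2 \<Omega>" if "t \<in> {0..T}" for t using u that by (auto simp: cont_curve_def)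
  have "\<forall>k. \<exists>N::nat. \<forall>s\<in>{0..T}. \<forall>t\<in>{0..T}. \<bar>s - t\<bar> \<le> 1 / real (Suc N) \<longrightarrow>
      (\<integral>x. (u s x - u t x)\<^sup>2 \<partial>lebesgue_on \<Omega>) < (1 / 2) ^ k"
    by (intro allI Lspace_2_curve_uniformly_continuous[OF u]) simp
  \<comment> \<open>\<open>N k\<close> fixes the mesh of the grid number \<open>k\<close>: times
    within one mesh width differ in squared norm by less than \<open>(1 / 2) ^ k\<close>, a summable
    bound independent of the time.\<close>
  then obtain N where N: "\<And>k s t. s \<in> {0..T} \<Longrightarrow> t \<in> {0..T} \<Longrightarrow> \<bar>s - t\<bar> \<le> 1 / real (Suc (N k)) \<Longrightarrow>
      (\<integral>x. (u s x - u t x)\<^sup>2 \<partial>lebesgue_on \<Omega>) < (1 / 2) ^ k" by metis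
  have "\<forall>t. \<exists>g. g \<in> borel_measurable borel \<and> (t \<in> {0..T} \<longrightarrow> (AE x in lebesgue_on \<Omega>. u t x = g x))"
  proof
    fix t show "\<exists>g. g \<in> borel_measurable borel \<and> (t \<in> {0..T} \<longrightarrow> (AE x in lebesgue_on \<Omega>. u t x = g x))"
    proof (cases "t \<in> {0..T}")
      case True
      thus ?thesis using borel_representative[OF _ S, of "u t"] L[OF True] by (auto simp: Lspace_2_iff)
    next
      case False thus ?thesis by (intro exI[of _ "\<lambda>_. 0"]) auto
    qed
  qed
  then obtain c where c [measurable]: "\<And>t. c t \<in> borel_measurable borel"
    and c_eq: "\<And>t. t \<in> {0..T} \<Longrightarrow> AE x in lebesgue_on \<Omega>. u t x = c t x" by metis
  \<comment> \<open>Rounding down keeps the grid time in \<open>[0, T]\<close>, at a distance of at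
    most one mesh width from \<open>t\<close>.\<close>
  define G where "G k t = of_int \<lfloor>t * real (Suc (N k))\<rfloor> / real (Suc (N k))" for k t
  define W where "W k p = c (G k (fst p)) (snd p)" for k and p :: "real \<times> 'a"
  have W_meas: "W k \<in> borel_measurable borel" for k
  proof -
    have "(snd :: real \<times> 'a \<Rightarrow> 'a) \<in> borel_measurable borel"
      by (intro borel_measurable_continuous_onI continuous_intros)
    hence A: "(\<lambda>p. c (of_int j / real (Suc (N k))) (snd p)) \<in> borel_measurable (borel :: (real \<times> 'a) measure)" for j :: int
      by (rule measurable_compose[OF _ c])
    have "(\<lambda>p. fst p * real (Suc (N k))) \<in> borel_measurable (borel :: (real \<times> 'a) measure)"
      by (intro borel_measurable_continuous_onI continuous_intros)
    hence B: "(\<lambda>p. \<lfloor>fst p * real (Suc (N k))\<rfloor>) \<in> measurable (borel :: (real \<times> 'a) measure) (count_space UNIV)"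
      by (rule measurable_compose) measurable
    \<comment> \<open>Only countably many grid times occur, so measurability can be checked slab by
      slab.\<close>
    from measurable_compose_countable[OF A B] show ?thesis by (simp add: W_def[abs_def] G_def)
  qed
  have G: "G k t \<in> {0..T}" "\<bar>G k t - t\<bar> \<le> 1 / real (Suc (N k))" if t: "t \<in> {0..T}" for k t
  proof -
    define n where "n = real (Suc (N k))"
    have n: "0 < n" by (simp add: n_def)
    have "of_int \<lfloor>t * n\<rfloor> \<le> t * n" "t * n < of_int \<lfloor>t * n\<rfloor> + 1" by linarith+
    hence g: "of_int \<lfloor>t * n\<rfloor> / n \<le> t" "t \<le> of_int \<lfloor>t * n\<rfloor> / n + 1 / n"
      using n by (simp_all add: field_simps)
    have "0 \<le> of_int \<lfloor>t * n\<rfloor> / n" using t n by simp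
    thus "G k t \<in> {0..T}" "\<bar>G k t - t\<bar> \<le> 1 / real (Suc (N k))"
      using g t unfolding G_def n_def[symmetric] by auto
  qed
  define w where "w p = lim (\<lambda>k. W k p)" for p
  have "w \<in> borel_measurable borel" unfolding w_def[abs_def] using W_meas by measurable
  moreover have "AE x in lebesgue_on \<Omega>. w (t, x) = u t x" if t: "t \<in> {0..T}" for t
  proof -
    let ?f = "\<lambda>k x. ennreal ((u (G k t) x - u t x)\<^sup>2)"
    have i: "integrable (lebesgue_on \<Omega>) (\<lambda>x. (u (G k t) x - u t x)\<^sup>2)" for k
      using Lspace_2_diff[OF L[OF G(1)[OF t]] L[OF t]] by (simp add: Lspace_2_iff)
    have m: "?f k \<in> borel_measurable (lebesgue_on \<Omega>)" for k
      using borel_measurable_integrable[OF i] by measurable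
    have "(\<integral>\<^sup>+x. ?f k x \<partial>lebesgue_on \<Omega>) \<le> ennreal ((1 / 2) ^ k)" for k
    proof -
      have "(\<integral>\<^sup>+x. ?f k x \<partial>lebesgue_on \<Omega>) = ennreal (\<integral>x. (u (G k t) x - u t x)\<^sup>2 \<partial>lebesgue_on \<Omega>)"
        using i by (rule nn_integral_eq_integral) auto
      also have "\<dots> \<le> ennreal ((1 / 2) ^ k)"
        using N[OF G(1)[OF t] t G(2)[OF t]] by (intro ennreal_leI) (rule less_imp_le)
      finally show ?thesis .
    qed
    hence "(\<integral>\<^sup>+x. (\<Sum>k. ?f k x) \<partial>lebesgue_on \<Omega>) \<le> (\<Sum>k. ennreal ((1 / 2) ^ k))"
      by (subst nn_integral_suminf[OF m]) (auto intro: suminf_le)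
    also have "\<dots> = ennreal (\<Sum>k. (1 / 2) ^ k)" by (intro suminf_ennreal2) auto
    \<comment> \<open>A finite integral of the sum makes the squared errors summable, hence null
      sequences, at almost every \<open>x\<close>; the exceptional null set depends on
      \<open>t\<close>.\<close>
    finally have "(\<integral>\<^sup>+x. (\<Sum>k. ?f k x) \<partial>lebesgue_on \<Omega>) \<noteq> \<infinity>" by (auto simp: top_unique)
    hence "AE x in lebesgue_on \<Omega>. (\<Sum>k. ?f k x) \<noteq> \<infinity>"
      by (intro nn_integral_noteq_infinite) (use m in \<open>auto intro: borel_measurable_suminf\<close>)
    moreover have "AE x in lebesgue_on \<Omega>. \<forall>k. u (G k t) x = c (G k t) x"
      using c_eq[OF G(1)[OF t]] by (subst AE_all_countable) blast
    ultimately show ?thesis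
    proof eventually_elim
      case (elim x)
      have "summable (\<lambda>k. (u (G k t) x - u t x)\<^sup>2)"
        using elim(1) by (intro summable_suminf_not_top) auto
      hence "(\<lambda>k. (u (G k t) x - u t x)\<^sup>2) \<longlonglongrightarrow> 0" by (rule summable_LIMSEQ_zero)
      from tendsto_real_sqrt[OF this] have "(\<lambda>k. \<bar>u (G k t) x - u t x\<bar>) \<longlonglongrightarrow> 0" by simp
      hence "(\<lambda>k. u (G k t) x) \<longlonglongrightarrow> u t x" by (simp add: tendsto_rabs_zero_iff LIM_zero_iff)
      hence "(\<lambda>k. W k (t, x)) \<longlonglongrightarrow> u t x" using elim(2) by (simp add: W_def)
      thus ?case unfolding w_def by (rule limI)
    qed
  qed
  ultimately show ?thesis by blast
qed

text \<open>Slices are taken for \<open>lborel\<close>, where the product measure is available, and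
  completed afterwards. Passing from the open to the closed time interval adds only the endpoints, a
  null set.\<close>

lemma AE_lebesgue_on_Times:
  fixes Q :: "real \<times> 'a::euclidean_space \<Rightarrow> bool"
  assumes Q: "AE p in lebesgue_on ({0<..<T} \<times> \<Omega>). Q p" and \<Omega>: "open \<Omega>"
  shows "AE s in lebesgue_on {0..T}. AE x in lebesgue_on \<Omega>. Q (s, x)"
proof -
  have S: "{0<..<T} \<times> \<Omega> \<in> sets lebesgue" by (intro sets_lebesgue_open open_Times \<Omega>) auto
  have "AE p in lborel. p \<in> {0<..<T} \<times> \<Omega> \<longrightarrow> Q p"
    using Q unfolding AE_lebesgue_on_iff[OF S] AE_completion_iff .
  hence "AE p in lborel \<Otimes>\<^sub>M lborel. p \<in> {0<..<T} \<times> \<Omega> \<longrightarrow> Q p" by (simp only: lborel_prod)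
  hence "AE s in lborel. AE x in lborel. (s, x) \<in> {0<..<T} \<times> \<Omega> \<longrightarrow> Q (s, x)"
    by (rule lborel_pair.AE_pair)
  hence "AE s in lebesgue. AE x in lborel. (s, x) \<in> {0<..<T} \<times> \<Omega> \<longrightarrow> Q (s, x)" by (rule AE_completion)
  moreover have "AE s in lebesgue. s \<notin> {0, T}"
    by (intro AE_not_in) (simp add: negligible_iff_null_sets[symmetric])
  ultimately have "AE s in lebesgue. s \<in> {0..T} \<longrightarrow> (AE x in lebesgue_on \<Omega>. Q (s, x))"
  proof eventually_elim
    case (elim s)
    show ?case
    proof
      assume "s \<in> {0..T}"
      hence s: "s \<in> {0<..<T}" using elim(2) by auto
      have "AE x in lebesgue. (s, x) \<in> {0<..<T} \<times> \<Omega> \<longrightarrow> Q (s, x)" using elim(1) by (rule AE_completion)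
      thus "AE x in lebesgue_on \<Omega>. Q (s, x)"
        unfolding AE_lebesgue_on_iff[OF sets_lebesgue_open[OF \<Omega>]] by eventually_elim (use s in auto)
    qed
  qed
  thus ?thesis by (subst AE_lebesgue_on_iff) auto
qed

text \<open>Fubini's theorem is applied to a Borel representative cut off to the cylinder. Almost
  every slice of \<open>f\<close> agrees with it almost everywhere, which transfers integrability
  and the slice integrals.\<close>

lemma Fubini_lebesgue_on:
  fixes f :: "real \<times> 'a::euclidean_space \<Rightarrow> real"
  assumes f: "integrable (lebesgue_on ({0<..<T} \<times> \<Omega>)) f" and \<Omega>: "open \<Omega>"
  shows "AE s in lebesgue_on {0..T}. integrable (lebesgue_on \<Omega>) (\<lambda>x. f (s, x))"
    and "integrable (lebesgue_on {0..T}) (\<lambda>s. \<integral>x. f (s, x) \<partial>lebesgue_on \<Omega>)"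
proof -
  have So: "open ({0<..<T} \<times> \<Omega>)" by (intro open_Times \<Omega>) auto
  have S: "{0<..<T} \<times> \<Omega> \<in> sets lebesgue" by (rule sets_lebesgue_open[OF So])
  have \<Omega>S: "\<Omega> \<in> sets lebesgue" by (rule sets_lebesgue_open[OF \<Omega>])
  have I: "{0..T} \<in> sets lebesgue" by auto
  obtain g where g [measurable]: "g \<in> borel_measurable borel" and fg: "AE p in lebesgue_on ({0<..<T} \<times> \<Omega>). f p = g p"
    using borel_representative[OF borel_measurable_integrable[OF f] S] by blast
  define F where "F p = indicator ({0<..<T} \<times> \<Omega>) p * g p" for p
  have F_meas: "F \<in> borel_measurable borel"
    unfolding F_def[abs_def] using So by (intro borel_measurable_times borel_measurable_indicator g) auto
  have gm: "g \<in> borel_measurable (lebesgue_on ({0<..<T} \<times> \<Omega>))"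
    by (intro measurable_restrict_space1 measurable_completion) simp
  have "integrable (lebesgue_on ({0<..<T} \<times> \<Omega>)) g"
    using integrable_cong_AE[OF borel_measurable_integrable[OF f] gm fg] f by blast
  hence "integrable lebesgue F" using S by (subst (asm) integrable_restrict_space) (auto simp: F_def[abs_def])
  hence "integrable lborel F" using F_meas by (subst (asm) integrable_completion) auto
  hence Fi: "integrable (lborel \<Otimes>\<^sub>M lborel) F" by (simp add: lborel_prod)
  have 1: "AE s in lebesgue. integrable lborel (\<lambda>x. F (s, x))"
    by (rule AE_completion[OF lborel_pair.AE_integrable_fst'[OF Fi]])
  have "integrable lborel (\<lambda>s. \<integral>x. F (s, x) \<partial>lborel)" by (rule lborel_pair.integrable_fst'[OF Fi])
  hence "integrable lebesgue (\<lambda>s. \<integral>x. F (s, x) \<partial>lborel)"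
    by (subst integrable_completion) (rule borel_measurable_integrable)
  hence 2: "integrable (lebesgue_on {0..T}) (\<lambda>s. \<integral>x. F (s, x) \<partial>lborel)" by (rule integrable_lebesgue_on[OF _ I])
  have fgs: "AE s in lebesgue_on {0..T}. AE x in lebesgue_on \<Omega>. f (s, x) = g (s, x)"
    by (rule AE_lebesgue_on_Times[OF fg \<Omega>])
  have "AE s in lebesgue. s \<notin> {0, T}"
    by (intro AE_not_in) (simp add: negligible_iff_null_sets[symmetric])
  hence in_s: "AE s in lebesgue_on {0..T}. s \<in> {0<..<T}"
    unfolding AE_lebesgue_on_iff[OF I] by eventually_elim auto
  have int_s: "AE s in lebesgue_on {0..T}. integrable lborel (\<lambda>x. F (s, x))"
    unfolding AE_lebesgue_on_iff[OF I] using 1 by eventually_elim auto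
  have main: "AE s in lebesgue_on {0..T}. integrable (lebesgue_on \<Omega>) (\<lambda>x. f (s, x)) \<and>
      (\<integral>x. F (s, x) \<partial>lborel) = (\<integral>x. f (s, x) \<partial>lebesgue_on \<Omega>)"
    using int_s in_s fgs
  proof eventually_elim
    case (elim s)
    have Fs: "(\<lambda>x. F (s, x)) = (\<lambda>x. indicator \<Omega> x *\<^sub>R g (s, x))"
      using elim(2) by (auto simp: F_def fun_eq_iff indicator_def)
    have gm: "(\<lambda>x. g (s, x)) \<in> borel_measurable borel"
      by (rule measurable_compose[OF _ g]) (intro borel_measurable_continuous_onI continuous_intros)
    have m: "(\<lambda>x. F (s, x)) \<in> borel_measurable lborel" using elim(1) by (rule borel_measurable_integrable)
    have "integrable lebesgue (\<lambda>x. F (s, x))" using elim(1) m by (subst integrable_completion) auto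
    hence gi: "integrable (lebesgue_on \<Omega>) (\<lambda>x. g (s, x))"
      unfolding Fs using \<Omega>S by (subst integrable_restrict_space) auto
    have sym: "AE x in lebesgue_on \<Omega>. g (s, x) = f (s, x)" using elim(3) by eventually_elim simp
    have fm: "(\<lambda>x. f (s, x)) \<in> borel_measurable (lebesgue_on \<Omega>)"
      by (rule borel_measurable_lebesgue_AE_cong[OF borel_measurable_integrable[OF gi] sym \<Omega>S])
    have "integrable (lebesgue_on \<Omega>) (\<lambda>x. f (s, x))"
      using integrable_cong_AE[OF borel_measurable_integrable[OF gi] fm sym] gi by blast
    moreover have "(\<integral>x. F (s, x) \<partial>lborel) = (\<integral>x. F (s, x) \<partial>lebesgue)"
      using m by (simp add: integral_completion)
    moreover have "\<dots> = (\<integral>x. g (s, x) \<partial>lebesgue_on \<Omega>)"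
      unfolding Fs using \<Omega>S by (subst integral_restrict_space) auto
    moreover have "\<dots> = (\<integral>x. f (s, x) \<partial>lebesgue_on \<Omega>)"
      by (rule integral_lebesgue_on_AE_cong[OF sym \<Omega>S])
    ultimately show ?case by simp
  qed
  show "AE s in lebesgue_on {0..T}. integrable (lebesgue_on \<Omega>) (\<lambda>x. f (s, x))"
    using main by eventually_elim blast
  have eq: "AE s in lebesgue_on {0..T}. (\<integral>x. F (s, x) \<partial>lborel) = (\<integral>x. f (s, x) \<partial>lebesgue_on \<Omega>)"
    using main by eventually_elim blast
  show "integrable (lebesgue_on {0..T}) (\<lambda>s. \<integral>x. f (s, x) \<partial>lebesgue_on \<Omega>)"
    using integrable_cong_AE[OF borel_measurable_integrable[OF 2]
        borel_measurable_lebesgue_AE_cong[OF borel_measurable_integrable[OF 2] eq I] eq] 2 by blast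
qed

text \<open>By Tonelli's theorem a uniform bound on the slices over a bounded time interval bounds
  the space-time integral. This supplies the space-time integrability of the multiplier.\<close>

lemma integrable_space_time_if_bounded:
  fixes f :: "real \<times> 'a::euclidean_space \<Rightarrow> real"
  assumes f [measurable]: "f \<in> borel_measurable borel" and \<Omega>: "open \<Omega>"
    and bound: "\<And>s. s \<in> {0<..<T} \<Longrightarrow> integrable (lebesgue_on \<Omega>) (\<lambda>x. f (s, x))"
      "\<And>s. s \<in> {0<..<T} \<Longrightarrow> (\<integral>x. \<bar>f (s, x)\<bar> \<partial>lebesgue_on \<Omega>) \<le> C"
  shows "integrable (lebesgue_on ({0<..<T} \<times> \<Omega>)) f"
proof -
  have So: "open ({0<..<T} \<times> \<Omega>)" by (intro open_Times \<Omega>) auto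
  have S: "{0<..<T} \<times> \<Omega> \<in> sets lebesgue" by (rule sets_lebesgue_open[OF So])
  have \<Omega>S: "\<Omega> \<in> sets lebesgue" by (rule sets_lebesgue_open[OF \<Omega>])
  define F where "F p = indicator ({0<..<T} \<times> \<Omega>) p * f p" for p
  have F_meas: "F \<in> borel_measurable borel"
    unfolding F_def[abs_def] using So by (intro borel_measurable_times borel_measurable_indicator f) auto
  have "(\<integral>\<^sup>+p. ennreal (norm (F p)) \<partial>(lborel \<Otimes>\<^sub>M lborel)) = (\<integral>\<^sup>+s. \<integral>\<^sup>+x. ennreal (norm (F (s, x))) \<partial>lborel \<partial>lborel)"
    using F_meas by (subst lborel.nn_integral_fst[symmetric]) (auto simp: lborel_prod)
  also have "\<dots> \<le> (\<integral>\<^sup>+s. ennreal C * indicator {0..T} s \<partial>lborel)"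
  proof (rule nn_integral_mono)
    fix s :: real
    show "(\<integral>\<^sup>+x. ennreal (norm (F (s, x))) \<partial>lborel) \<le> ennreal C * indicator {0..T} s"
    proof (cases "s \<in> {0<..<T}")
      case True
      have gm: "(\<lambda>x. f (s, x)) \<in> borel_measurable borel"
        by (rule measurable_compose[OF _ f]) (intro borel_measurable_continuous_onI continuous_intros)
      have "(\<integral>\<^sup>+x. ennreal (norm (F (s, x))) \<partial>lborel) = (\<integral>\<^sup>+x. ennreal \<bar>f (s, x)\<bar> * indicator \<Omega> x \<partial>lborel)"
        using True by (intro nn_integral_cong) (auto simp: F_def indicator_def)
      also have "\<dots> = (\<integral>\<^sup>+x. ennreal \<bar>f (s, x)\<bar> * indicator \<Omega> x \<partial>lebesgue)"
        by (simp add: nn_integral_completion)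
      also have "\<dots> = (\<integral>\<^sup>+x. ennreal \<bar>f (s, x)\<bar> \<partial>lebesgue_on \<Omega>)"
        using \<Omega>S by (subst nn_integral_restrict_space) auto
      also have "\<dots> = ennreal (\<integral>x. \<bar>f (s, x)\<bar> \<partial>lebesgue_on \<Omega>)"
        by (rule nn_integral_eq_integral[OF integrable_abs[OF bound(1)[OF True]]]) auto
      also have "\<dots> \<le> ennreal C" by (intro ennreal_leI bound(2) True)
      finally show ?thesis using True by simp
    next
      case False
      hence "F (s, x) = 0" for x by (auto simp: F_def)
      thus ?thesis by simp
    qed
  qed
  also have "\<dots> = ennreal C * emeasure lborel {0..T}" by (subst nn_integral_cmult_indicator) auto
  also have "\<dots> < \<infinity>" by (cases "0 \<le> T") (auto simp: ennreal_mult_less_top)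
  finally have "integrable (lborel \<Otimes>\<^sub>M lborel) F"
    using F_meas by (intro integrableI_bounded) (auto simp: lborel_prod)
  hence "integrable lborel F" by (simp add: lborel_prod)
  hence "integrable lebesgue F" using F_meas by (subst integrable_completion) auto
  thus ?thesis using S by (subst integrable_restrict_space) (auto simp: F_def[abs_def])
qed

subsection \<open>Testing the equation with the solution\<close>

lemma Lnorm_AE_cong:
  assumes "AE x in lebesgue_on S. f x = g x" "S \<in> sets lebesgue"
  shows "Lnorm q S f = Lnorm q S g"
  unfolding Lnorm_def using assms(1)
  by (subst integral_lebesgue_on_AE_cong[OF _ assms(2), of _ "\<lambda>x. norm (g x) powr q"]) (auto elim: eventually_mono)

lemma H1_norm_AE_cong:
  assumes "AE x in lebesgue_on \<Omega>. u x = v x" "open \<Omega>"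
  shows "H1_norm \<Omega> u = H1_norm \<Omega> v"
  using Lnorm_AE_cong[OF assms(1) sets_lebesgue_open[OF assms(2)]] weak_grad_AE_cong[OF assms]
  by (simp add: H1_norm_def)

lemma H10_AE_cong:
  assumes u: "u \<in> H10 \<Omega>" and eq: "AE x in lebesgue_on \<Omega>. u x = v x" and \<Omega>: "open \<Omega>"
  shows "v \<in> H10 \<Omega>"
proof -
  have "v \<in> H1 \<Omega>"
    using u eq Lspace_AE_cong[OF _ eq sets_lebesgue_open[OF \<Omega>]]
    by (auto simp: H10_def H1_def has_weak_gradient_AE_cong[OF eq \<Omega>])
  moreover have "H1_norm \<Omega> (\<lambda>x. \<phi> x - u x) = H1_norm \<Omega> (\<lambda>x. \<phi> x - v x)" for \<phi>
    using eq by (intro H1_norm_AE_cong \<Omega>) (auto elim: eventually_mono)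
  ultimately show ?thesis using u by (auto simp: H10_def)
qed

lemma tendsto_within_cong:
  assumes "(f \<longlongrightarrow> l) (at t within S)" "\<And>s. s \<in> S \<Longrightarrow> f s = g s"
  shows "(g \<longlongrightarrow> l) (at t within S)"
  using assms(1) by (rule Lim_transform_eventually) (use assms(2) in \<open>auto simp: eventually_at_filter\<close>)

text \<open>Apart from joint integrability, which \<open>wL\<close> supplies, the conditions on the
  curve compare at most two times at once and ignore changes on null sets. The time derivative
  \<open>u'\<close> can therefore be kept.\<close>

lemma admissible_representative:
  assumes u: "cont_curve T (H10 \<Omega>) (H1_norm \<Omega>) u" and du: "L2_time_derivative T \<Omega> u u'"
    and cu: "cont_curve T (Lspace 2 \<Omega>) (Lnorm 2 \<Omega>) u'" and \<Omega>: "open \<Omega>"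
    and w: "\<And>t. t \<in> {0..T} \<Longrightarrow> AE x in lebesgue_on \<Omega>. w (t, x) = u t x"
    and wL: "w \<in> Lspace (m + 1) ({0<..<T} \<times> \<Omega>)"
  shows "admissible_test_curve \<Omega> m T (\<lambda>t x. w (t, x)) u'"
  unfolding admissible_test_curve_def
proof (intro conjI cu)
  have S: "\<Omega> \<in> sets lebesgue" by (rule sets_lebesgue_open[OF \<Omega>])
  show "in_space_time_L (m + 1) T \<Omega> (\<lambda>t x. w (t, x))" using wL by (simp add: in_space_time_L_def)
  have eq: "AE x in lebesgue_on \<Omega>. u s x - u t x = w (s, x) - w (t, x)" if "s \<in> {0..T}" "t \<in> {0..T}" for s t
    using w[OF that(1)] w[OF that(2)] by eventually_elim simp
  show "cont_curve T (H10 \<Omega>) (H1_norm \<Omega>) (\<lambda>t x. w (t, x))"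
    unfolding cont_curve_def
  proof (intro ballI conjI)
    fix t assume t: "t \<in> {0..T}"
    have "AE x in lebesgue_on \<Omega>. u t x = w (t, x)" using w[OF t] by eventually_elim simp
    moreover have "u t \<in> H10 \<Omega>" using u t by (simp add: cont_curve_def)
    ultimately show "(\<lambda>x. w (t, x)) \<in> H10 \<Omega>" by (rule H10_AE_cong[OF _ _ \<Omega>, rotated])
    show "((\<lambda>s. H1_norm \<Omega> (\<lambda>x. w (s, x) - w (t, x))) \<longlongrightarrow> 0) (at t within {0..T})"
    proof (rule tendsto_within_cong)
      show "((\<lambda>s. H1_norm \<Omega> (\<lambda>x. u s x - u t x)) \<longlongrightarrow> 0) (at t within {0..T})"
        using u t by (simp add: cont_curve_def)
    qed (rule H1_norm_AE_cong[OF eq[OF _ t] \<Omega>])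
  qed
  show "L2_time_derivative T \<Omega> (\<lambda>t x. w (t, x)) u'"
    unfolding L2_time_derivative_def
  proof
    fix t assume t: "t \<in> {0..T}"
    show "((\<lambda>s. Lnorm 2 \<Omega> (\<lambda>x. (w (s, x) - w (t, x)) / (s - t) - u' t x)) \<longlongrightarrow> 0) (at t within {0..T})"
    proof (rule tendsto_within_cong)
      show "((\<lambda>s. Lnorm 2 \<Omega> (\<lambda>x. (u s x - u t x) / (s - t) - u' t x)) \<longlongrightarrow> 0) (at t within {0..T})"
        using du t by (simp add: L2_time_derivative_def)
      show "Lnorm 2 \<Omega> (\<lambda>x. (u s x - u t x) / (s - t) - u' t x) =
          Lnorm 2 \<Omega> (\<lambda>x. (w (s, x) - w (t, x)) / (s - t) - u' t x)" if "s \<in> {0..T}" for s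
        using eq[OF that t] by (intro Lnorm_AE_cong S) (auto elim: eventually_mono)
    qed
  qed
qed

lemma H10_curve_imp_L2_curve:
  assumes u: "cont_curve T (H10 \<Omega>) (H1_norm \<Omega>) u"
  shows "cont_curve T (Lspace 2 \<Omega>) (Lnorm 2 \<Omega>) u"
  unfolding cont_curve_def
proof (intro ballI conjI)
  fix t assume t: "t \<in> {0..T}"
  show "u t \<in> Lspace 2 \<Omega>" using u t by (auto simp: cont_curve_def H10_def H1_def)
  have le: "Lnorm 2 \<Omega> f \<le> H1_norm \<Omega> f" for f :: "'a \<Rightarrow> real"
    unfolding H1_norm_def by (rule real_le_rsqrt) simp
  show "((\<lambda>s. Lnorm 2 \<Omega> (\<lambda>x. u s x - u t x)) \<longlongrightarrow> 0) (at t within {0..T})"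
  proof (rule tendsto_sandwich[OF _ _ tendsto_const])
    show "((\<lambda>s. H1_norm \<Omega> (\<lambda>x. u s x - u t x)) \<longlongrightarrow> 0) (at t within {0..T})"
      using u t by (simp add: cont_curve_def)
  qed (use le in \<open>auto simp: Lnorm_def\<close>)
qed

text \<open>A crude form of Young's inequality, obtained by comparing \<open>\<bar>v\<bar>\<close>
  with \<open>\<bar>w\<bar>\<close>. It dominates the product of damping and multiplier by powers
  with exponent \<open>m + 1\<close>, which are integrable in space-time.\<close>

lemma power_product_le:
  fixes v w m :: real
  assumes "1 \<le> m"
  shows "(1 + \<bar>v\<bar> powr m) * \<bar>w\<bar> \<le> 2 * (1 + \<bar>v\<bar> powr (m + 1) + \<bar>w\<bar> powr (m + 1))"
proof -
  have 1: "\<bar>w\<bar> \<le> 1 + \<bar>w\<bar> powr (m + 1)"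
  proof (cases "\<bar>w\<bar> \<le> 1")
    case False
    hence "\<bar>w\<bar> powr 1 \<le> \<bar>w\<bar> powr (m + 1)" using assms by (intro powr_mono) auto
    thus ?thesis using False by simp
  qed (auto intro: add_increasing2)
  have 2: "\<bar>v\<bar> powr m * \<bar>w\<bar> \<le> \<bar>v\<bar> powr (m + 1) + \<bar>w\<bar> powr (m + 1)"
  proof (cases "\<bar>v\<bar> \<le> \<bar>w\<bar>")
    case True
    hence "\<bar>v\<bar> powr m * \<bar>w\<bar> \<le> \<bar>w\<bar> powr m * \<bar>w\<bar>" using assms by (intro mult_right_mono powr_mono2) auto
    also have "\<dots> = \<bar>w\<bar> powr (m + 1)" by (simp add: powr_add)
    finally show ?thesis by (simp add: add_increasing)
  next
    case False
    hence "\<bar>v\<bar> powr m * \<bar>w\<bar> \<le> \<bar>v\<bar> powr m * \<bar>v\<bar>" by (intro mult_left_mono) auto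
    also have "\<dots> = \<bar>v\<bar> powr (m + 1)" by (simp add: powr_add)
    finally show ?thesis by (simp add: add_increasing2)
  qed
  have add: "P + Q \<le> 2 * (1 + A + B)" if "P \<le> 1 + B" "Q \<le> A + B" "0 \<le> A" "0 \<le> B" for P Q A B :: real
  proof -
    have "P + Q \<le> (1 + B) + (A + B)" using that(1,2) by (rule add_mono)
    also have "\<dots> \<le> 2 * (1 + A + B)" using that(3) by simp
    finally show ?thesis .
  qed
  show ?thesis using add[OF 1 2] by (simp only: distrib_right mult_1 powr_ge_zero)
qed

text \<open>Measurability of \<open>\<gamma>\<close> is given on the open interval; the endpoints
  form a null set.\<close>

lemma measurable_bounded_times_integrable:
  fixes \<gamma> f :: "real \<Rightarrow> real"
  assumes \<gamma>: "\<gamma> \<in> borel_measurable (lebesgue_on {0<..<T})" and bd: "\<And>t. 0 \<le> t \<Longrightarrow> \<bar>\<gamma> t\<bar> \<le> C"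
    and f: "integrable (lebesgue_on {0..T}) f"
  shows "integrable (lebesgue_on {0..T}) (\<lambda>s. \<gamma> s * f s)"
proof (rule Bochner_Integration.integrable_bound)
  have I: "{0..T} \<in> sets lebesgue" "{0<..<T} \<in> sets lebesgue" by auto
  have "AE s in lebesgue. s \<notin> {0, T}"
    by (intro AE_not_in) (simp add: negligible_iff_null_sets[symmetric])
  hence "AE s in lebesgue. (if s \<in> {0<..<T} then \<gamma> s else 0) = (if s \<in> {0..T} then \<gamma> s else 0)"
    by eventually_elim auto
  from borel_measurable_AE[OF borel_measurable_if_I[OF \<gamma> I(2)] this]
  have "\<gamma> \<in> borel_measurable (lebesgue_on {0..T})" by (rule borel_measurable_if_D)
  thus "(\<lambda>s. \<gamma> s * f s) \<in> borel_measurable (lebesgue_on {0..T})"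
    using borel_measurable_integrable[OF f] by (rule borel_measurable_times)
  show "integrable (lebesgue_on {0..T}) (\<lambda>s. C * \<bar>f s\<bar>)" using f by simp
  have C: "0 \<le> C" using bd[of 0] by auto
  show "AE s in lebesgue_on {0..T}. norm (\<gamma> s * f s) \<le> norm (C * \<bar>f s\<bar>)"
    using bd C by (intro AE_I2) (auto simp: abs_mult intro!: mult_right_mono)
qed

text \<open>The equation is tested with the jointly measurable \<open>w\<close>, and
  \<open>w\<close> is replaced by \<open>u\<close> under each space integral, one time at a time.
  The Sobolev inequality with exponent \<open>m + 1 \<le> 6\<close> and the bound \<open>W1\<close>
  put \<open>w\<close> into the space-time Lebesgue space required of a test curve.\<close>

lemma weak_solution_tested:
  fixes \<Omega> :: "(real^3) set"
  assumes sol: "weak_solution \<Omega> A \<gamma> g p m u0 u1 T u u'" and \<Omega>: "open \<Omega>" "bounded \<Omega>"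
    and m: "1 \<le> m" "m \<le> 5" and \<gamma>: "\<gamma> \<in> borel_measurable (lebesgue_on {0<..<T})"
    and \<gamma>_bd: "\<And>t. 0 \<le> t \<Longrightarrow> \<bar>\<gamma> t\<bar> \<le> \<gamma>1"
    and g: "continuous_on UNIV g" "\<And>s. \<bar>g s\<bar> \<le> c * (1 + \<bar>s\<bar> powr m)"
    and W: "\<And>t. t \<in> {0..T} \<Longrightarrow> (\<integral>x. (norm (weak_grad \<Omega> (u t) x))\<^sup>2 \<partial>lebesgue_on \<Omega>) \<le> W1"
  shows "AE s in lebesgue_on {0..T}. integrable (lebesgue_on \<Omega>) (\<lambda>x. g (u' s x) * u' s x)"
    and "AE s in lebesgue_on {0..T}. integrable (lebesgue_on \<Omega>) (\<lambda>x. g (u' s x) * u s x)"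
    and "integrable (lebesgue_on {0..T}) (\<lambda>s. \<integral>x. \<gamma> s * g (u' s x) * u' s x \<partial>lebesgue_on \<Omega>)"
    and "integrable (lebesgue_on {0..T}) (\<lambda>s. \<integral>x. \<gamma> s * g (u' s x) * u s x \<partial>lebesgue_on \<Omega>)"
    and "\<And>t. t \<in> {0..T} \<Longrightarrow> L2_inner \<Omega> (u' t) (u t) - L2_inner \<Omega> (u' 0) (u 0)
        + (\<integral>s. form_a \<Omega> A (u s) (u s) \<partial>lebesgue_on {0..t})
        - (\<integral>s. (Lnorm 2 \<Omega> (u' s))\<^sup>2 \<partial>lebesgue_on {0..t})
        + (\<integral>s. (\<integral>x. \<gamma> s * g (u' s x) * u s x \<partial>lebesgue_on \<Omega>) \<partial>lebesgue_on {0..t})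
        = (\<integral>s. (\<integral>x. \<bar>u s x\<bar> powr (p + 1) \<partial>lebesgue_on \<Omega>) \<partial>lebesgue_on {0..t})"
proof -
  let ?Q = "{0<..<T} \<times> \<Omega>"
  have S: "\<Omega> \<in> sets lebesgue" by (rule sets_lebesgue_open[OF \<Omega>(1)])
  have Q: "?Q \<in> sets lebesgue" by (intro sets_lebesgue_open open_Times \<Omega>) auto
  have "?Q \<in> lmeasurable"
    by (intro bounded_set_imp_lmeasurable Q bounded_Times \<Omega>) auto
  hence fin: "finite_measure (lebesgue_on ?Q)" by (rule finite_measure_lebesgue_on)
  have u: "cont_curve T (H10 \<Omega>) (H1_norm \<Omega>) u" and du: "L2_time_derivative T \<Omega> u u'"
    and cu: "cont_curve T (Lspace 2 \<Omega>) (Lnorm 2 \<Omega>) u'"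
    and u'L: "in_space_time_L (m + 1) T \<Omega> u'"
    using sol by (auto simp: weak_solution_def)
  have uH: "u t \<in> H10 \<Omega>" if "t \<in> {0..T}" for t using u that by (simp add: cont_curve_def)
  obtain w where w_borel [measurable]: "w \<in> borel_measurable borel"
    and w: "\<And>t. t \<in> {0..T} \<Longrightarrow> AE x in lebesgue_on \<Omega>. w (t, x) = u t x"
    using joint_representative[OF H10_curve_imp_L2_curve[OF u] \<Omega>(1)] by blast
  have w_meas: "w \<in> borel_measurable (lebesgue_on ?Q)"
    by (intro measurable_restrict_space1 measurable_completion) simp
  have v_meas: "(\<lambda>(t, x). u' t x) \<in> borel_measurable (lebesgue_on ?Q)"
    and v_int: "integrable (lebesgue_on ?Q) (\<lambda>q. \<bar>u' (fst q) (snd q)\<bar> powr (m + 1))"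
    using u'L by (auto simp: in_space_time_L_def Lspace_def case_prod_beta)
  hence v_meas: "(\<lambda>q. u' (fst q) (snd q)) \<in> borel_measurable (lebesgue_on ?Q)"
    by (simp add: case_prod_unfold)
  define C where "C = (measure lebesgue \<Omega> + 32768) * W1 powr ((m + 1) / 2)"
  have w_int: "integrable (lebesgue_on ?Q) (\<lambda>q. \<bar>w q\<bar> powr (m + 1))"
  proof (rule integrable_space_time_if_bounded[OF _ \<Omega>(1), where C = C])
    fix s assume "s \<in> {0<..<T}"
    hence s: "s \<in> {0..T}" by auto
    have ws: "AE x in lebesgue_on \<Omega>. \<bar>u s x\<bar> powr (m + 1) = \<bar>w (s, x)\<bar> powr (m + 1)"
      using w[OF s] by eventually_elim simp
    have m1: "0 < m + 1" "m + 1 \<le> 6" using m by auto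
    note sob = sobolev_H10[OF uH[OF s] \<Omega> m1]
    have meas: "(\<lambda>x. \<bar>w (s, x)\<bar> powr (m + 1)) \<in> borel_measurable (lebesgue_on \<Omega>)"
      by (rule borel_measurable_lebesgue_AE_cong[OF borel_measurable_integrable[OF sob(1)] ws S])
    show "integrable (lebesgue_on \<Omega>) (\<lambda>x. \<bar>w (s, x)\<bar> powr (m + 1))"
      using integrable_cong_AE[OF borel_measurable_integrable[OF sob(1)] meas ws] sob(1) by blast
    have "(\<integral>x. \<bar>\<bar>w (s, x)\<bar> powr (m + 1)\<bar> \<partial>lebesgue_on \<Omega>) = (\<integral>x. \<bar>u s x\<bar> powr (m + 1) \<partial>lebesgue_on \<Omega>)"
      using integral_lebesgue_on_AE_cong[OF ws S] by simp
    also have "\<dots> \<le> (measure lebesgue \<Omega> + 32768) *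
        (\<integral>x. (norm (weak_grad \<Omega> (u s) x))\<^sup>2 \<partial>lebesgue_on \<Omega>) powr ((m + 1) / 2)" by (rule sob(2))
    also have "\<dots> \<le> C" unfolding C_def using m
      by (intro mult_left_mono powr_mono2 W s) (auto intro!: integral_nonneg_AE add_nonneg_nonneg)
    finally show "(\<integral>x. \<bar>\<bar>w (s, x)\<bar> powr (m + 1)\<bar> \<partial>lebesgue_on \<Omega>) \<le> C" .
  qed measurable
  have gm: "g \<in> borel_measurable borel" using g(1) by (rule borel_measurable_continuous_onI)
  have c0: "0 \<le> c"
  proof -
    have "0 \<le> c * (1 + \<bar>0\<bar> powr m)" using g(2)[of 0] abs_ge_zero[of "g 0"] by linarith
    thus ?thesis by simp
  qed
  have damping: "integrable (lebesgue_on ?Q) (\<lambda>q. g (u' (fst q) (snd q)) * z q)"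
    if z: "z \<in> borel_measurable (lebesgue_on ?Q)" "integrable (lebesgue_on ?Q) (\<lambda>q. \<bar>z q\<bar> powr (m + 1))" for z
  proof (rule Bochner_Integration.integrable_bound)
    interpret finite_measure "lebesgue_on ?Q" by (rule fin)
    show "integrable (lebesgue_on ?Q) (\<lambda>q. c * (2 * (1 + \<bar>u' (fst q) (snd q)\<bar> powr (m + 1) + \<bar>z q\<bar> powr (m + 1))))"
      using v_int z(2) by simp
    show "(\<lambda>q. g (u' (fst q) (snd q)) * z q) \<in> borel_measurable (lebesgue_on ?Q)"
      by (intro borel_measurable_times z(1) measurable_compose[OF v_meas gm])
    show "AE q in lebesgue_on ?Q. norm (g (u' (fst q) (snd q)) * z q)
        \<le> norm (c * (2 * (1 + \<bar>u' (fst q) (snd q)\<bar> powr (m + 1) + \<bar>z q\<bar> powr (m + 1))))"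
    proof (rule AE_I2)
      fix q
      let ?v = "u' (fst q) (snd q)"
      have "norm (g ?v * z q) \<le> c * (1 + \<bar>?v\<bar> powr m) * \<bar>z q\<bar>"
        using g(2)[of ?v] by (simp add: abs_mult mult_right_mono)
      also have "\<dots> \<le> c * (2 * (1 + \<bar>?v\<bar> powr (m + 1) + \<bar>z q\<bar> powr (m + 1)))"
        using mult_left_mono[OF power_product_le[OF m(1), of ?v "z q"] c0] by (simp add: mult.assoc)
      also have "\<dots> \<le> norm (c * (2 * (1 + \<bar>?v\<bar> powr (m + 1) + \<bar>z q\<bar> powr (m + 1))))" by simp
      finally show "norm (g ?v * z q) \<le> norm (c * (2 * (1 + \<bar>?v\<bar> powr (m + 1) + \<bar>z q\<bar> powr (m + 1))))" .
    qed
  qed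
  note F1 = Fubini_lebesgue_on[OF damping[OF v_meas v_int] \<Omega>(1), unfolded fst_conv snd_conv]
  note F2 = Fubini_lebesgue_on[OF damping[OF w_meas w_int] \<Omega>(1), unfolded fst_conv snd_conv]
  show "AE s in lebesgue_on {0..T}. integrable (lebesgue_on \<Omega>) (\<lambda>x. g (u' s x) * u' s x)" by (rule F1(1))
  have gw: "AE x in lebesgue_on \<Omega>. g (u' s x) * w (s, x) = g (u' s x) * u s x" if "s \<in> {0..T}" for s
    using w[OF that] by eventually_elim simp
  have "AE s in lebesgue_on {0..T}. s \<in> {0..T}" by (intro AE_I2) simp
  with F2(1) show "AE s in lebesgue_on {0..T}. integrable (lebesgue_on \<Omega>) (\<lambda>x. g (u' s x) * u s x)"
  proof eventually_elim
    case (elim s)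
    note i = elim(1)
    show ?case
      using integrable_cong_AE[OF borel_measurable_integrable[OF i]
          borel_measurable_lebesgue_AE_cong[OF borel_measurable_integrable[OF i] gw[OF elim(2)] S] gw[OF elim(2)]] i
      by blast
  qed
  \<comment> \<open>Taking \<open>\<gamma> s\<close> out of the space integral reduces measurability
    in time to that of \<open>\<gamma>\<close> and of an integral covered by Fubini's
    theorem.\<close>
  have pull: "(\<integral>x. \<gamma> s * g (u' s x) * z x \<partial>lebesgue_on \<Omega>) = \<gamma> s * (\<integral>x. g (u' s x) * z x \<partial>lebesgue_on \<Omega>)" for s z
    by (simp add: mult.assoc)
  show "integrable (lebesgue_on {0..T}) (\<lambda>s. \<integral>x. \<gamma> s * g (u' s x) * u' s x \<partial>lebesgue_on \<Omega>)"
    unfolding pull by (rule measurable_bounded_times_integrable[OF \<gamma> \<gamma>_bd F1(2)])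
  have gw_eq: "(\<integral>x. g (u' s x) * w (s, x) \<partial>lebesgue_on \<Omega>) = (\<integral>x. g (u' s x) * u s x \<partial>lebesgue_on \<Omega>)" if "s \<in> {0..T}" for s
    by (rule integral_lebesgue_on_AE_cong[OF gw[OF that] S])
  have int_u: "integrable (lebesgue_on {0..T}) (\<lambda>s. \<integral>x. g (u' s x) * u s x \<partial>lebesgue_on \<Omega>)"
    using F2(2) by (subst Bochner_Integration.integrable_cong[OF refl gw_eq[symmetric]]) auto
  show "integrable (lebesgue_on {0..T}) (\<lambda>s. \<integral>x. \<gamma> s * g (u' s x) * u s x \<partial>lebesgue_on \<Omega>)"
    unfolding pull by (rule measurable_bounded_times_integrable[OF \<gamma> \<gamma>_bd int_u])
  have wL: "w \<in> Lspace (m + 1) ?Q" using w_meas w_int by (simp add: Lspace_def)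
  have adm: "admissible_test_curve \<Omega> m T (\<lambda>t x. w (t, x)) u'"
    by (rule admissible_representative[OF u du cu \<Omega>(1) w wL])
  fix t assume t: "t \<in> {0..T}"
  have id: "L2_inner \<Omega> (u' t) (\<lambda>x. w (t, x)) - L2_inner \<Omega> (u' 0) (\<lambda>x. w (0, x))
        + (\<integral>s. form_a \<Omega> A (u s) (\<lambda>x. w (s, x)) \<partial>lebesgue_on {0..t})
        - (\<integral>s. (\<integral>x. u' s x * u' s x \<partial>lebesgue_on \<Omega>) \<partial>lebesgue_on {0..t})
        + (\<integral>s. (\<integral>x. \<gamma> s * g (u' s x) * w (s, x) \<partial>lebesgue_on \<Omega>) \<partial>lebesgue_on {0..t})
        = (\<integral>s. (\<integral>x. \<bar>u s x\<bar> powr (p - 1) * u s x * w (s, x) \<partial>lebesgue_on \<Omega>) \<partial>lebesgue_on {0..t})"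
    using sol[unfolded weak_solution_def, THEN conjunct2, THEN conjunct2, THEN conjunct2, THEN conjunct2,
        THEN conjunct2, THEN conjunct2, rule_format, OF t adm] .
  have inner: "L2_inner \<Omega> f (\<lambda>x. w (s, x)) = L2_inner \<Omega> f (u s)" if "s \<in> {0..T}" for f s
    unfolding L2_inner_def using w[OF that] by (intro integral_lebesgue_on_AE_cong S) (auto elim: eventually_mono)
  have fa: "form_a \<Omega> A (u s) (\<lambda>x. w (s, x)) = form_a \<Omega> A (u s) (u s)" if "s \<in> {0..T}" for s
    unfolding form_a_def using weak_grad_AE_cong[OF w[OF that] \<Omega>(1)] by simp
  have src: "(\<integral>x. \<bar>u s x\<bar> powr (p - 1) * u s x * w (s, x) \<partial>lebesgue_on \<Omega>) = (\<integral>x. \<bar>u s x\<bar> powr (p + 1) \<partial>lebesgue_on \<Omega>)"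
    if "s \<in> {0..T}" for s
  proof (rule integral_lebesgue_on_AE_cong[OF _ S])
    show "AE x in lebesgue_on \<Omega>. \<bar>u s x\<bar> powr (p - 1) * u s x * w (s, x) = \<bar>u s x\<bar> powr (p + 1)"
      using w[OF that]
    proof eventually_elim
      case (elim x)
      have "\<bar>u s x\<bar> powr (p + 1) = \<bar>u s x\<bar> powr (p - 1) * \<bar>u s x\<bar> powr 2"
        using powr_add[of "\<bar>u s x\<bar>" "p - 1" 2] by (simp add: add.commute)
      thus ?case using elim by (simp add: power2_eq_square mult.assoc add.commute)
    qed
  qed
  have kin: "(\<integral>x. u' s x * u' s x \<partial>lebesgue_on \<Omega>) = (Lnorm 2 \<Omega> (u' s))\<^sup>2" for s
    unfolding Lnorm_2_squared by (simp add: power2_eq_square)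
  have sub: "s \<in> {0..T}" if "s \<in> space (lebesgue_on {0..t})" for s using that t by auto
  have "0 \<in> {0..T}" using t by auto
  note z = inner[OF t] inner[OF this]
  have "(\<integral>s. form_a \<Omega> A (u s) (\<lambda>x. w (s, x)) \<partial>lebesgue_on {0..t}) = (\<integral>s. form_a \<Omega> A (u s) (u s) \<partial>lebesgue_on {0..t})"
    by (rule Bochner_Integration.integral_cong[OF refl fa[OF sub]])
  moreover have "(\<integral>s. (\<integral>x. \<gamma> s * g (u' s x) * w (s, x) \<partial>lebesgue_on \<Omega>) \<partial>lebesgue_on {0..t}) =
      (\<integral>s. (\<integral>x. \<gamma> s * g (u' s x) * u s x \<partial>lebesgue_on \<Omega>) \<partial>lebesgue_on {0..t})"
    unfolding pull by (rule Bochner_Integration.integral_cong[OF refl]) (simp add: gw_eq[OF sub])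
  moreover have "(\<integral>s. (\<integral>x. \<bar>u s x\<bar> powr (p - 1) * u s x * w (s, x) \<partial>lebesgue_on \<Omega>) \<partial>lebesgue_on {0..t}) =
      (\<integral>s. (\<integral>x. \<bar>u s x\<bar> powr (p + 1) \<partial>lebesgue_on \<Omega>) \<partial>lebesgue_on {0..t})"
    by (rule Bochner_Integration.integral_cong[OF refl src[OF sub]])
  ultimately show "L2_inner \<Omega> (u' t) (u t) - L2_inner \<Omega> (u' 0) (u 0)
        + (\<integral>s. form_a \<Omega> A (u s) (u s) \<partial>lebesgue_on {0..t})
        - (\<integral>s. (Lnorm 2 \<Omega> (u' s))\<^sup>2 \<partial>lebesgue_on {0..t})
        + (\<integral>s. (\<integral>x. \<gamma> s * g (u' s x) * u s x \<partial>lebesgue_on \<Omega>) \<partial>lebesgue_on {0..t})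
        = (\<integral>s. (\<integral>x. \<bar>u s x\<bar> powr (p + 1) \<partial>lebesgue_on \<Omega>) \<partial>lebesgue_on {0..t})"
    using id unfolding kin z by simp
qed

subsection \<open>Energy estimates\<close>

lemma integrable_lebesgue_on_subset:
  fixes f :: "'a::euclidean_space \<Rightarrow> 'b::{banach, second_countable_topology}"
  assumes "integrable (lebesgue_on S) f" "A \<subseteq> S" "A \<in> sets lebesgue" "S \<in> sets lebesgue"
  shows "integrable (lebesgue_on A) f"
proof -
  have "set_integrable lebesgue S f"
    using assms by (subst (asm) integrable_restrict_space) (auto simp: set_integrable_def)
  hence "set_integrable lebesgue A f" by (rule set_integrable_subset) (use assms in auto)
  thus ?thesis using assms by (subst integrable_restrict_space) (auto simp: set_integrable_def)
qed

lemma integrable_on_subinterval_lebesgue_on: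
  fixes f :: "real \<Rightarrow> real"
  assumes f: "integrable (lebesgue_on {0..S}) f" and ab: "0 \<le> a" "b \<le> S"
  shows "integrable (lebesgue_on {a..b}) f" "f integrable_on {a..b}"
    "(\<integral>x. f x \<partial>lebesgue_on {a..b}) = integral {a..b} f"
proof -
  show i: "integrable (lebesgue_on {a..b}) f"
    using ab by (intro integrable_lebesgue_on_subset[OF f]) auto
  show "f integrable_on {a..b}" by (rule integrable_on_lebesgue_on[OF i]) auto
  show "(\<integral>x. f x \<partial>lebesgue_on {a..b}) = integral {a..b} f"
    by (rule lebesgue_integral_eq_integral[OF i]) auto
qed

lemma integral_mono_AE_subinterval:
  fixes f g :: "real \<Rightarrow> real"
  assumes f: "integrable (lebesgue_on {0..S}) f" and g: "integrable (lebesgue_on {0..S}) g"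
    and le: "AE s in lebesgue_on {0..S}. f s \<le> g s" and ab: "0 \<le> a" "b \<le> S"
  shows "integral {a..b} f \<le> integral {a..b} g"
proof -
  note F = integrable_on_subinterval_lebesgue_on[OF f ab] and G = integrable_on_subinterval_lebesgue_on[OF g ab]
  have "AE s in lebesgue. s \<in> {0..S} \<longrightarrow> f s \<le> g s"
    using le by (subst (asm) AE_lebesgue_on_iff) auto
  hence "AE s in lebesgue. s \<in> {a..b} \<longrightarrow> f s \<le> g s" by eventually_elim (use ab in auto)
  hence "AE s in lebesgue_on {a..b}. f s \<le> g s" by (subst AE_lebesgue_on_iff) auto
  from integral_mono_AE[OF F(1) G(1) this] show ?thesis using F(3) G(3) by simp
qed

text \<open>
  Over a window of fixed length the integrated energy is controlled by the dissipation: the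
  boundary terms \<open>c E\<close> coming from the multiplier \<open>u\<close> are absorbed by taking the window long.
\<close>

lemma energy_window_inequality:
  fixes a K N D G X E h :: "real \<Rightarrow> real"
  assumes int: "\<And>S. integrable (lebesgue_on {0..S}) a" "\<And>S. integrable (lebesgue_on {0..S}) K"
      "\<And>S. integrable (lebesgue_on {0..S}) N" "\<And>S. integrable (lebesgue_on {0..S}) D"
      "\<And>S. integrable (lebesgue_on {0..S}) G"
    and D_nonneg: "\<And>s. 0 \<le> s \<Longrightarrow> 0 \<le> D s"
    and energy: "\<And>t. 0 \<le> t \<Longrightarrow> E t + integral {0..t} D = E 0"
    and ident: "\<And>t. 0 \<le> t \<Longrightarrow>
      X t - X 0 + integral {0..t} a - integral {0..t} K + integral {0..t} G = integral {0..t} N"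
    and \<delta>: "0 < \<delta>" and well: "\<And>t. 0 \<le> t \<Longrightarrow> N t \<le> (1 - \<delta>) * a t"
    and E_upper: "\<And>t. 0 \<le> t \<Longrightarrow> E t \<le> (K t + a t) / 2"
    and X_bound: "\<And>t. 0 \<le> t \<Longrightarrow> \<bar>X t\<bar> \<le> c * E t" and c: "0 \<le> c"
    and h: "\<And>r. 0 < r \<Longrightarrow> r \<le> 1 \<Longrightarrow> 0 < h r \<and> h r \<le> 1"
    and kin: "\<And>S r. 0 < r \<Longrightarrow> r \<le> 1 \<Longrightarrow> AE s in lebesgue_on {0..S}. K s \<le> c1 * (r\<^sup>2 + D s / h r)"
    and damp: "\<And>S r. 0 < r \<Longrightarrow> r \<le> 1 \<Longrightarrow>
      AE s in lebesgue_on {0..S}. \<bar>G s\<bar> \<le> \<delta> / 2 * a s + c2 * (r\<^sup>2 + D s / h r)"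
    and c12: "0 < c1" "0 < c2"
  shows "\<exists>T>0. \<exists>C>0. \<forall>t\<ge>0. \<forall>r. 0 < r \<and> r \<le> 1 \<longrightarrow> E (t + T) \<le> C * (r\<^sup>2 + (E t - E (t + T)) / h r)"
proof -
  \<comment> \<open>The boundary terms cost \<open>2 * c / \<delta>\<close> copies of
    \<open>E (t + T)\<close>, so this length leaves exactly one copy on the left.\<close>
  define T where "T = 2 * c / \<delta> + 1"
  define c6 where "c6 = c1 / 2 + (c1 + c2) / \<delta>"
  define C where "C = c6 * (T + 1) + c / \<delta>"
  have T: "0 < T" using c \<delta> by (simp add: T_def add_nonneg_pos)
  have c6: "0 < c6" using c12 \<delta> by (simp add: c6_def add_pos_pos)
  have C: "0 < C" using c6 T c \<delta> by (simp add: C_def add_pos_nonneg)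
  have "E (t + T) \<le> C * (r\<^sup>2 + (E t - E (t + T)) / h r)" if t: "0 \<le> t" and r: "0 < r" "r \<le> 1" for t r
  proof -
    have hr: "0 < h r" "h r \<le> 1" using h r by auto
    define J where "J f = integral {t..t + T} f" for f :: "real \<Rightarrow> real"
    have tT: "0 \<le> t + T" "t \<le> t + T" using t T by auto
    note on = integrable_on_subinterval_lebesgue_on(2)[OF _ order_refl, of "t + T" _ "t + T"]
    have J: "integral {0..t + T} f = integral {0..t} f + J f" if "integrable (lebesgue_on {0..t + T}) f" for f
      unfolding J_def using Henstock_Kurzweil_Integration.integral_combine[OF t tT(2) on[OF that order_refl]] by simp
    note on' = integrable_on_subinterval_lebesgue_on(2)[OF _ t order_refl]
    have d: "E t - E (t + T) = J D"
      using energy[OF t] energy[OF tT(1)] J[OF int(4)] by simp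
    have JD: "0 \<le> J D" unfolding J_def using D_nonneg t by (intro integral_nonneg on' int) auto
    define R where "R = T * r\<^sup>2 + J D / h r"
    define B where "B s = r\<^sup>2 + D s / h r" for s
    have Bi: "integrable (lebesgue_on {0..S}) B" for S
    proof -
      have "finite_measure (lebesgue_on {0..S})" by (intro finite_measure_lebesgue_on) auto
      thus ?thesis unfolding B_def[abs_def] using int(4)[of S]
        by (intro Bochner_Integration.integrable_add integrable_divide_zero finite_measure.integrable_const) auto
    qed
    have JB: "J (\<lambda>s. k * B s) = k * R" for k
    proof -
      have "J B = T * r\<^sup>2 + J D / h r"
        unfolding J_def B_def[abs_def] using tT on'[OF int(4)]
        by (subst Henstock_Kurzweil_Integration.integral_add) (auto simp: integrable_on_divide)
      thus ?thesis by (simp add: J_def R_def)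
    qed
    have 1: "J K \<le> c1 * R"
      unfolding JB[symmetric] unfolding J_def
      by (rule integral_mono_AE_subinterval[OF int(2) _ _ t order_refl]) (use Bi kin[OF r, folded B_def] in auto)
    have "J (\<lambda>s. - G s) \<le> J (\<lambda>s. \<delta> / 2 * a s + c2 * B s)"
      unfolding J_def
    proof (rule integral_mono_AE_subinterval[OF _ _ _ t order_refl])
      show "AE s in lebesgue_on {0..t + T}. - G s \<le> \<delta> / 2 * a s + c2 * B s"
        using damp[OF r, of "t + T"] unfolding B_def by eventually_elim linarith
    qed (use int Bi in auto)
    also have "J (\<lambda>s. \<delta> / 2 * a s + c2 * B s) = J (\<lambda>s. \<delta> / 2 * a s) + J (\<lambda>s. c2 * B s)"
      unfolding J_def using Bi int(1) on' by (intro Henstock_Kurzweil_Integration.integral_add on') auto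
    also have "\<dots> = \<delta> / 2 * J a + c2 * R" unfolding JB by (simp add: J_def)
    finally have 2: "- J G \<le> \<delta> / 2 * J a + c2 * R" by (simp add: J_def)
    have "J N \<le> J (\<lambda>s. (1 - \<delta>) * a s)"
      unfolding J_def using well t int by (intro integral_le on') auto
    hence 3: "J N \<le> (1 - \<delta>) * J a" by (simp add: J_def)
    have 4: "X (t + T) - X t + J a - J K + J G = J N"
      using ident[OF t] ident[OF tT(1)] J[OF int(1)] J[OF int(2)] J[OF int(3)] J[OF int(5)] by simp
    have mono: "E (t + T) \<le> E s" if s: "s \<in> {t..t + T}" for s
    proof -
      have s0: "0 \<le> s" using s t by simp
      have "integral {0..s} D \<le> integral {0..t + T} D"
        using s t D_nonneg by (intro integral_subset_le on[OF int(4)] integrable_on_subinterval_lebesgue_on(2)[OF int(4)[of s]]) auto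
      thus ?thesis using energy[OF s0] energy[OF tT(1)] by simp
    qed
    have "J (\<lambda>s. E (t + T)) \<le> J (\<lambda>s. (K s + a s) / 2)"
      unfolding J_def
    proof (rule integral_le)
      show "(\<lambda>s. (K s + a s) / 2) integrable_on {t..t + T}"
        using int by (intro on') auto
      show "E (t + T) \<le> (K s + a s) / 2" if "s \<in> {t..t + T}" for s
        using mono[OF that] E_upper[of s] that t by auto
    qed auto
    also have "J (\<lambda>s. (K s + a s) / 2) = (J K + J a) / 2"
      unfolding J_def using on'[OF int(1)] on'[OF int(2)]
      by (simp add: Henstock_Kurzweil_Integration.integral_add)
    also have "J (\<lambda>s. E (t + T)) = T * E (t + T)" using tT by (simp add: J_def)
    finally have 5: "T * E (t + T) \<le> (J K + J a) / 2" .
    define e0 e1 where "e0 = E t" and "e1 = E (t + T)"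
    have X: "X t - X (t + T) \<le> c * (e0 + e1)"
      using X_bound[OF t] X_bound[OF tT(1)] by (simp add: e0_def e1_def distrib_left)
    have "J a \<le> J K - J G + c * (e0 + e1) + (1 - \<delta>) * J a" using 4 3 X by linarith
    \<comment> \<open>The well leaves \<open>\<delta> * J a\<close> on the left, and the damping
      term uses up half of it.\<close>
    hence "\<delta> / 2 * J a \<le> (c1 + c2) * R + c * (e0 + e1)"
      using 1 2 by (simp add: algebra_simps)
    hence Ja: "J a / 2 \<le> ((c1 + c2) * R + c * (e0 + e1)) / \<delta>"
      using \<delta> by (simp add: field_simps)
    have e0: "e0 = e1 + J D" using d by (simp add: e0_def e1_def)
    have "T * e1 \<le> J K / 2 + J a / 2" using 5 by (simp add: e1_def add_divide_distrib)
    also have "\<dots> \<le> c1 / 2 * R + ((c1 + c2) * R + c * (e0 + e1)) / \<delta>"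
      using 1 by (intro add_mono Ja) simp
    \<comment> \<open>Writing \<open>e0 = e1 + J D\<close> splits the boundary terms into a multiple
      of \<open>e1\<close>, to be absorbed, and a multiple of the dissipation.\<close>
    also have "\<dots> = c6 * R + c / \<delta> * J D + 2 * c / \<delta> * e1"
      using \<delta> by (simp add: c6_def e0 field_simps)
    finally have "e1 \<le> c6 * R + c / \<delta> * J D" by (simp add: T_def algebra_simps)
    also have "\<dots> \<le> c6 * ((T + 1) * (r\<^sup>2 + J D / h r)) + c / \<delta> * (r\<^sup>2 + J D / h r)"
    proof -
      have q: "0 \<le> J D / h r" using JD hr by simp
      \<comment> \<open>Because \<open>h r \<le> 1\<close>, the bare dissipation is bounded by the
        dissipation divided by \<open>h r\<close>, so both kinds of terms share one form.\<close>
      have "J D * h r \<le> J D * 1" using JD hr by (intro mult_left_mono) auto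
      hence "J D \<le> J D / h r" using hr by (simp add: le_divide_eq)
      hence "J D \<le> r\<^sup>2 + J D / h r" by (simp add: add_increasing)
      moreover have "R \<le> (T + 1) * (r\<^sup>2 + J D / h r)"
      proof -
        have "(T + 1) * (r\<^sup>2 + J D / h r) = R + (r\<^sup>2 + T * (J D / h r))"
          unfolding R_def by (simp add: distrib_left distrib_right add_divide_distrib)
        moreover have "0 \<le> r\<^sup>2 + T * (J D / h r)" using q T by (intro add_nonneg_nonneg mult_nonneg_nonneg) auto
        ultimately show ?thesis by linarith
      qed
      ultimately show ?thesis using c6 c \<delta> by (intro add_mono mult_left_mono) auto
    qed
    also have "\<dots> = C * (r\<^sup>2 + J D / h r)" unfolding C_def by (simp only: distrib_right mult.assoc)
    finally show ?thesis by (simp add: e1_def d)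
  qed
  thus ?thesis using T C by blast
qed

text \<open>As long as \<open>a t \<le> z\<close> the source is at most \<open>a t\<close>, and the
  energy bound then confines \<open>a t\<close> to values up to \<open>E0 / e < z\<close>. Starting
  below \<open>z\<close>, the continuous function \<open>a\<close> can therefore never reach
  \<open>z\<close>, and the gap between \<open>E0 / e\<close> and \<open>z\<close> yields the fixed
  fraction.\<close>

lemma potential_well:
  fixes a N k :: "real \<Rightarrow> real"
  assumes p: "1 < p" and \<kappa>: "0 < \<kappa>"
    and a_cont: "\<And>t. continuous_on {0..t} a" and a_nonneg: "\<And>t. 0 \<le> t \<Longrightarrow> 0 \<le> a t"
    and N: "\<And>t. 0 \<le> t \<Longrightarrow> N t \<le> a t powr ((p + 1) / 2) / \<kappa>"
    and k: "\<And>t. 0 \<le> t \<Longrightarrow> 0 \<le> k t"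
    and E: "\<And>t. 0 \<le> t \<Longrightarrow> k t + a t / 2 - N t / (p + 1) \<le> E0"
    and E0: "0 < E0" "E0 < (1 / 2 - 1 / (p + 1)) * \<kappa> powr (2 / (p - 1))"
    and a0: "a 0 < \<kappa> powr (2 / (p - 1))"
  shows "\<exists>\<delta>>0. \<forall>t\<ge>0. N t \<le> (1 - \<delta>) * a t"
proof -
  \<comment> \<open>The positive solution \<open>a\<close> of
    \<open>a powr ((p + 1) / 2) / \<kappa> = a\<close>. It is also where
    \<open>a / 2 - a powr ((p + 1) / 2) / ((p + 1) \<kappa>)\<close> is largest, and the maximal
    value \<open>(1 / 2 - 1 / (p + 1)) * z\<close> is the depth of the well.\<close>
  define z where "z = \<kappa> powr (2 / (p - 1))"
  have z: "0 < z" using \<kappa> by (simp add: z_def)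
  define q where "q = (p - 1) / 2"
  have q: "0 < q" using p by (simp add: q_def)
  have zq: "z powr q = \<kappa>" proof -
    have "2 / (p - 1) * ((p - 1) / 2) = 1" using p by simp
    thus ?thesis using \<kappa> by (simp only: z_def q_def powr_powr) simp
  qed
  have Nq: "N t \<le> a t * (a t / z) powr q" if t: "0 \<le> t" for t
  proof -
    have "a t powr ((p + 1) / 2) = a t powr (1 + q)" by (simp add: q_def field_simps)
    also have "\<dots> = a t * a t powr q" using a_nonneg[OF t] by (simp add: powr_add)
    finally have "a t powr ((p + 1) / 2) / \<kappa> = a t * (a t powr q / z powr q)" using zq by simp
    also have "\<dots> = a t * (a t / z) powr q" using a_nonneg[OF t] z by (simp add: powr_divide)
    finally show ?thesis using N[OF t] by simp
  qed
  define e where "e = 1 / 2 - 1 / (p + 1)"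
  have e: "0 < e" using p by (simp add: e_def field_simps)
  have low: "e * a t \<le> E0" if t: "0 \<le> t" and le: "a t \<le> z" for t
  proof -
    have "(a t / z) powr q \<le> 1 powr q" using a_nonneg[OF t] z le q by (intro powr_mono2) auto
    hence "a t * (a t / z) powr q \<le> a t * 1" using a_nonneg[OF t] by (intro mult_left_mono) auto
    hence "N t \<le> a t" using Nq[OF t] by simp
    hence "N t / (p + 1) \<le> a t / (p + 1)" using p by (intro divide_right_mono) auto
    moreover have "e * a t = a t / 2 - a t / (p + 1)" by (simp add: e_def left_diff_distrib)
    ultimately show ?thesis using E[OF t] k[OF t] by linarith
  qed
  have E0z: "E0 < e * z" using E0(2) by (simp add: e_def z_def)
  have az: "a t < z" if t: "0 \<le> t" for t
  proof (rule ccontr)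
    assume "\<not> a t < z"
    hence "\<exists>s\<ge>0. s \<le> t \<and> a s = z"
      using a0 t a_cont[of t] by (intro IVT') (auto simp: z_def)
    then obtain s where "0 \<le> s" "a s = z" by blast
    thus False using low[of s] E0z by simp
  qed
  define y where "y = E0 / e"
  have y: "0 < y" "y < z" using E0(1) E0z e by (auto simp: y_def field_simps)
  \<comment> \<open>\<open>N t\<close> is at most \<open>a t\<close> times
    \<open>(a t / z) powr q\<close>, and \<open>a t \<le> y\<close> bounds the latter factor away
    from 1.\<close>
  define \<delta> where "\<delta> = 1 - (y / z) powr q"
  have "(y / z) powr q < 1 powr q" using y z q by (intro powr_less_mono2) auto
  hence \<delta>: "0 < \<delta>" by (simp add: \<delta>_def)
  have "N t \<le> (1 - \<delta>) * a t" if t: "0 \<le> t" for t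
  proof -
    have "a t \<le> y" using low[OF t] az[OF t] e by (simp add: y_def field_simps)
    hence "(a t / z) powr q \<le> (y / z) powr q"
      using a_nonneg[OF t] z q by (intro powr_mono2 divide_right_mono) auto
    hence "a t * (a t / z) powr q \<le> a t * (y / z) powr q" using a_nonneg[OF t] by (intro mult_left_mono) auto
    thus ?thesis using Nq[OF t] by (simp add: \<delta>_def mult.commute)
  qed
  thus ?thesis using \<delta> by blast
qed

section \<open>Pointwise inequalities for the damping\<close>

context
  fixes g h :: "real \<Rightarrow> real" and m b1 b2 :: real
  assumes m: "1 \<le> m" and g: "continuous_on UNIV g" "mono g" "g 0 = 0" and b: "b1 > 0" "b2 > 0"
    and g_growth: "\<And>s. \<bar>s\<bar> > 1 \<Longrightarrow> b1 * \<bar>s\<bar> powr (m + 1) \<le> g s * s \<and> g s * s \<le> b2 * \<bar>s\<bar> powr (m + 1)"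
    and h: "continuous_on {-1..1} h" "strict_mono_on {-1..1} h" "\<And>s. s \<in> {-1..1} \<Longrightarrow> h (- s) = - h s"
    and g_lower: "\<And>s. \<bar>s\<bar> \<le> 1 \<Longrightarrow> \<bar>h s * s\<bar> \<le> g s * s"
    and g_upper: "\<And>s. \<bar>s\<bar> \<le> 1 \<Longrightarrow> s \<in> h ` {-1..1} \<Longrightarrow> g s * s \<le> \<bar>inv_into {-1..1} h s * s\<bar>"
begin

lemma h_zero: "h 0 = 0" using h(3)[of 0] by simp

lemma h_pos: "0 < r \<Longrightarrow> r \<le> 1 \<Longrightarrow> 0 < h r"
  using strict_mono_onD[OF h(2), of 0 r] h_zero by simp

lemma h_mono: "-1 \<le> r \<Longrightarrow> r \<le> s \<Longrightarrow> s \<le> 1 \<Longrightarrow> h r \<le> h s"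
  using strict_mono_onD[OF h(2), of r s] by (cases "r = s") auto

lemma h_abs: "\<bar>s\<bar> \<le> 1 \<Longrightarrow> \<bar>h s\<bar> = h \<bar>s\<bar>"
  using h(3)[of s] h_mono[of 0 s] h_mono[of s 0] h_zero by (cases "0 \<le> s") auto

text \<open>The intermediate value theorem on \<open>[-r, r]\<close>, whose ends are mapped to
  \<open>- h r\<close> and \<open>h r\<close>; by injectivity the preimage found there is the value
  of the inverse.\<close>

lemma inverse_h:
  assumes v: "\<bar>v\<bar> \<le> h r" and r: "0 \<le> r" "r \<le> 1"
  shows "v \<in> h ` {-1..1}" "\<bar>inv_into {-1..1} h v\<bar> \<le> r"
proof -
  have "\<exists>s\<ge>-r. s \<le> r \<and> h s = v"
    using v r h(3)[of r] by (intro IVT' continuous_on_subset[OF h(1)]) auto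
  then obtain s where s: "-r \<le> s" "s \<le> r" "h s = v" by blast
  have inj: "inj_on h {-1..1}" using h(2) by (rule strict_mono_on_imp_inj_on)
  have "s \<in> {-1..1}" using s r by auto
  thus "v \<in> h ` {-1..1}" "\<bar>inv_into {-1..1} h v\<bar> \<le> r"
    using s inv_into_f_f[OF inj] by auto
qed

text \<open>If \<open>h 1\<close> exceeded 1, then 1 would lie in the range of \<open>h\<close>, and
  the two bounds on \<open>g\<close> at 1 would give \<open>h 1 \<le> g 1 \<le> 1\<close>.\<close>

lemma h_one_le: "h 1 \<le> 1"
proof (rule ccontr)
  assume "\<not> h 1 \<le> 1"
  hence gt: "1 < h 1" by simp
  note I = inverse_h[of 1 1]
  let ?s = "inv_into {-1..1} h 1"
  have s: "1 \<in> h ` {-1..1}" "\<bar>?s\<bar> \<le> 1" using I gt by auto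
  have "h 1 \<le> g 1" using g_lower[of 1] by simp
  also have "\<dots> \<le> \<bar>?s\<bar>" using g_upper[of 1] s by simp
  finally show False using s gt by simp
qed

lemma h_le_one: "0 \<le> r \<Longrightarrow> r \<le> 1 \<Longrightarrow> h r \<le> 1"
  using h_mono[of r 1] h_one_le by simp

lemma damping_nonneg: "0 \<le> g s * s"
proof (cases "\<bar>s\<bar> \<le> 1")
  case True
  thus ?thesis using g_lower[of s] by linarith
next
  case False
  have "0 \<le> b1 * \<bar>s\<bar> powr (m + 1)" using b by simp
  thus ?thesis using g_growth[of s] False by simp
qed

lemma abs_damping: "\<bar>g s\<bar> * \<bar>s\<bar> = g s * s"
  using damping_nonneg[of s] by (simp add: abs_mult[symmetric])

lemma damping_local_bound: "\<bar>s\<bar> \<le> 1 \<Longrightarrow> \<bar>g s\<bar> \<le> max (g 1) (- g (-1))"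
  using monoD[OF g(2), of s 1] monoD[OF g(2), of "-1" s] by (auto simp: abs_le_iff le_max_iff_disj)

lemma damping_far_bound: "1 < \<bar>s\<bar> \<Longrightarrow> \<bar>g s\<bar> \<le> b2 * \<bar>s\<bar> powr m"
proof -
  assume s: "1 < \<bar>s\<bar>"
  have "\<bar>g s\<bar> * \<bar>s\<bar> \<le> b2 * \<bar>s\<bar> powr (m + 1)" using g_growth[OF s] abs_damping by simp
  also have "\<dots> = (b2 * \<bar>s\<bar> powr m) * \<bar>s\<bar>" by (simp add: powr_add)
  finally show ?thesis using s by (simp add: mult_le_cancel_right)
qed

lemma damping_growth: "\<exists>c. \<forall>s. \<bar>g s\<bar> \<le> c * (1 + \<bar>s\<bar> powr m)"
proof -
  define c where "c = max (g 1) (- g (-1))"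
  have c: "0 \<le> c" using damping_local_bound[of 0] g(3) by (simp add: c_def)
  have "\<bar>g s\<bar> \<le> (c + b2) * (1 + \<bar>s\<bar> powr m)" for s
  proof -
    have p: "0 \<le> \<bar>s\<bar> powr m" by simp
    have "\<bar>g s\<bar> \<le> c + b2 * \<bar>s\<bar> powr m"
      using damping_local_bound[of s, folded c_def] damping_far_bound[of s] b c p
      by (cases "\<bar>s\<bar> \<le> 1") (auto intro: add_increasing add_increasing2)
    also have "\<dots> \<le> (c + b2) * (1 + \<bar>s\<bar> powr m)" using b c p by (simp add: algebra_simps)
    finally show ?thesis .
  qed
  thus ?thesis by blast
qed

text \<open>For \<open>\<bar>v\<bar>\<close> between \<open>r\<close> and 1,
  \<open>v^2 \<le> \<bar>v\<bar>\<close> and monotonicity of \<open>h\<close> give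
  \<open>v^2 * h r \<le> g v * v\<close>. Beyond 1 the growth condition gives
  \<open>b1 * v^2 \<le> g v * v\<close>, and \<open>h r \<le> 1\<close> brings this into the same
  form.\<close>

lemma kinetic_le_damping:
  assumes r: "0 < r" "r \<le> 1"
  shows "v\<^sup>2 \<le> r\<^sup>2 + (1 + 1 / b1) * (g v * v / h r)"
proof -
  define y where "y = g v * v / h r"
  have hr: "0 < h r" "h r \<le> 1" using h_pos h_le_one r by auto
  have y: "0 \<le> y" using damping_nonneg hr by (simp add: y_def)
  have gy: "g v * v \<le> y" using mult_left_mono[OF hr(2) damping_nonneg[of v]] hr by (simp add: y_def le_divide_eq)
  have yb: "0 \<le> y / b1" using y b by simp
  have r2: "0 \<le> r\<^sup>2" by simp
  have "v\<^sup>2 \<le> r\<^sup>2 \<or> v\<^sup>2 \<le> y \<or> v\<^sup>2 \<le> y / b1"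
  proof -
    consider "\<bar>v\<bar> \<le> r" | "r < \<bar>v\<bar>" "\<bar>v\<bar> \<le> 1" | "1 < \<bar>v\<bar>" by linarith
    thus ?thesis
    proof cases
      case 1
      have "\<bar>v\<bar>\<^sup>2 \<le> r\<^sup>2" using 1 by (intro power_mono) auto
      thus ?thesis by simp
    next
      case 2
      have "v\<^sup>2 * h r \<le> \<bar>v\<bar> * h \<bar>v\<bar>"
      proof (rule mult_mono)
        show "v\<^sup>2 \<le> \<bar>v\<bar>" using 2 mult_left_le[of "\<bar>v\<bar>" "\<bar>v\<bar>"] by (simp add: power2_eq_square)
        show "h r \<le> h \<bar>v\<bar>" using 2 r by (intro h_mono) auto
      qed (use hr in auto)
      also have "\<dots> \<le> g v * v" using g_lower[OF 2(2)] h_abs[OF 2(2)] by (simp add: abs_mult mult.commute)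
      finally show ?thesis using hr by (simp add: y_def le_divide_eq)
    next
      case 3
      have "v\<^sup>2 = \<bar>v\<bar> powr 2" using 3 by simp
      also have "\<dots> \<le> \<bar>v\<bar> powr (m + 1)" using 3 m by (intro powr_mono) auto
      also have "\<dots> \<le> g v * v / b1" using g_growth[OF 3] b by (simp add: le_divide_eq mult.commute)
      also have "\<dots> \<le> y / b1" using gy b by (intro divide_right_mono) auto
      finally show ?thesis by simp
    qed
  qed
  hence "v\<^sup>2 \<le> r\<^sup>2 + (y + y / b1)" using y yb r2 by linarith
  thus ?thesis unfolding y_def[symmetric] by (simp add: distrib_right)
qed

text \<open>For \<open>\<bar>v\<bar> \<le> h r\<close> the upper bound on \<open>g\<close> gives
  \<open>\<bar>g v\<bar> \<le> r\<close>; for \<open>h r < \<bar>v\<bar> \<le> 1\<close> one has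
  \<open>\<bar>g v\<bar> * h r \<le> g v * v\<close> and a fixed bound on
  \<open>\<bar>g v\<bar>\<close>. In both cases the quadratic Young inequality suffices, while
  \<open>\<bar>v\<bar> > 1\<close> calls for the power \<open>m + 1\<close> of
  \<open>w\<close>.\<close>

lemma damping_product:
  assumes \<eta>: "0 < \<eta>"
  shows "\<exists>C>0. \<forall>r v w. 0 < r \<and> r \<le> 1 \<longrightarrow>
    \<bar>g v * w\<bar> \<le> \<eta> * (w\<^sup>2 + \<bar>w\<bar> powr (m + 1)) + C * (r\<^sup>2 + g v * v / h r)"
proof -
  define c0 where "c0 = max (g 1) (- g (-1))"
  have c0: "0 \<le> c0" using damping_local_bound[of 0] g(3) by (simp add: c0_def)
  \<comment> \<open>\<open>1 / (4 * \<eta>)\<close> comes from Young's inequality and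
    \<open>1 + c0\<close> from the bound on the square of \<open>g v\<close>. \<open>C2\<close>
    bounds the ratio of \<open>\<bar>w\<bar>\<close> to \<open>\<bar>v\<bar>\<close> when
    \<open>\<bar>v\<bar> > 1\<close> and
    \<open>\<eta> * \<bar>w\<bar> powr m < \<bar>g v\<bar>\<close>.\<close>
  define C1 where "C1 = (1 + c0) / (4 * \<eta>)"
  define C2 where "C2 = (b2 / \<eta>) powr (1 / m)"
  have C: "0 < C1" "0 < C2" using c0 \<eta> b by (simp_all add: C1_def C2_def add_pos_nonneg)
  have "\<bar>g v * w\<bar> \<le> \<eta> * (w\<^sup>2 + \<bar>w\<bar> powr (m + 1)) + (C1 + C2) * (r\<^sup>2 + g v * v / h r)"
    if r: "0 < r" "r \<le> 1" for r v w
  proof -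
    define y where "y = g v * v / h r"
    have hr: "0 < h r" "h r \<le> 1" using h_pos h_le_one r by auto
    have y: "0 \<le> y" using damping_nonneg hr by (simp add: y_def)
    have gy: "g v * v \<le> y" using mult_left_mono[OF hr(2) damping_nonneg[of v]] hr by (simp add: y_def le_divide_eq)
    have r2: "0 \<le> r\<^sup>2" by simp
    have nn: "0 \<le> \<eta> * w\<^sup>2" "0 \<le> \<eta> * \<bar>w\<bar> powr (m + 1)" "0 \<le> C1 * (r\<^sup>2 + y)" "0 \<le> C2 * (r\<^sup>2 + y)"
      using \<eta> C y by auto
    have "\<bar>g v * w\<bar> \<le> \<eta> * w\<^sup>2 + C1 * (r\<^sup>2 + y) \<or> \<bar>g v * w\<bar> \<le> \<eta> * \<bar>w\<bar> powr (m + 1) + C2 * (r\<^sup>2 + y)"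
    proof (cases "\<bar>v\<bar> \<le> 1")
      case True
      have "(g v)\<^sup>2 \<le> (1 + c0) * (r\<^sup>2 + y)"
      proof (cases "\<bar>v\<bar> \<le> h r")
        case small: True
        have "\<bar>g v\<bar> \<le> r"
        proof (cases "v = 0")
          case True thus ?thesis using g(3) r by simp
        next
          case False
          note I = inverse_h[OF small less_imp_le[OF r(1)] r(2)]
          have "\<bar>g v\<bar> * \<bar>v\<bar> \<le> \<bar>inv_into {-1..1} h v\<bar> * \<bar>v\<bar>"
            using g_upper[OF True I(1)] abs_damping by (simp add: abs_mult)
          hence "\<bar>g v\<bar> \<le> \<bar>inv_into {-1..1} h v\<bar>" using False by simp
          thus ?thesis using I(2) by linarith
        qed
        hence "\<bar>g v\<bar>\<^sup>2 \<le> r\<^sup>2" by (intro power_mono) auto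
        also have "\<dots> \<le> (1 + c0) * (r\<^sup>2 + y)" using c0 y by (simp add: algebra_simps)
        finally show ?thesis by simp
      next
        case False
        have "(g v)\<^sup>2 = \<bar>g v\<bar> * \<bar>g v\<bar>" by (simp add: power2_eq_square)
        also have "\<dots> \<le> c0 * \<bar>g v\<bar>" using damping_local_bound[OF True] by (intro mult_right_mono) (auto simp: c0_def)
        also have "\<dots> \<le> c0 * y"
        proof (rule mult_left_mono[OF _ c0])
          have "\<bar>g v\<bar> * h r \<le> \<bar>g v\<bar> * \<bar>v\<bar>" using False by (intro mult_left_mono) auto
          thus "\<bar>g v\<bar> \<le> y" using abs_damping hr by (simp add: y_def le_divide_eq)
        qed
        also have "\<dots> \<le> (1 + c0) * (r\<^sup>2 + y)" using c0 y by (simp add: algebra_simps)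
        finally show ?thesis .
      qed
      hence "(g v)\<^sup>2 / (4 * \<eta>) \<le> C1 * (r\<^sup>2 + y)" using \<eta> by (simp add: C1_def divide_right_mono)
      moreover have "\<bar>g v * w\<bar> \<le> \<eta> * w\<^sup>2 + (g v)\<^sup>2 / (4 * \<eta>)"
      proof -
        have "0 \<le> (2 * \<eta> * \<bar>w\<bar> - \<bar>g v\<bar>)\<^sup>2 / (4 * \<eta>)" using \<eta> by simp
        also have "\<dots> = \<eta> * w\<^sup>2 + (g v)\<^sup>2 / (4 * \<eta>) - \<bar>g v\<bar> * \<bar>w\<bar>"
          using \<eta> by (simp add: power2_diff power_mult_distrib field_simps power2_eq_square[of \<eta>])
        finally show ?thesis by (simp add: abs_mult)
      qed
      ultimately show ?thesis by linarith
    next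
      case False
      hence v: "1 < \<bar>v\<bar>" by simp
      have "\<bar>g v * w\<bar> \<le> \<eta> * \<bar>w\<bar> powr (m + 1) + C2 * (r\<^sup>2 + y)"
      \<comment> \<open>A dichotomy in place of a Young inequality with general exponents: either
        \<open>g v\<close> is small against the power of \<open>w\<close>, or \<open>w\<close> is at
        most a multiple of \<open>v\<close> and the product is controlled by the
        dissipation.\<close>
      proof (cases "\<bar>g v\<bar> \<le> \<eta> * \<bar>w\<bar> powr m")
        case True
        have "\<bar>g v * w\<bar> \<le> \<eta> * \<bar>w\<bar> powr m * \<bar>w\<bar>" unfolding abs_mult by (rule mult_right_mono[OF True]) simp
        also have "\<dots> = \<eta> * \<bar>w\<bar> powr (m + 1)" by (simp add: powr_add)
        finally show ?thesis using nn by linarith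
      next
        case False
        have "\<bar>w\<bar> powr m \<le> b2 / \<eta> * \<bar>v\<bar> powr m"
          using False damping_far_bound[OF v] \<eta> by (simp add: field_simps)
        hence "(\<bar>w\<bar> powr m) powr (1 / m) \<le> (b2 / \<eta> * \<bar>v\<bar> powr m) powr (1 / m)"
          using m by (intro powr_mono2) auto
        moreover have "(b2 / \<eta> * \<bar>v\<bar> powr m) powr (1 / m) = C2 * \<bar>v\<bar>"
          using m b \<eta> by (subst powr_mult) (auto simp: powr_powr C2_def)
        ultimately have "\<bar>w\<bar> \<le> C2 * \<bar>v\<bar>" using m by (simp add: powr_powr)
        hence "\<bar>g v\<bar> * \<bar>w\<bar> \<le> \<bar>g v\<bar> * (C2 * \<bar>v\<bar>)" by (intro mult_left_mono) auto
        also have "\<dots> = C2 * (g v * v)" by (simp add: abs_damping[symmetric])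
        also have "\<dots> \<le> C2 * (r\<^sup>2 + y)" using C add_mono[OF r2 gy] by (intro mult_left_mono) auto
        finally show ?thesis using nn by (simp add: abs_mult)
      qed
      thus ?thesis by blast
    qed
    hence "\<bar>g v * w\<bar> \<le> \<eta> * w\<^sup>2 + \<eta> * \<bar>w\<bar> powr (m + 1) + (C1 * (r\<^sup>2 + y) + C2 * (r\<^sup>2 + y))"
      using nn by linarith
    thus ?thesis unfolding y_def[symmetric] by (simp add: distrib_left distrib_right)
  qed
  thus ?thesis using C by (intro exI[of _ "C1 + C2"]) auto
qed

end

subsection \<open>The decay rate\<close>

text \<open>Since \<open>r\<close> decreases and \<open>h\<close> is monotone, each increment of
  \<open>1 / r\<close> is bounded below by the same multiple of \<open>h (r N)\<close>, and the
  increments telescope.\<close>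

lemma decay_sequence:
  fixes h :: "real \<Rightarrow> real" and r :: "nat \<Rightarrow> real"
  assumes h_mono: "\<And>x y. 0 \<le> x \<Longrightarrow> x \<le> y \<Longrightarrow> y \<le> 1 \<Longrightarrow> h x \<le> h y"
    and h_pos: "\<And>x. 0 < x \<Longrightarrow> x \<le> 1 \<Longrightarrow> 0 < h x"
    and h_le: "\<And>x. 0 \<le> x \<Longrightarrow> x \<le> 1 \<Longrightarrow> h x \<le> 1"
    and k: "0 < k"
    and dec: "\<And>n. n < N \<Longrightarrow> k * ((r (Suc n))\<^sup>2 * h (r (Suc n))) \<le> (r n)\<^sup>2 - (r (Suc n))\<^sup>2"
    and r: "\<And>n. n \<le> N \<Longrightarrow> 0 < r n \<and> r n \<le> 1"
  shows "real N * min (k / 6) (1 / 2) * h (r N) \<le> 1 / r N"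
proof -
  define \<kappa> where "\<kappa> = min (k / 6) (1 / 2)"
  have \<kappa>: "0 < \<kappa>" "\<kappa> \<le> k / 6" "\<kappa> \<le> 1 / 2"
    using k by (auto simp: \<kappa>_def)
  have step: "\<kappa> * h (r (Suc n)) \<le> 1 / r (Suc n) - 1 / r n" if n: "n < N" for n
  proof -
    define x y where "x = r (Suc n)" and "y = r n"
    have xy: "0 < x" "x \<le> 1" "0 < y" "y \<le> 1"
      using r[of n] r[of "Suc n"] n by (auto simp: x_def y_def)
    have hx: "0 < h x" "h x \<le> 1"
      using h_pos h_le xy by auto
    have d: "k * (x\<^sup>2 * h x) \<le> y\<^sup>2 - x\<^sup>2"
      using dec[OF n] by (simp add: x_def y_def)
    have eq: "y\<^sup>2 - x\<^sup>2 = (y - x) * (y + x)"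
      by (simp add: power2_eq_square algebra_simps)
    have "0 < k * (x\<^sup>2 * h x)"
      using k xy hx by simp
    hence "0 < (y - x) * (y + x)" using d eq by linarith
    hence "x < y" using xy by (simp add: zero_less_mult_iff)
    have "\<kappa> * h x \<le> 1 / x - 1 / y"
    \<comment> \<open>If the level does not drop below half,
      \<open>y^2 - x^2 \<le> 3 x (y - x)\<close> and \<open>x y \<le> 2 x^2\<close> produce the
      factor \<open>1 / 6\<close>. Otherwise \<open>1 / x - 1 / y\<close> is at least
      \<open>1 / (2 x)\<close>, hence at least \<open>1 / 2\<close>, which explains the second entry
      of the minimum.\<close>
    proof (cases "y \<le> 2 * x")
      case True
      have "k * (x\<^sup>2 * h x) \<le> (y - x) * (3 * x)"
        using d eq mult_left_mono[of "y + x" "3 * x" "y - x"] True \<open>x < y\<close> by linarith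
      hence "x * (k * (x * h x)) \<le> x * (3 * (y - x))"
        by (simp add: power2_eq_square mult.assoc mult.commute mult.left_commute)
      hence A: "k * (x * h x) \<le> 3 * (y - x)" using xy by simp
      have "\<kappa> * h x * (x * y) \<le> k / 6 * h x * (x * (2 * x))"
        using \<kappa> hx xy True k by (intro mult_mono) auto
      also have "\<dots> = (k * (x * h x)) * x / 3"
        by (simp add: field_simps)
      also have "\<dots> \<le> (3 * (y - x)) * 1 / 3"
        using mult_mono[OF A xy(2)] xy \<open>x < y\<close> by simp
      finally show ?thesis using xy
        by (simp add: field_simps)
    next
      case False
      have "1 / y \<le> 1 / (2 * x)" using False xy by (intro divide_left_mono) auto
      moreover have "1 / (2 * x) \<ge> 1 / 2" using xy by (simp add: field_simps)
      moreover have "\<kappa> * h x \<le> 1 / 2 * 1" using \<kappa> hx by (intro mult_mono) auto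
      moreover have "1 / x = 1 / (2 * x) + 1 / (2 * x)" using xy by (simp add: field_simps)
      ultimately show ?thesis by linarith
    qed
    thus ?thesis by (simp add: x_def y_def)
  qed
  have mono: "r (Suc n) \<le> r n" if n: "n < N" for n
  proof -
    have "0 \<le> k * ((r (Suc n))\<^sup>2 * h (r (Suc n)))"
      using k h_pos[of "r (Suc n)"] r[of "Suc n"] n by auto
    hence "(r (Suc n))\<^sup>2 \<le> (r n)\<^sup>2" using dec[OF n] by linarith
    thus ?thesis using r[of n] n by - (rule power2_le_imp_le, auto)
  qed
  have anti: "r N \<le> r n" if "n \<le> N" for n
    using that by (induction rule: inc_induct) (auto intro: order_trans[OF _ mono])
  have "real n * (\<kappa> * h (r N)) \<le> 1 / r n" if "n \<le> N" for n
    using that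
  proof (induction n)
    case 0
    then show ?case using r[of 0] by simp
  next
    case (Suc n)
    have "h (r N) \<le> h (r (Suc n))"
      using Suc.prems r[of N] r[of "Suc n"] anti by (intro h_mono) auto
    hence "\<kappa> * h (r N) \<le> \<kappa> * h (r (Suc n))" using \<kappa> by simp
    with step[of n] Suc show ?case by (simp add: algebra_simps)
  qed
  from this[of N] show ?thesis by (simp add: \<kappa>_def mult.assoc)
qed

text \<open>
  With \<open>r n = sqrt (E (n T) / 2 L)\<close> the hypothesis \<open>key\<close>, used at level \<open>r (Suc n)\<close>, says that
  \<open>1 / r\<close> grows by at least a multiple of \<open>h (r (Suc n))\<close> in each step. The constant produced by
  this is removed with \<open>h (x / c) * (x / c) \<le> h x * x / c\<close>, so no convexity of
  \<open>h x * x\<close> is needed.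
\<close>

lemma decay_rate:
  fixes h E :: "real \<Rightarrow> real"
  assumes h_mono: "strict_mono_on {0..1} h"
    and h0: "h 0 = 0" and h1: "h 1 \<le> 1"
    and E_nonneg: "\<And>t. 0 \<le> t \<Longrightarrow> 0 \<le> E t"
    and E_mono: "\<And>s t. 0 \<le> s \<Longrightarrow> s \<le> t \<Longrightarrow> E t \<le> E s"
    and T: "0 < T" and K: "0 < K"
    and key: "\<And>t r. 0 \<le> t \<Longrightarrow> 0 < r \<Longrightarrow> r \<le> 1 \<Longrightarrow>
      E (t + T) \<le> K * (r\<^sup>2 + (E t - E (t + T)) / h r)"
  shows "\<exists>C>0. \<forall>t\<ge>1. \<forall>s\<in>{0..1}. h s * s = 1 / t \<longrightarrow> E t \<le> C * s\<^sup>2"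
proof -
  have hm: "h x \<le> h y" if "0 \<le> x" "x \<le> y" "y \<le> 1" for x y
    using h_mono that by (cases "x = y") (auto simp: strict_mono_on_def intro: less_imp_le)
  have hp: "0 < h x" if "0 < x" "x \<le> 1" for x
    using strict_mono_onD[OF h_mono, of 0 x] that h0 by simp
  have hl: "h x \<le> 1" if "0 \<le> x" "x \<le> 1" for x
    using hm[of x 1] that h1 by simp
  \<comment> \<open>\<open>L \<ge> E 0\<close> keeps all levels \<open>r n\<close> in
    \<open>[0, 1]\<close>. Normalising by \<open>2 * L\<close> makes \<open>L\<close> times the
    square of \<open>r (Suc n)\<close> half of the energy after \<open>Suc n\<close> windows, so
    that term can be absorbed.\<close>
  define L where "L = max K (E 0)"
  have L: "0 < L" "K \<le> L" "E 0 \<le> L" using K by (auto simp: L_def)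
  define r where "r n = sqrt (E (real n * T) / (2 * L))" for n :: nat
  define \<kappa> where "\<kappa> = min (1 / (2 * L) / 6) (1 / 2)"
  have \<kappa>: "0 < \<kappa>" using L by (simp add: \<kappa>_def)
  define c where "c = max 1 (2 * T / \<kappa>)"
  have c: "1 \<le> c" "2 * T / \<kappa> \<le> c" by (auto simp: c_def)
  \<comment> \<open>The first entry serves \<open>t \<ge> T\<close>, the second the initial stretch
    \<open>t < T\<close>, in which no full window has elapsed.\<close>
  define C where "C = max (2 * L * c\<^sup>2) (E 0 * T\<^sup>2)"
  have C: "0 < C" "2 * L * c\<^sup>2 \<le> C" "E 0 * T\<^sup>2 \<le> C" using L c by (auto simp: C_def less_max_iff_disj)
  have r2: "2 * L * (r n)\<^sup>2 = E (real n * T)" for n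
    using L E_nonneg[of "real n * T"] T by (simp add: r_def)
  have r_bd: "0 \<le> r n" "r n \<le> 1" for n
  proof -
    show "0 \<le> r n" using L E_nonneg[of "real n * T"] T by (simp add: r_def)
    have "E (real n * T) \<le> L" using E_mono[of 0 "real n * T"] T L by simp
    thus "r n \<le> 1" using L by (simp add: r_def)
  qed
  have main: "real N * \<kappa> * h (r N) \<le> 1 / r N" if pos: "0 < E (real N * T)" for N
    unfolding \<kappa>_def
  proof (rule decay_sequence)
    fix n assume n: "n \<le> N"
    have "0 < E (real n * T)"
      using E_mono[of "real n * T" "real N * T"] T n pos by (smt (verit) mult_right_mono of_nat_le_iff of_nat_0_le_iff mult_nonneg_nonneg)
    thus "0 < r n \<and> r n \<le> 1" using r_bd L by (auto simp: r_def)
  next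
    fix n assume n: "n < N"
    have "0 < E (real (Suc n) * T)"
      using E_mono[of "real (Suc n) * T" "real N * T"] T n pos
      by (smt (verit) mult_right_mono of_nat_le_iff of_nat_0_le_iff mult_nonneg_nonneg Suc_leI)
    hence rp: "0 < r (Suc n)" using L by (auto simp: r_def)
    have h: "0 < h (r (Suc n))" using hp rp r_bd by simp
    define d where "d = E (real n * T) - E (real (Suc n) * T)"
    have d: "0 \<le> d" using E_mono[of "real n * T" "real (Suc n) * T"] T by (simp add: d_def algebra_simps)
    have "E (real (Suc n) * T) \<le> K * ((r (Suc n))\<^sup>2 + d / h (r (Suc n)))"
      using key[of "real n * T" "r (Suc n)"] T rp r_bd by (simp add: d_def algebra_simps)
    also have "\<dots> \<le> L * ((r (Suc n))\<^sup>2 + d / h (r (Suc n)))"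
      using L d h by (intro mult_right_mono) auto
    finally have "2 * L * (r (Suc n))\<^sup>2 \<le> L * ((r (Suc n))\<^sup>2 + d / h (r (Suc n)))"
      unfolding r2 .
    hence "L * (r (Suc n))\<^sup>2 \<le> L * (d / h (r (Suc n)))" by (simp add: algebra_simps)
    hence "(r (Suc n))\<^sup>2 \<le> d / h (r (Suc n))" using mult_le_cancel_left_pos[OF L(1)] by blast
    hence "(r (Suc n))\<^sup>2 * h (r (Suc n)) \<le> d" using h by (simp add: field_simps)
    also have "d = 2 * L * ((r n)\<^sup>2 - (r (Suc n))\<^sup>2)"
      using r2[of n] r2[of "Suc n"] by (simp add: d_def algebra_simps)
    finally show "1 / (2 * L) * ((r (Suc n))\<^sup>2 * h (r (Suc n))) \<le> (r n)\<^sup>2 - (r (Suc n))\<^sup>2"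
      using L by (simp add: field_simps)
  qed (use hm hp hl L in auto)
  have "E t \<le> C * s\<^sup>2" if t: "1 \<le> t" and s: "s \<in> {0..1}" and st: "h s * s = 1 / t" for t s
  proof (cases "t < T")
    case True
    \<comment> \<open>Since \<open>h s \<le> 1\<close>, the relation \<open>h s * s = 1 / t\<close>
      keeps \<open>s\<close> above \<open>1 / T\<close>, so a multiple of \<open>s^2\<close>
      dominates the initial energy.\<close>
    have "1 / T \<le> 1 / t" using True t by (simp add: field_simps)
    also have "\<dots> \<le> 1 * s" unfolding st[symmetric] using hl s by (intro mult_right_mono) auto
    finally have "1 \<le> T * s" using T by (simp add: field_simps)
    hence "1\<^sup>2 \<le> (T * s)\<^sup>2" by (intro power_mono) auto
    hence "E 0 * 1 \<le> E 0 * (T * s)\<^sup>2" using E_nonneg[of 0] by (intro mult_left_mono) auto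
    moreover have "E t \<le> E 0" using E_mono[of 0 t] t by simp
    moreover have "E 0 * T\<^sup>2 * s\<^sup>2 \<le> C * s\<^sup>2" using C by (intro mult_right_mono) auto
    ultimately show ?thesis by (simp add: power_mult_distrib)
  next
    case False
    define N where "N = nat \<lfloor>t / T\<rfloor>"
    have tT: "1 \<le> t / T" using False T by (simp add: field_simps)
    have N: "real N = of_int \<lfloor>t / T\<rfloor>" using tT by (simp add: N_def)
    have N1: "real N \<le> t / T" "t / T < real N + 1" using N by linarith+
    hence "1 \<le> real N" using tT N by (metis of_int_1_le_iff le_floor_iff of_int_1)
    hence N2: "t / T \<le> 2 * real N" using N1 by linarith
    have NT: "real N * T \<le> t" using N1 T by (simp add: field_simps)
    have Et: "E t \<le> E (real N * T)" using E_mono[of "real N * T" t] NT T by simp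
    show ?thesis
    \<comment> \<open>At zero energy there is no positive level to work with, but the claim is then
      immediate.\<close>
    proof (cases "E (real N * T) = 0")
      case True
      thus ?thesis using Et C by (smt (verit) mult_nonneg_nonneg zero_le_power2)
    next
      case nz: False
      have pos: "0 < E (real N * T)" using nz E_nonneg[of "real N * T"] T by auto
      have rp: "0 < r N" using pos L by (simp add: r_def)
      have "real N * \<kappa> * (h (r N) * r N) \<le> 1" using main[OF pos] rp by (simp add: field_simps)
      hence "h (r N) * r N \<le> 1 / (real N * \<kappa>)"
        using \<open>1 \<le> real N\<close> \<kappa> by (simp add: field_simps)
      also have "\<dots> \<le> 1 / (t / T / 2 * \<kappa>)"
        using N2 t T \<kappa> \<open>1 \<le> real N\<close> by (intro divide_left_mono mult_right_mono mult_pos_pos) auto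
      also have "\<dots> = 2 * T / \<kappa> / t" by (simp add: field_simps)
      also have "\<dots> \<le> c / t" using c t by (intro divide_right_mono) auto
      finally have A: "h (r N) * r N \<le> c / t" .
      have "r N * 1 \<le> r N * c" using rp c by (intro mult_left_mono) auto
      hence rc: "0 < r N / c" "r N / c \<le> r N" "r N / c \<le> 1"
        using rp c r_bd[of N] by (auto simp: divide_le_eq)
      have "h (r N / c) * (r N / c) \<le> h (r N) * (r N / c)"
        using rc hm[of "r N / c" "r N"] r_bd[of N] by (intro mult_right_mono) auto
      also have "\<dots> \<le> 1 / t" using A c t by (simp add: field_simps)
      finally have B: "h (r N / c) * (r N / c) \<le> h s * s" using st by simp
      \<comment> \<open>The comparison of \<open>h x * x\<close> at the two points is inverted by
        its strict growth, in contrapositive form.\<close>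
      have "r N / c \<le> s"
      proof (rule ccontr)
        assume "\<not> r N / c \<le> s"
        hence "h s * s \<le> h (r N / c) * s" using hm[of s "r N / c"] s rc by (intro mult_right_mono) auto
        also have "\<dots> < h (r N / c) * (r N / c)"
          using \<open>\<not> r N / c \<le> s\<close> hp[of "r N / c"] rc by (intro mult_strict_left_mono) auto
        finally show False using B by simp
      qed
      hence "r N \<le> c * s" using c by (simp add: field_simps)
      hence "(r N)\<^sup>2 \<le> (c * s)\<^sup>2" using rp by (intro power_mono) auto
      hence "2 * L * (r N)\<^sup>2 \<le> 2 * L * c\<^sup>2 * s\<^sup>2" using L by (simp add: power_mult_distrib)
      also have "\<dots> \<le> C * s\<^sup>2" using C by (intro mult_right_mono) auto
      finally show ?thesis using Et r2[of N] by simp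
    qed
  qed
  thus ?thesis using C(1) by blast
qed

section \<open>From the hypotheses on function spaces to scalar inequalities\<close>

lemma smooth_on_closed_continuous:
  assumes "smooth_on_closed K f"
  shows "continuous_on K f"
proof -
  obtain U F where F: "K \<subseteq> U" "smooth_on U F" "\<And>x. x \<in> K \<Longrightarrow> F x = f x"
    using assms by (auto simp: smooth_on_closed_def)
  have "Ck_on 0 U F" using F(2) by (simp only: smooth_on_def)
  hence "continuous_on K F" using F(1) continuous_on_subset by auto
  thus ?thesis using F(3) continuous_on_cong[of K K F f] by simp
qed

lemma quadratic_form_inner:
  fixes A :: "real^'n^'n"
  shows "(A *v \<xi>) \<bullet> \<xi> = (\<Sum>i\<in>UNIV. \<Sum>j\<in>UNIV. A $ i $ j * \<xi> $ i * \<xi> $ j)"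
  by (simp add: inner_vec_def matrix_vector_mult_def sum_distrib_left sum_distrib_right mult_ac)

lemma Lnorm_powr:
  "0 < q \<Longrightarrow> Lnorm q S f powr q = (\<integral>x. norm (f x) powr q \<partial>lebesgue_on S)"
  unfolding Lnorm_def by (simp add: powr_powr integral_nonneg_AE)

lemma total_energy_AE_cong:
  assumes "AE x in lebesgue_on \<Omega>. w x = w' x" "AE x in lebesgue_on \<Omega>. v x = v' x" "open \<Omega>"
  shows "total_energy \<Omega> A p w v = total_energy \<Omega> A p w' v'"
  using Lnorm_AE_cong[OF assms(1) sets_lebesgue_open[OF assms(3)]]
    Lnorm_AE_cong[OF assms(2) sets_lebesgue_open[OF assms(3)]] weak_grad_AE_cong[OF assms(1,3)]
  by (simp add: total_energy_def quadratic_energy_def form_a_def)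

text \<open>The pointwise inequalities at one level \<open>r\<close> are integrated over a set of
  finite measure; the constant terms contribute its volume.\<close>

lemma damping_estimates:
  fixes v w :: "'a::euclidean_space \<Rightarrow> real"
  assumes S: "S \<in> lmeasurable" and gv: "integrable (lebesgue_on S) (\<lambda>x. g (v x) * v x)"
    and gw: "integrable (lebesgue_on S) (\<lambda>x. g (v x) * w x)"
    and v: "v \<in> Lspace 2 S" and w: "w \<in> Lspace 2 S" "integrable (lebesgue_on S) (\<lambda>x. \<bar>w x\<bar> powr (m + 1))"
    and kin: "\<And>y. y\<^sup>2 \<le> r\<^sup>2 + k1 * (g y * y / h r)"
    and prod: "\<And>y z. \<bar>g y * z\<bar> \<le> \<eta> * (z\<^sup>2 + \<bar>z\<bar> powr (m + 1)) + k2 * (r\<^sup>2 + g y * y / h r)"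
  defines "P \<equiv> (\<integral>x. g (v x) * v x \<partial>lebesgue_on S)"
  shows "(\<integral>x. (v x)\<^sup>2 \<partial>lebesgue_on S) \<le> r\<^sup>2 * measure lebesgue S + k1 * (P / h r)"
    and "(\<integral>x. \<bar>g (v x) * w x\<bar> \<partial>lebesgue_on S)
      \<le> \<eta> * ((\<integral>x. (w x)\<^sup>2 \<partial>lebesgue_on S) + (\<integral>x. \<bar>w x\<bar> powr (m + 1) \<partial>lebesgue_on S))
        + k2 * (r\<^sup>2 * measure lebesgue S + P / h r)"
proof -
  interpret finite_measure "lebesgue_on S" using S by (rule finite_measure_lebesgue_on)
  have meas: "measure (lebesgue_on S) (space (lebesgue_on S)) = measure lebesgue S"
    using S by (subst measure_restrict_space) auto
  have v2: "integrable (lebesgue_on S) (\<lambda>x. (v x)\<^sup>2)" and w2: "integrable (lebesgue_on S) (\<lambda>x. (w x)\<^sup>2)"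
    using v w by (auto simp: Lspace_2_iff)
  have "(\<integral>x. (v x)\<^sup>2 \<partial>lebesgue_on S) \<le> (\<integral>x. r\<^sup>2 + k1 * (g (v x) * v x / h r) \<partial>lebesgue_on S)"
    using v2 gv kin by (intro integral_mono) auto
  also have "\<dots> = r\<^sup>2 * measure lebesgue S + k1 * (P / h r)"
    using gv meas by (simp add: P_def)
  finally show "(\<integral>x. (v x)\<^sup>2 \<partial>lebesgue_on S) \<le> r\<^sup>2 * measure lebesgue S + k1 * (P / h r)" .
  have "(\<integral>x. \<bar>g (v x) * w x\<bar> \<partial>lebesgue_on S)
      \<le> (\<integral>x. \<eta> * ((w x)\<^sup>2 + \<bar>w x\<bar> powr (m + 1)) + k2 * (r\<^sup>2 + g (v x) * v x / h r) \<partial>lebesgue_on S)"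
    using w2 w(2) gv gw prod by (intro integral_mono) auto
  also have "\<dots> = \<eta> * ((\<integral>x. (w x)\<^sup>2 \<partial>lebesgue_on S) + (\<integral>x. \<bar>w x\<bar> powr (m + 1) \<partial>lebesgue_on S))
        + k2 * (r\<^sup>2 * measure lebesgue S + P / h r)"
    using w2 w(2) gv meas by (simp add: P_def)
  finally show "(\<integral>x. \<bar>g (v x) * w x\<bar> \<partial>lebesgue_on S)
      \<le> \<eta> * ((\<integral>x. (w x)\<^sup>2 \<partial>lebesgue_on S) + (\<integral>x. \<bar>w x\<bar> powr (m + 1) \<partial>lebesgue_on S))
        + k2 * (r\<^sup>2 * measure lebesgue S + P / h r)" .
qed

text \<open>
  If the gradients of all members of the space had norm 0, every real number would be admissible
  in \<open>embedding_constant\<close>, whose \<open>LEAST\<close> would then be unspecified. So the optimal constant is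
  used only if some gradient is nonzero.
\<close>

lemma source_below_form:
  fixes \<Omega> :: "(real^3) set" and u :: "real \<Rightarrow> real^3 \<Rightarrow> real" and a N k :: "real \<Rightarrow> real"
  assumes \<Omega>: "open \<Omega>" "bounded \<Omega>" and p: "1 < p" "p + 1 \<le> 6" and \<omega>: "0 < \<omega>"
    and M: "M = embedding_constant \<Omega> (p + 1)"
    and uH: "\<And>t. 0 \<le> t \<Longrightarrow> u t \<in> H10 \<Omega>"
    and N: "\<And>t. N t = (\<integral>x. \<bar>u t x\<bar> powr (p + 1) \<partial>lebesgue_on \<Omega>)"
    and a_lower: "\<And>t. 0 \<le> t \<Longrightarrow> \<omega> * (Lnorm 2 \<Omega> (weak_grad \<Omega> (u t)))\<^sup>2 \<le> a t"
    and a_cont: "\<And>t. continuous_on {0..t} a" and k: "\<And>t. 0 \<le> t \<Longrightarrow> 0 \<le> k t"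
    and E: "\<And>t. 0 \<le> t \<Longrightarrow> k t + a t / 2 - N t / (p + 1) \<le> E0"
    and E0: "0 < E0"
      "E0 < (1 / 2 - 1 / (p + 1)) * (\<omega> powr ((p + 1) / 2) / M powr (p + 1)) powr (2 / (p - 1))"
    and a0: "a 0 < (\<omega> powr ((p + 1) / 2) / M powr (p + 1)) powr (2 / (p - 1))"
  shows "\<exists>\<delta>>0. \<forall>t\<ge>0. N t \<le> (1 - \<delta>) * a t"
proof -
  let ?G = "\<lambda>w. Lnorm 2 \<Omega> (weak_grad \<Omega> w)"
  have G0: "0 \<le> ?G w" for w by (simp add: Lnorm_def)
  have a_nonneg: "0 \<le> a t" if "0 \<le> t" for t
  proof -
    have "0 \<le> \<omega> * (?G (u t))\<^sup>2" using \<omega> by simp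
    thus ?thesis using a_lower[OF that] by linarith
  qed
  have q: "0 < p + 1" using p by simp
  show ?thesis
  proof (cases "\<exists>w\<in>H10 \<Omega>. 0 < ?G w")
    \<comment> \<open>All gradients have norm 0 here, so the Sobolev inequality already gives
      \<open>N t \<le> 0\<close>.\<close>
    case False
    have "N t \<le> (1 - 1 / 2) * a t" if t: "0 \<le> t" for t
    proof -
      have "?G (u t) = 0" using False uH[OF t] G0[of "u t"] by force
      hence "(\<integral>x. (norm (weak_grad \<Omega> (u t) x))\<^sup>2 \<partial>lebesgue_on \<Omega>) = 0"
        unfolding Lnorm_2_squared[symmetric] by simp
      hence "N t \<le> 0" using sobolev_H10(2)[OF uH[OF t] \<Omega> q p(2)] unfolding N by simp
      thus ?thesis using a_nonneg[OF t] by simp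
    qed
    thus ?thesis by (intro exI[of _ "1 / 2"]) auto
  next
    case True
    then obtain w where w: "w \<in> H10 \<Omega>" "0 < ?G w" by blast
    note emb = embedding_constant_H10[OF \<Omega> q p(2) w, folded M]
    \<comment> \<open>For \<open>M = 0\<close> the division by \<open>M powr (p + 1)\<close> would
      give 0 by convention, and the upper bound on \<open>E0\<close> would read
      \<open>E0 < 0\<close>.\<close>
    have "M \<noteq> 0" using E0 p by auto
    hence M0: "0 < M" using emb(1) by simp
    define \<kappa> where "\<kappa> = \<omega> powr ((p + 1) / 2) / M powr (p + 1)"
    have \<kappa>: "0 < \<kappa>" using M0 \<omega> by (simp add: \<kappa>_def)
    have "N t \<le> a t powr ((p + 1) / 2) / \<kappa>" if t: "0 \<le> t" for t
    proof -
      have "N t = Lnorm (p + 1) \<Omega> (u t) powr (p + 1)" using q by (simp add: N Lnorm_powr)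
      also have "\<dots> \<le> (M * ?G (u t)) powr (p + 1)"
        using emb(2)[OF uH[OF t]] q by (intro powr_mono2) (auto simp: Lnorm_def)
      also have "\<dots> = M powr (p + 1) * ?G (u t) powr (p + 1)" using M0 G0 by (simp add: powr_mult)
      also have "?G (u t) powr (p + 1) = ((?G (u t))\<^sup>2) powr ((p + 1) / 2)"
      proof -
        have "(?G (u t))\<^sup>2 = ?G (u t) powr 2" using G0 by simp
        moreover have "2 * ((p + 1) / 2) = p + 1" by simp
        ultimately show ?thesis by (simp only: powr_powr)
      qed
      also have "\<dots> \<le> (a t / \<omega>) powr ((p + 1) / 2)"
        using a_lower[OF t] \<omega> q by (intro powr_mono2) (auto simp: field_simps)
      also have "\<dots> = a t powr ((p + 1) / 2) / \<omega> powr ((p + 1) / 2)"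
        using a_nonneg[OF t] \<omega> by (simp add: powr_divide)
      finally show ?thesis using M0 by (simp add: \<kappa>_def mult_left_mono field_simps)
    qed
    thus ?thesis
      using potential_well[OF p(1) \<kappa> a_cont a_nonneg _ k E E0[folded \<kappa>_def] a0[folded \<kappa>_def]] by blast
  qed
qed

subsection \<open>Decay of the energy\<close>

theorem theorem2p6:
  fixes \<Omega> :: "(real^3) set"
    and A :: "real^3 \<Rightarrow> real^3^3"
    and \<omega> M p m b1 b2 \<gamma>0 :: real
    and \<gamma> g h :: "real \<Rightarrow> real"
    and u0 u1 :: "real^3 \<Rightarrow> real"
    and u u' :: "real \<Rightarrow> real^3 \<Rightarrow> real"
  assumes domain: "smooth_bounded_domain \<Omega>"
    and A_smooth: "\<And>i j. smooth_on_closed (closure \<Omega>) (\<lambda>x. A x $ i $ j)"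
    and A_sym: "\<And>x i j. x \<in> closure \<Omega> \<Longrightarrow> A x $ i $ j = A x $ j $ i"
    and \<omega>_pos: "\<omega> > 0"
    and A_elliptic: "\<And>x \<xi>. x \<in> closure \<Omega> \<Longrightarrow>
      (\<Sum>i\<in>UNIV. \<Sum>j\<in>UNIV. A x $ i $ j * \<xi> $ i * \<xi> $ j) \<ge> \<omega> * (\<Sum>i\<in>UNIV. (\<xi> $ i)\<^sup>2)"
    and M: "M = embedding_constant \<Omega> (p + 1)"
    and p: "1 < p" "p \<le> 5"
    and m: "1 \<le> m" "m \<le> 5" "p * ((m + 1) / m) < 6"
    and \<gamma>: "W1inf_loc_half_line \<gamma>" "bounded (\<gamma> ` {0..})" "\<And>t. t \<ge> 0 \<Longrightarrow> 0 \<le> \<gamma> t"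
    and g: "continuous_on UNIV g" "mono g" "g 0 = 0"
    and b: "b1 > 0" "b2 > 0"
    and g_growth: "\<And>s. \<bar>s\<bar> > 1 \<Longrightarrow>
      b1 * \<bar>s\<bar> powr (m + 1) \<le> g s * s \<and> g s * s \<le> b2 * \<bar>s\<bar> powr (m + 1)"
    and data: "u0 \<in> H10 \<Omega>" "u1 \<in> Lspace 2 \<Omega>"
    and E0: "0 < total_energy \<Omega> A p u0 u1"
      "total_energy \<Omega> A p u0 u1
         < (1 / 2 - 1 / (p + 1)) * (\<omega> powr ((p + 1) / 2) / M powr (p + 1)) powr (2 / (p - 1))"
    and a0: "form_a \<Omega> A u0 u0 < (\<omega> powr ((p + 1) / 2) / M powr (p + 1)) powr (2 / (p - 1))"
    and \<gamma>0: "\<gamma>0 > 0" "\<And>t. t \<ge> 0 \<Longrightarrow> \<gamma> t \<ge> \<gamma>0"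
    and h: "C1_on_interval (-1) 1 h" "strict_mono_on {-1..1} h"
      "\<And>s. s \<in> {-1..1} \<Longrightarrow> h (- s) = - h s"
    and g_lower: "\<And>s. \<bar>s\<bar> \<le> 1 \<Longrightarrow> \<bar>h s * s\<bar> \<le> g s * s"
    and g_upper: "\<And>s. \<bar>s\<bar> \<le> 1 \<Longrightarrow> s \<in> h ` {-1..1} \<Longrightarrow>
      g s * s \<le> \<bar>inv_into {-1..1} h s * s\<bar>"
    and sol: "global_weak_solution \<Omega> A \<gamma> g p m u0 u1 u u'"
    and energy_id: "energy_identity \<Omega> A \<gamma> g p u u'"
  shows "\<exists>C>0. \<forall>t\<ge>1. 1 / t \<in> (\<lambda>s. h s * s) ` {0..1} \<longrightarrow>
    total_energy \<Omega> A p (u t) (u' t)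
      \<le> C * total_energy \<Omega> A p (u 0) (u' 0) * (inv_into {0..1} (\<lambda>s. h s * s) (1 / t))\<^sup>2"
proof -
  have \<Omega>: "open \<Omega>" "bounded \<Omega>" using domain by (auto simp: smooth_bounded_domain_def)
  have S: "\<Omega> \<in> lmeasurable" using \<Omega> by (simp add: bounded_set_imp_lmeasurable)
  have "p * ((m + 1) / m) = p + p / m" using m(1) by (simp add: field_simps)
  moreover have "p / 5 \<le> p / m" using m p by (intro divide_left_mono) auto
  ultimately have p6: "p + 1 \<le> 6" using m(3) p by simp
  have p1: "0 < p + 1" using p by simp
  have A_cont: "continuous_on (closure \<Omega>) (\<lambda>x. A x $ i $ j)" for i j
    by (rule smooth_on_closed_continuous[OF A_smooth])
  obtain B where B: "0 < B" "\<And>x q. x \<in> \<Omega> \<Longrightarrow> norm (A x *v q) \<le> B * norm q"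
    using matrix_field_bound[of \<Omega> A] A_cont \<Omega>(2) by metis
  have ell: "\<omega> * (norm \<xi>)\<^sup>2 \<le> (A x *v \<xi>) \<bullet> \<xi>" if "x \<in> \<Omega>" for x \<xi>
  proof -
    have "(norm \<xi>)\<^sup>2 = (\<Sum>i\<in>UNIV. (\<xi> $ i)\<^sup>2)"
      unfolding power2_norm_eq_inner inner_vec_def by (simp add: power2_eq_square)
    thus ?thesis unfolding quadratic_form_inner using A_elliptic[of x \<xi>] that closure_subset[of \<Omega>] by auto
  qed
  have h_cont: "continuous_on {-1..1} h"
    using h(1) by (auto simp: C1_on_interval_def intro: DERIV_continuous_on)
  note gh = m(1) g b g_growth h_cont h(2,3) g_lower g_upper
  have wsol: "weak_solution \<Omega> A \<gamma> g p m u0 u1 T u u'" if "0 < T" for T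
    using sol that by (simp add: global_weak_solution_def)
  have u_cont: "cont_curve T (H10 \<Omega>) (H1_norm \<Omega>) u"
    and v_cont: "cont_curve T (Lspace 2 \<Omega>) (Lnorm 2 \<Omega>) u'" if "0 < T" for T
    using wsol[OF that] by (auto simp: weak_solution_def)
  have uH: "u t \<in> H10 \<Omega>" and vL: "u' t \<in> Lspace 2 \<Omega>" if "0 \<le> t" for t
    using u_cont[of "t + 1"] v_cont[of "t + 1"] that by (auto simp: cont_curve_def)
  have uH1: "u t \<in> H1 \<Omega>" if "0 \<le> t" for t using uH[OF that] by (simp add: H10_def)

  \<comment> \<open>Scalar quantities along the solution\<close>
  define a where "a t = form_a \<Omega> A (u t) (u t)" for t
  define K where "K t = (Lnorm 2 \<Omega> (u' t))\<^sup>2" for t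
  define N where "N t = (\<integral>x. \<bar>u t x\<bar> powr (p + 1) \<partial>lebesgue_on \<Omega>)" for t
  define W where "W t = (\<integral>x. (norm (weak_grad \<Omega> (u t) x))\<^sup>2 \<partial>lebesgue_on \<Omega>)" for t
  define P where "P s = (\<integral>x. g (u' s x) * u' s x \<partial>lebesgue_on \<Omega>)" for s
  define D where "D s = (\<integral>x. \<gamma> s * g (u' s x) * u' s x \<partial>lebesgue_on \<Omega>)" for s
  define G where "G s = (\<integral>x. \<gamma> s * g (u' s x) * u s x \<partial>lebesgue_on \<Omega>)" for s
  define X where "X t = L2_inner \<Omega> (u' t) (u t)" for t
  define E where "E t = total_energy \<Omega> A p (u t) (u' t)" for t

  have E_eq: "E t = K t / 2 + a t / 2 - N t / (p + 1)" for t
    using p1 by (simp add: E_def total_energy_def quadratic_energy_def Lnorm_powr K_def a_def N_def)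
  have W_nonneg: "0 \<le> W t" for t unfolding W_def by (intro integral_nonneg_AE) auto
  have N_nonneg: "0 \<le> N t" for t unfolding N_def by (intro integral_nonneg_AE) auto
  have a_lower: "\<omega> * W t \<le> a t" if "0 \<le> t" for t
    using form_a_lower[OF A_cont \<Omega>(1) B uH1[OF that] ell] by (simp add: W_def a_def)
  have a_nonneg: "0 \<le> a t" if "0 \<le> t" for t
    using a_lower[OF that] mult_nonneg_nonneg[OF less_imp_le[OF \<omega>_pos] W_nonneg[of t]] by linarith
  have a_cont: "continuous_on {0..T} a" if "0 < T" for T
    using form_a_continuous[OF A_cont \<Omega>(1) B u_cont[OF that]] by (simp add: a_def[abs_def])
  have a_cont: "continuous_on {0..T} a" for T
    using continuous_on_subset[OF a_cont[of "max T 1"], of "{0..T}"] by auto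
  have K_cont: "continuous_on {0..T} K" if "0 < T" for T
    using Lnorm_2_squared_continuous[OF v_cont[OF that]] by (simp add: K_def[abs_def])
  have K_cont: "continuous_on {0..T} K" for T
    using continuous_on_subset[OF K_cont[of "max T 1"], of "{0..T}"] by auto

  \<comment> \<open>The tested equation and integrability in time\<close>
  have \<gamma>_meas: "\<gamma> \<in> borel_measurable (lebesgue_on {0<..<T})" if "0 < T" for T
    using \<gamma>(1) that by (auto simp: W1inf_loc_half_line_def Linf_space_def)
  obtain \<gamma>1 where \<gamma>1: "0 < \<gamma>1" "\<And>t. 0 \<le> t \<Longrightarrow> \<bar>\<gamma> t\<bar> \<le> \<gamma>1"
    using \<gamma>(2) by (auto simp: bounded_pos)
  obtain c where c: "\<And>s. \<bar>g s\<bar> \<le> c * (1 + \<bar>s\<bar> powr m)"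
    using damping_growth[OF gh] by blast

  \<comment> \<open>Continuity gives a bound on each bounded time interval. A bound for all times
    comes from the well, which presupposes a nonincreasing energy and hence integrability of the
    dissipation, obtained with the present bound.\<close>
  have W_bd: "\<exists>W1. \<forall>t\<in>{0..T}. W t \<le> W1" for T
  proof -
    have "bounded (a ` {0..T})" by (intro compact_imp_bounded compact_continuous_image a_cont) auto
    then obtain c where c: "\<And>t. t \<in> {0..T} \<Longrightarrow> \<bar>a t\<bar> \<le> c"
      unfolding bounded_iff by (metis imageI real_norm_def)
    have "W t \<le> c / \<omega>" if "t \<in> {0..T}" for t
      using a_lower[of t] c[OF that] that \<omega>_pos by (simp add: field_simps)
    thus ?thesis by blast
  qed
  have tested: "AE s in lebesgue_on {0..T}. integrable (lebesgue_on \<Omega>) (\<lambda>x. g (u' s x) * u' s x)"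
    "AE s in lebesgue_on {0..T}. integrable (lebesgue_on \<Omega>) (\<lambda>x. g (u' s x) * u s x)"
    "integrable (lebesgue_on {0..T}) D" "integrable (lebesgue_on {0..T}) G"
    "\<And>t. t \<in> {0..T} \<Longrightarrow> X t - X 0 + (\<integral>s. a s \<partial>lebesgue_on {0..t}) - (\<integral>s. K s \<partial>lebesgue_on {0..t})
        + (\<integral>s. G s \<partial>lebesgue_on {0..t}) = (\<integral>s. N s \<partial>lebesgue_on {0..t})" if T: "0 < T" for T
  proof -
    obtain W1 where W1: "\<And>t. t \<in> {0..T} \<Longrightarrow> W t \<le> W1" using W_bd by blast
    note ws = weak_solution_tested[OF wsol[OF T] \<Omega> m(1,2) \<gamma>_meas[OF T] \<gamma>1(2) g(1) c W1[unfolded W_def]]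
    show "AE s in lebesgue_on {0..T}. integrable (lebesgue_on \<Omega>) (\<lambda>x. g (u' s x) * u' s x)"
      "AE s in lebesgue_on {0..T}. integrable (lebesgue_on \<Omega>) (\<lambda>x. g (u' s x) * u s x)"
      by (rule ws(1), assumption+) (rule ws(2), assumption+)
    show "integrable (lebesgue_on {0..T}) D" "integrable (lebesgue_on {0..T}) G"
      unfolding D_def[abs_def] G_def[abs_def] by (rule ws(3), assumption+) (rule ws(4), assumption+)
    show "X t - X 0 + (\<integral>s. a s \<partial>lebesgue_on {0..t}) - (\<integral>s. K s \<partial>lebesgue_on {0..t})
        + (\<integral>s. G s \<partial>lebesgue_on {0..t}) = (\<integral>s. N s \<partial>lebesgue_on {0..t})" if "t \<in> {0..T}" for t
      unfolding X_def a_def[abs_def] K_def[abs_def] G_def[abs_def] N_def[abs_def]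
      by (rule weak_solution_tested(5)[OF wsol[OF T] \<Omega> m(1,2) \<gamma>_meas[OF T] \<gamma>1(2) g(1) c W1[unfolded W_def] that])
  qed
  have int_any: "integrable (lebesgue_on {0..T}) f" if "\<And>T. 0 < T \<Longrightarrow> integrable (lebesgue_on {0..T}) f" for f :: "real \<Rightarrow> real" and T
    using integrable_on_subinterval_lebesgue_on(1)[OF that[of "max T 1"], of 0 T] by simp
  have D_int: "integrable (lebesgue_on {0..T}) D" for T by (rule int_any[OF tested(3)])
  have G_int: "integrable (lebesgue_on {0..T}) G" for T by (rule int_any[OF tested(4)])
  have leb: "(\<integral>s. f s \<partial>lebesgue_on {0..t}) = integral {0..t} f" if "\<And>T. integrable (lebesgue_on {0..T}) f"
    for f :: "real \<Rightarrow> real" and t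
    by (rule lebesgue_integral_eq_integral[OF that]) auto
  have cont_int: "integrable (lebesgue_on {0..T}) f" if "continuous_on {0..T} f" for f :: "real \<Rightarrow> real" and T
    using absolutely_integrable_continuous_real[OF that]
    by (rule absolutely_integrable_imp_integrable) auto
  have energy: "E t + integral {0..t} D = E 0" if "0 \<le> t" for t
  proof -
    have "E t + (\<integral>s. D s \<partial>lebesgue_on {0..t}) = E 0"
      using energy_id that unfolding energy_identity_def E_def D_def[abs_def] by blast
    thus ?thesis by (simp only: leb[OF D_int])
  qed
  \<comment> \<open>The energy identity expresses \<open>N\<close> through \<open>K\<close>,
    \<open>a\<close> and the indefinite integral of \<open>D\<close>, all of which are continuous in
    time.\<close>
  have N_int: "integrable (lebesgue_on {0..T}) N" for T
  proof (rule cont_int)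
    have "continuous_on {0..T} (\<lambda>t. integral {0..t} D)"
      by (rule indefinite_integral_continuous_1) (rule integrable_on_lebesgue_on[OF D_int], simp)
    hence "continuous_on {0..T} (\<lambda>t. (p + 1) * (K t / 2 + a t / 2 - (E 0 - integral {0..t} D)))"
      by (intro continuous_intros K_cont a_cont) auto
    moreover have "(p + 1) * (K t / 2 + a t / 2 - (E 0 - integral {0..t} D)) = N t" if "t \<in> {0..T}" for t
      using energy[of t] that p1 by (simp add: E_eq[of t] field_simps)
    ultimately show "continuous_on {0..T} N" by (simp cong: continuous_on_cong_simp)
  qed
  have a_int: "integrable (lebesgue_on {0..T}) a" and K_int: "integrable (lebesgue_on {0..T}) K" for T
    by (rule cont_int[OF a_cont], rule cont_int[OF K_cont])
  have ident: "X t - X 0 + integral {0..t} a - integral {0..t} K + integral {0..t} G = integral {0..t} N"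
    if t: "0 \<le> t" for t
    using tested(5)[of "t + 1" t] t by (simp add: leb a_int K_int G_int N_int)

  \<comment> \<open>Monotonicity of the energy and the potential well\<close>
  have D_P: "D s = \<gamma> s * P s" for s by (simp add: D_def P_def mult.assoc)
  have g_nonneg: "0 \<le> g y * y" for y by (rule damping_nonneg[OF gh])
  have P_nonneg: "0 \<le> P s" for s
    unfolding P_def by (intro integral_nonneg_AE AE_I2 g_nonneg)
  have D_nonneg: "0 \<le> D s" if "0 \<le> s" for s using \<gamma>(3)[OF that] P_nonneg by (simp add: D_P)
  have P_le: "P s \<le> D s / \<gamma>0" if "0 \<le> s" for s
    using mult_right_mono[OF \<gamma>0(2)[OF that] P_nonneg[of s]] \<gamma>0(1) by (simp add: D_P field_simps)
  have E_mono: "E t \<le> E s" if "0 \<le> s" "s \<le> t" for s t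
  proof -
    have "integral {0..s} D \<le> integral {0..t} D"
      using that D_nonneg integrable_on_lebesgue_on[OF D_int] by (intro integral_subset_le) auto
    thus ?thesis using energy[of s] energy[of t] that by simp
  qed

  have "E 0 = total_energy \<Omega> A p u0 u1"
    unfolding E_def using wsol[of 1] by (intro total_energy_AE_cong \<Omega>) (auto simp: weak_solution_def)
  note E0' = E0[folded this]
  have "a 0 = form_a \<Omega> A u0 u0"
    unfolding a_def form_a_def using wsol[of 1] weak_grad_AE_cong[OF _ \<Omega>(1), of "u 0" u0]
    by (simp add: weak_solution_def)
  note a0' = a0[folded this]
  obtain \<delta> where \<delta>: "0 < \<delta>" "\<And>t. 0 \<le> t \<Longrightarrow> N t \<le> (1 - \<delta>) * a t"
    using source_below_form[of \<Omega> p \<omega> M u N a "\<lambda>t. K t / 2" "E 0", OF \<Omega> p(1) p6 \<omega>_pos M uH N_def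
      a_lower[unfolded W_def Lnorm_2_squared[symmetric]] a_cont _ _ E0' a0'] E_mono[of 0] E_eq
    by (force simp: K_def)

  \<comment> \<open>What is left of the coefficient \<open>1 / 2\<close> of \<open>a\<close> once
    the source, at most \<open>a t / (p + 1)\<close>, is subtracted; this makes the energy control
    both \<open>K\<close> and \<open>a\<close>.\<close>
  define e where "e = 1 / 2 - 1 / (p + 1)"
  have e: "0 < e" using p by (simp add: e_def field_simps)
  have E_lower: "K t / 2 + e * a t \<le> E t" if t: "0 \<le> t" for t
  proof -
    have "0 \<le> \<delta> * a t" using \<delta>(1) a_nonneg[OF t] by simp
    hence "N t \<le> a t" using \<delta>(2)[OF t] by (simp add: left_diff_distrib)
    hence "N t / (p + 1) \<le> a t / (p + 1)" using p1 by (intro divide_right_mono) auto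
    thus ?thesis unfolding E_eq[of t] by (simp add: e_def left_diff_distrib)
  qed
  have K_nonneg: "0 \<le> K t" for t by (simp add: K_def)
  have E_nonneg: "0 \<le> E t" if "0 \<le> t" for t
    using E_lower[OF that] K_nonneg[of t] mult_nonneg_nonneg[OF less_imp_le[OF e] a_nonneg[OF that]] by linarith
  have E_upper: "E t \<le> (K t + a t) / 2" if "0 \<le> t" for t
    using E_eq[of t] N_nonneg[of t] p1 by (simp add: add_divide_distrib)
  have a_le: "a t \<le> E t / e" if "0 \<le> t" for t
    using E_lower[OF that] K_nonneg[of t] e by (simp add: field_simps)
  have W_le: "W t \<le> a t / \<omega>" if "0 \<le> t" for t
    using a_lower[OF that] \<omega>_pos by (simp add: field_simps)

  \<comment> \<open>Bounds by the energy, uniform in time\<close>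
  define CS where "CS = measure lebesgue \<Omega> + 32768"
  have CS: "0 < CS" by (simp add: CS_def add_nonneg_pos)
  note sob = sobolev_H10[OF uH \<Omega>, folded W_def CS_def]
  have u2: "(\<integral>x. (u t x)\<^sup>2 \<partial>lebesgue_on \<Omega>) \<le> CS * W t" if t: "0 \<le> t" for t
    using sob(2)[OF t, of 2] W_nonneg[of t] by simp
  have X_bound: "\<bar>X t\<bar> \<le> (1 + CS / (2 * \<omega> * e)) * E t" if t: "0 \<le> t" for t
  proof -
    have uL: "u t \<in> Lspace 2 \<Omega>" using H1_weak_grad(1)[OF uH1[OF t] \<Omega>(1)] .
    have "\<bar>X t\<bar> \<le> 1 / 2 * K t + 1 / 2 * (\<integral>x. (u t x)\<^sup>2 \<partial>lebesgue_on \<Omega>)"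
      using Lspace_2_inner(2)[OF vL[OF t] uL] by (simp add: X_def L2_inner_def K_def Lnorm_2_squared)
    also have "\<dots> \<le> E t + 1 / 2 * (CS * (E t / e / \<omega>))"
    proof (intro add_mono mult_left_mono)
      show "1 / 2 * K t \<le> E t" using E_lower[OF t] mult_nonneg_nonneg[OF less_imp_le[OF e] a_nonneg[OF t]] by simp
      have "CS * W t \<le> CS * (E t / e / \<omega>)"
        using W_le[OF t] divide_right_mono[OF a_le[OF t], of \<omega>] \<omega>_pos CS by (intro mult_left_mono) auto
      thus "(\<integral>x. (u t x)\<^sup>2 \<partial>lebesgue_on \<Omega>) \<le> CS * (E t / e / \<omega>)" using u2[OF t] by linarith
    qed auto
    also have "\<dots> = (1 + CS / (2 * \<omega> * e)) * E t" using e \<omega>_pos by (simp add: field_simps)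
    finally show ?thesis .
  qed

  define Wm where "Wm = E 0 / e / \<omega>"
  have Wm: "W t \<le> Wm" if t: "0 \<le> t" for t
  proof -
    have "a t \<le> E 0 / e" using a_le[OF t] divide_right_mono[OF E_mono[OF order_refl t], of e] e by linarith
    thus ?thesis using W_le[OF t] divide_right_mono[of "a t" "E 0 / e" \<omega>] \<omega>_pos by (simp add: Wm_def)
  qed
  \<comment> \<open>The power \<open>m + 1\<close> of \<open>u\<close> may exceed the quadratic
    order of \<open>a\<close>; the excess \<open>W t powr ((m - 1) / 2)\<close> is bounded through
    \<open>Wm\<close>, by which the initial energy enters the constant.\<close>
  define c5 where "c5 = CS * (1 + Wm powr ((m - 1) / 2)) / \<omega>"
  have c5: "0 < c5" using CS \<omega>_pos by (simp add: c5_def add_pos_nonneg)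
  have um: "(\<integral>x. (u t x)\<^sup>2 \<partial>lebesgue_on \<Omega>) + (\<integral>x. \<bar>u t x\<bar> powr (m + 1) \<partial>lebesgue_on \<Omega>) \<le> c5 * a t"
    if t: "0 \<le> t" for t
  proof -
    have "(\<integral>x. \<bar>u t x\<bar> powr (m + 1) \<partial>lebesgue_on \<Omega>) \<le> CS * W t powr ((m + 1) / 2)"
      using m by (intro sob(2)[OF t]) auto
    also have "W t powr ((m + 1) / 2) = W t powr (1 + (m - 1) / 2)" by (simp add: field_simps)
    also have "\<dots> = W t * W t powr ((m - 1) / 2)" using W_nonneg[of t] by (simp add: powr_add)
    also have "CS * \<dots> \<le> CS * (W t * Wm powr ((m - 1) / 2))"
      using CS W_nonneg[of t] Wm[OF t] m by (intro mult_left_mono powr_mono2) auto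
    finally have "(\<integral>x. (u t x)\<^sup>2 \<partial>lebesgue_on \<Omega>) + (\<integral>x. \<bar>u t x\<bar> powr (m + 1) \<partial>lebesgue_on \<Omega>)
        \<le> CS * (1 + Wm powr ((m - 1) / 2)) * W t"
      using u2[OF t] by (simp add: algebra_simps)
    also have "\<dots> \<le> CS * (1 + Wm powr ((m - 1) / 2)) * (a t / \<omega>)"
      using W_le[OF t] CS by (intro mult_left_mono) (auto intro!: mult_nonneg_nonneg add_nonneg_nonneg)
    finally show ?thesis by (simp add: c5_def)
  qed

  \<comment> \<open>Kinetic energy and damping at a free level\<close>
  define \<eta> where "\<eta> = \<delta> / (2 * \<gamma>1 * c5)"
  have \<eta>: "0 < \<eta>" using \<delta>(1) \<gamma>1(1) c5 by (simp add: \<eta>_def)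
  \<comment> \<open>By the choice of \<open>\<eta>\<close>, the product
    \<open>\<gamma>1 * \<eta> * c5\<close> is \<open>\<delta> / 2\<close>, half of the margin left
    by the well.\<close>
  obtain C\<eta> where C\<eta>: "0 < C\<eta>" "\<And>r v w. 0 < r \<Longrightarrow> r \<le> 1 \<Longrightarrow>
      \<bar>g v * w\<bar> \<le> \<eta> * (w\<^sup>2 + \<bar>w\<bar> powr (m + 1)) + C\<eta> * (r\<^sup>2 + g v * v / h r)"
    using damping_product[OF gh \<eta>] by blast
  have h_r: "0 < h r \<and> h r \<le> 1" if "0 < r" "r \<le> 1" for r
    using h_pos[OF gh that] h_le_one[OF gh, of r] that by simp
  define \<mu> where "\<mu> = measure lebesgue \<Omega> + 1 / \<gamma>0"
  have \<mu>: "0 < \<mu>" using \<gamma>0(1) by (simp add: \<mu>_def add_nonneg_pos)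
  \<comment> \<open>The lower bound \<open>\<gamma>0\<close> passes from \<open>P\<close> to the
    dissipation \<open>D\<close> of the energy identity; the volume and dissipation terms are merged
    under one factor, the form the window inequality takes.\<close>
  have rP: "r\<^sup>2 * measure lebesgue \<Omega> + k * (P s / h r) \<le> (measure lebesgue \<Omega> + k / \<gamma>0) * (r\<^sup>2 + D s / h r)"
    if r: "0 < r" "r \<le> 1" and s: "0 \<le> s" and k: "0 \<le> k" for r s k
  proof -
    have d: "0 \<le> D s / h r" using D_nonneg[OF s] h_r[OF r] by simp
    have "P s / h r \<le> D s / \<gamma>0 / h r" using P_le[OF s] h_r[OF r] by (intro divide_right_mono) auto
    also have "\<dots> = 1 / \<gamma>0 * (D s / h r)" by simp
    finally have "k * (P s / h r) \<le> k * (1 / \<gamma>0 * (D s / h r))" using k by (rule mult_left_mono)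
    also have "\<dots> = k / \<gamma>0 * (D s / h r)" by simp
    finally have 1: "k * (P s / h r) \<le> k / \<gamma>0 * (D s / h r)" .
    have "0 \<le> k / \<gamma>0 * r\<^sup>2" "0 \<le> measure lebesgue \<Omega> * (D s / h r)"
      by (intro mult_nonneg_nonneg divide_nonneg_pos zero_le_power2 k \<gamma>0(1) d measure_nonneg)+
    moreover have "(measure lebesgue \<Omega> + k / \<gamma>0) * (r\<^sup>2 + D s / h r) =
        r\<^sup>2 * measure lebesgue \<Omega> + k / \<gamma>0 * (D s / h r) + (k / \<gamma>0 * r\<^sup>2 + measure lebesgue \<Omega> * (D s / h r))"
      by (simp only: distrib_left distrib_right mult.commute[of "measure lebesgue \<Omega>" "r\<^sup>2"])
    ultimately show ?thesis using 1 by linarith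
  qed
  define k1 where "k1 = 1 + 1 / b1"
  have k1: "0 < k1" using b by (simp add: k1_def add_pos_pos)
  have kin: "y\<^sup>2 \<le> r\<^sup>2 + k1 * (g y * y / h r)" if "0 < r" "r \<le> 1" for r y
    unfolding k1_def by (rule kinetic_le_damping[OF gh that])
  have bounds: "AE s in lebesgue_on {0..T}. K s \<le> (measure lebesgue \<Omega> + k1 / \<gamma>0) * (r\<^sup>2 + D s / h r) \<and>
      \<bar>G s\<bar> \<le> \<delta> / 2 * a s + \<gamma>1 * C\<eta> * \<mu> * (r\<^sup>2 + D s / h r)"
    if r: "0 < r" "r \<le> 1" and T: "0 < T" for r T
  proof -
    have "AE s in lebesgue_on {0..T}. s \<in> {0..T}" by (intro AE_I2) simp
    with tested(1,2)[OF T] show ?thesis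
    proof eventually_elim
      case (elim s)
      hence s: "0 \<le> s" by simp
      have uL: "u s \<in> Lspace 2 \<Omega>" using H1_weak_grad(1)[OF uH1[OF s] \<Omega>(1)] .
      have um_int: "integrable (lebesgue_on \<Omega>) (\<lambda>x. \<bar>u s x\<bar> powr (m + 1))"
        using m by (intro sob(1)[OF s]) auto
      note est = damping_estimates[where g = g and h = h and m = m and r = r and ?k1.0 = k1 and ?k2.0 = C\<eta> and \<eta> = \<eta>
          and v = "u' s" and w = "u s", OF S elim(1,2) vL[OF s] uL um_int kin[OF r] C\<eta>(2)[OF r], folded P_def]
      have "K s \<le> r\<^sup>2 * measure lebesgue \<Omega> + k1 * (P s / h r)"
        using est(1) by (simp add: K_def Lnorm_2_squared)
      also have "\<dots> \<le> (measure lebesgue \<Omega> + k1 / \<gamma>0) * (r\<^sup>2 + D s / h r)"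
        using rP[OF r s, of k1] k1 by simp
      finally have 1: "K s \<le> (measure lebesgue \<Omega> + k1 / \<gamma>0) * (r\<^sup>2 + D s / h r)" .
      have "G s = \<gamma> s * (\<integral>x. g (u' s x) * u s x \<partial>lebesgue_on \<Omega>)" by (simp add: G_def mult.assoc)
      hence "\<bar>G s\<bar> \<le> \<gamma>1 * \<bar>\<integral>x. g (u' s x) * u s x \<partial>lebesgue_on \<Omega>\<bar>"
        using \<gamma>1(2)[OF s] by (simp add: abs_mult mult_right_mono)
      also have "\<dots> \<le> \<gamma>1 * (\<integral>x. \<bar>g (u' s x) * u s x\<bar> \<partial>lebesgue_on \<Omega>)"
        using \<gamma>1(1) by (intro mult_left_mono integral_abs_bound) auto
      also have "\<dots> \<le> \<gamma>1 * (\<eta> * (c5 * a s) + C\<eta> * (\<mu> * (r\<^sup>2 + D s / h r)))"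
      proof (intro mult_left_mono)
        have "\<eta> * ((\<integral>x. (u s x)\<^sup>2 \<partial>lebesgue_on \<Omega>) + (\<integral>x. \<bar>u s x\<bar> powr (m + 1) \<partial>lebesgue_on \<Omega>)) \<le> \<eta> * (c5 * a s)"
          using um[OF s] \<eta> by (intro mult_left_mono) auto
        moreover have "C\<eta> * (r\<^sup>2 * measure lebesgue \<Omega> + P s / h r) \<le> C\<eta> * (\<mu> * (r\<^sup>2 + D s / h r))"
          using rP[OF r s, of 1] C\<eta>(1) by (intro mult_left_mono) (auto simp: \<mu>_def)
        ultimately show "(\<integral>x. \<bar>g (u' s x) * u s x\<bar> \<partial>lebesgue_on \<Omega>)
            \<le> \<eta> * (c5 * a s) + C\<eta> * (\<mu> * (r\<^sup>2 + D s / h r))"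
          using est(2) by linarith
      qed (use \<gamma>1 in auto)
      also have "\<dots> = \<gamma>1 * \<eta> * c5 * a s + \<gamma>1 * C\<eta> * \<mu> * (r\<^sup>2 + D s / h r)"
        by (simp only: distrib_left mult.assoc)
      also have "\<gamma>1 * \<eta> * c5 = \<delta> / 2" using \<gamma>1(1) c5 by (simp add: \<eta>_def)
      finally show ?case using 1 by blast
    qed
  qed
  \<comment> \<open>The same bounds for every real \<open>T\<close>, by restriction from
    \<open>[0, max T 1]\<close>; the tested equation is available for positive lengths.\<close>
  have bounds: "AE s in lebesgue_on {0..T}. K s \<le> (measure lebesgue \<Omega> + k1 / \<gamma>0) * (r\<^sup>2 + D s / h r) \<and>
      \<bar>G s\<bar> \<le> \<delta> / 2 * a s + \<gamma>1 * C\<eta> * \<mu> * (r\<^sup>2 + D s / h r)"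
    if r: "0 < r" "r \<le> 1" for r T
  proof -
    have sets: "{0..max T 1} \<in> sets lebesgue" and pos: "0 < max T 1" by auto
    have "AE s in lebesgue. s \<in> {0..max T 1} \<longrightarrow> K s \<le> (measure lebesgue \<Omega> + k1 / \<gamma>0) * (r\<^sup>2 + D s / h r) \<and>
        \<bar>G s\<bar> \<le> \<delta> / 2 * a s + \<gamma>1 * C\<eta> * \<mu> * (r\<^sup>2 + D s / h r)"
      using bounds[OF r pos] unfolding AE_lebesgue_on_iff[OF sets] .
    thus ?thesis by (subst AE_lebesgue_on_iff) (auto elim: eventually_mono)
  qed

  \<comment> \<open>From the window inequality to the decay rate\<close>
  have "\<exists>T>0. \<exists>C>0. \<forall>t\<ge>0. \<forall>r. 0 < r \<and> r \<le> 1 \<longrightarrow> E (t + T) \<le> C * (r\<^sup>2 + (E t - E (t + T)) / h r)"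
  proof (rule energy_window_inequality[where a = a and K = K and N = N and D = D and G = G and X = X and \<delta> = \<delta>
        and c = "1 + CS / (2 * \<omega> * e)" and ?c1.0 = "measure lebesgue \<Omega> + k1 / \<gamma>0" and ?c2.0 = "\<gamma>1 * C\<eta> * \<mu>"])
    show "0 \<le> 1 + CS / (2 * \<omega> * e)" using CS \<omega>_pos e by simp
    show "0 < measure lebesgue \<Omega> + k1 / \<gamma>0" using k1 \<gamma>0(1) by (simp add: add_nonneg_pos)
    show "0 < \<gamma>1 * C\<eta> * \<mu>" using \<gamma>1(1) C\<eta>(1) \<mu> by simp
    show "AE s in lebesgue_on {0..T}. K s \<le> (measure lebesgue \<Omega> + k1 / \<gamma>0) * (r\<^sup>2 + D s / h r)"
      if "0 < r" "r \<le> 1" for T r using bounds[OF that, of T] by eventually_elim blast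
    show "AE s in lebesgue_on {0..T}. \<bar>G s\<bar> \<le> \<delta> / 2 * a s + \<gamma>1 * C\<eta> * \<mu> * (r\<^sup>2 + D s / h r)"
      if "0 < r" "r \<le> 1" for T r using bounds[OF that, of T] by eventually_elim blast
  qed (fact a_int K_int N_int D_int G_int D_nonneg energy ident \<delta> E_upper X_bound h_r)+
  then obtain T C where TC: "0 < T" "0 < C" "\<And>t r. 0 \<le> t \<Longrightarrow> 0 < r \<Longrightarrow> r \<le> 1 \<Longrightarrow>
      E (t + T) \<le> C * (r\<^sup>2 + (E t - E (t + T)) / h r)" by blast
  have "strict_mono_on {0..1} h" using h(2) by (rule monotone_on_subset) auto
  moreover have "h 0 = 0" by (rule h_zero[OF gh])
  moreover have "h 1 \<le> 1" by (rule h_one_le[OF gh])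
  ultimately have "\<exists>C>0. \<forall>t\<ge>1. \<forall>s\<in>{0..1}. h s * s = 1 / t \<longrightarrow> E t \<le> C * s\<^sup>2"
    by (rule decay_rate[where E = E and h = h and T = T and K = C, OF _ _ _ E_nonneg E_mono TC])
  then
  obtain C' where C': "0 < C'" "\<And>t s. 1 \<le> t \<Longrightarrow> s \<in> {0..1} \<Longrightarrow> h s * s = 1 / t \<Longrightarrow> E t \<le> C' * s\<^sup>2"
    by blast
  show ?thesis
  \<comment> \<open>Division by the initial energy, positive by hypothesis (iv), makes room for the
    factor \<open>E 0\<close> in the claim.\<close>
  proof (intro exI[of _ "C' / E 0"] conjI allI impI)
    show "0 < C' / E 0" using C'(1) E0'(1) by simp
    fix t :: real assume t: "1 \<le> t" "1 / t \<in> (\<lambda>s. h s * s) ` {0..1}"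
    let ?s = "inv_into {0..1} (\<lambda>s. h s * s) (1 / t)"
    have "E t \<le> C' * ?s\<^sup>2"
      using C'(2)[OF t(1) inv_into_into[OF t(2)]] f_inv_into_f[OF t(2)] by simp
    also have "\<dots> = C' / E 0 * E 0 * ?s\<^sup>2" using E0'(1) by simp
    finally show "total_energy \<Omega> A p (u t) (u' t) \<le> C' / E 0 * total_energy \<Omega> A p (u 0) (u' 0) * ?s\<^sup>2"
      by (simp only: E_def)
  qed
qed

end
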